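(* Let $K=1/9$ and let $\beta_n\in A_n$ for every $n$. Consider, for positive constants $B$, $E_\alpha$ (indexed by the model indices $\alpha$), $L$, $H\ge1$, $I$, and constants $\mu_{n,\alpha}$ ($\alpha\in A_n$), with $\alpha\gtrsim\beta_n$ and $\alpha<\beta_n$ defined relative to $H$, the conditions: (i) $\displaystyle \sup_{\varepsilon\ge\varepsilon_{n,\alpha}}\log N\Big(\frac{\varepsilon}{3},C_{n,\alpha}(2\varepsilon),d\Big)\le E_\alpha n\varepsilon_{n,\alpha}^2$ for all $\alpha\in A_n$; (ii) $\displaystyle \frac{\lambda_{n,\alpha}}{\lambda_{n,\beta_n}}\frac{\Pi_{n,\alpha}(C_{n,\alpha}(i\varepsilon_{n,\alpha}))}{\Pi_{n,\beta_n}(B_{n,\beta_n}(\varepsilon_{n,\beta_n}))}\le\mu_{n,\alpha}e^{Li^2n\varepsilon_{n,\alpha}^2}$ for all $\alpha<\beta_n$ and all $i\ge I$; (iii) $\displaystyle \frac{\lambda_{n,\alpha}}{\lambda_{n,\beta_n}}\frac{\Pi_{n,\alpha}(C_{n,\alpha}(i\varepsilon_{n,\beta_n}))}{\Pi_{n,\beta_n}(B_{n,\beta_n}(\varepsilon_{n,\beta_n}))}\le\mu_{n,\alpha}e^{Li^2n\varepsilon_{n,\beta_n}^2}$ for all $\alpha\gtrsim\beta_n$ and all $i\ge I$; (iv) $\displaystyle \sum_{\alpha\in A_n:\alpha<\beta_n}\frac{\lambda_{n,\alpha}}{\lambda_{n,\beta_n}}\frac{\Pi_{n,\alpha}(C_{n,\alpha}(IB\varepsilon_{n,\alpha}))}{\Pi_{n,\beta_n}(B_{n,\beta_n}(\varepsilon_{n,\beta_n}))}=o\big(e^{-2n\varepsilon_{n,\beta_n}^2}\big)$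 as $n\to\infty$. (A) Suppose that $n\varepsilon_{n,\beta_n}^2\to\infty$; that (i)–(iv) hold for some such constants with $I>2$; that there are constants $E$ and $\underline E$ with $E\ge\sup_{\alpha\in A_n:\alpha\gtrsim\beta_n}E_\alpha\varepsilon_{n,\alpha}^2/\varepsilon_{n,\beta_n}^2$ and $\underline E\ge\sup_{\alpha\in A_n:\alpha<\beta_n}E_\alpha$ (with $\underline E=0$ if there is no $\alpha\in A_n$ with $\alpha<\beta_n$), such that $B>\sqrt H$, $KB^2>((H\underline E)\vee E)+1$ and $B^2I^2(K-2L)>3$; and that $\sum_{\alpha\in A_n}\sqrt{\mu_{n,\alpha}}\le\exp[n\varepsilon_{n,\beta_n}^2]$. Then, as $n\to\infty$, $$P_0^n\Pi_n\big(\{\alpha\in A_n:\alpha<\beta_n\}\,\big|\,X_1,\dots,X_n\big)\to0,$$ $$P_0^n\Pi_n\big(\{\alpha\in A_n:\alpha\gtrsim\beta_n,\ d(p_0,\mathcal P_{n,\alpha})>IB\,\varepsilon_{n,\beta_n}\}\,\big|\,X_1,\dots,X_n\big)\to0.$$ (B) Suppose that $\varepsilon_{n,\beta_n}=1/\sqrt n$; that there exist positive constants $B$, $E_\alpha$, $L<K/2$, $H\ge1$ and constants $\mu_{n,\alpha}$ such that (i)–(iv) hold for every sufficiently large $I$; and that $\sum_{\alpha\in A_n}\sqrt{\mu_{n,\alpha}}=O(1)$. Then the two convergences in (A) hold with $IB$ replaced by $I_n$, for any sequence $I_n\to\infty$.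
   Context: Setting. $X_1,\dots,X_n$ is an i.i.d. sample from a probability measure $P_0$ on a measurable space $(\mathcal X,\mathcal A)$ with density $p_0$ relative to a reference measure $\mu$. In general $p$ and $P$ denote a density and the corresponding probability measure; $Pf=\int f\,dP$, and $P_0^n T$ denotes the expectation of $T(X_1,\dots,X_n)$ under $P_0^n$. The Hellinger distance is $h(p,q)=\|\sqrt p-\sqrt q\|_2$ (norm of $L_2(\mu)$). $d$ is a metric on the set of probability densities that is bounded above by $h$ and whose balls are convex; $d(p_0,\mathcal P)=\inf_{p\in\mathcal P}d(p_0,p)$. $N(\varepsilon,\mathcal P,d)$ is the $\varepsilon$-covering number of the metric space $(\mathcal P,d)$: the minimal number of balls of radius $\varepsilon$ needed to cover $\mathcal P$. For each $n$: $A_n$ is a countable set; for each $\alpha\in A_n$, $\mathcal P_{n,\alpha}$ is a set of $\mu$-probability densities with a $\sigma$-field making $(x,p)\mapsto p(x)$ measurable, $\Pi_{n,\alpha}$ is a probability measure on $\mathcal P_{n,\alpha}$; and $\lambda_n=(\lambda_{n,\alpha}:\alpha\in A_n)$ is a probability measure on $A_n$. The posterior distribution of the model index is, for $S\subset A_n$, $$\Pi_n(S|X_1,\dots,X_n)=\frac{\sum_{\alpha\in S}\lambda_{n,\alpha}\int\prod_{i=1}^np(X_i)\,d\Pi_{n,\alpha}(p)}{\sum_{\alpha\in A_n}\lambda_{n,\alpha}\int\prod_{i=1}^np(X_i)\,d\Pi_{n,\alpha}(p)},$$ with appropriate measurability assumed so that this is well defined. Neighbourhoods: $$B_{n,\alpha}(\varepsilon)=\Big\{p\in\mathcal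 P_{n,\alpha}:-P_0\log\frac p{p_0}\le\varepsilon^2,\ P_0\Big(\log\frac p{p_0}\Big)^2\le\varepsilon^2\Big\},\quad C_{n,\alpha}(\varepsilon)=\{p\in\mathcal P_{n,\alpha}:d(p,p_0)\le\varepsilon\}.$$ $\varepsilon_{n,\alpha}>0$ are given numbers with $\varepsilon_{n,\alpha}\to0$ as $n\to\infty$. For given $\beta_n\in A_n$ and a constant $H\ge1$, and $\alpha\in A_n$: $\alpha\gtrsim\beta_n$ means $\varepsilon_{n,\alpha}^2\le H\varepsilon_{n,\beta_n}^2$, and $\alpha<\beta_n$ means $\varepsilon_{n,\alpha}^2>H\varepsilon_{n,\beta_n}^2$ (no order on $A_n$ is assumed). Conditions involving $\alpha<\beta_n$ are understood to be automatically satisfied if there is no such $\alpha$.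
   Formalization: In (B) finite constants E and underline-E as in (A), bounding E_α ε²_{n,α}/ε²_{n,β_n} over α≳β_n and E_α over α<β_n (without the inequalities involving B, K), are also assumed; without them (B) fails, e.g. for models whose E_α grow with n. *)

theory Defs
  imports "HOL-Probability.Probability" "HOL-Library.Landau_Symbols"
begin

definition prob_densities :: "'x measure \<Rightarrow> ('x \<Rightarrow> real) set" where
  "prob_densities M = {p \<in> borel_measurable M.
     (\<forall>x\<in>space M. 0 \<le> p x) \<and> (\<integral>\<^sup>+x. ennreal (p x) \<partial>M) = 1}"

definition hellinger :: "'x measure \<Rightarrow> ('x \<Rightarrow> real) \<Rightarrow> ('x \<Rightarrow> real) \<Rightarrow> real" where
  "hellinger M p q = sqrt (\<integral>x. (sqrt (p x) - sqrt (q x))\<^sup>2 \<partial>M)"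

text \<open>
  Densities are represented by functions, but are points of a metric space only up to
  almost everywhere equality: a distance bounded by the Hellinger distance vanishes on
  every pair of almost everywhere equal densities.
\<close>

definition density_metric ::
  "'x measure \<Rightarrow> (('x \<Rightarrow> real) \<Rightarrow> ('x \<Rightarrow> real) \<Rightarrow> real) \<Rightarrow> bool" where
  "density_metric M d \<longleftrightarrow>
     (\<forall>p\<in>prob_densities M. \<forall>q\<in>prob_densities M.
        0 \<le> d p q \<and> d p q = d q p \<and> (d p q = 0 \<longleftrightarrow> (AE x in M. p x = q x))) \<and>
     (\<forall>p\<in>prob_densities M. \<forall>q\<in>prob_densities M. \<forall>r\<in>prob_densities M.
        d p r \<le> d p q + d q r)"

definition convex_balls ::
  "'x measure \<Rightarrow> (('x \<Rightarrow> real) \<Rightarrow> ('x \<Rightarrow> real) \<Rightarrow> real) \<Rightarrow> bool" where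
  "convex_balls M d \<longleftrightarrow>
     (\<forall>c\<in>prob_densities M. \<forall>p\<in>prob_densities M. \<forall>q\<in>prob_densities M. \<forall>r. \<forall>t\<in>{0..1}.
        d c p < r \<and> d c q < r \<longrightarrow> d c (\<lambda>x. (1 - t) * p x + t * q x) < r)"

text \<open>Balls are those of the metric space \<open>(S, d)\<close>, so their centres lie in \<open>S\<close>.\<close>

definition covering_number :: "real \<Rightarrow> 'b set \<Rightarrow> ('b \<Rightarrow> 'b \<Rightarrow> real) \<Rightarrow> enat" where
  "covering_number r S d =
     Inf {enat (card F) |F. finite F \<and> F \<subseteq> S \<and> S \<subseteq> (\<Union>c\<in>F. {q\<in>S. d c q < r})}"

definition metric_entropy :: "real \<Rightarrow> 'b set \<Rightarrow> ('b \<Rightarrow> 'b \<Rightarrow> real) \<Rightarrow> ereal" where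
  "metric_entropy r S d =
     (case covering_number r S d of
        enat k \<Rightarrow> (if k = 0 then - \<infinity> else ereal (ln (real k)))
      | \<infinity> \<Rightarrow> \<infinity>)"

text \<open>
  Since \<open>ln 0 = 0\<close> and non-integrable functions have Bochner integral \<open>0\<close> in HOL, the
  convention \<open>log 0 = -\<infinity>\<close> is expressed by the almost sure positivity of \<open>p\<close>, and
  finiteness of the second moment by a nonnegative integral; the latter makes
  \<open>ln (p / p0)\<close> integrable, so that the first moment is genuine.
\<close>

definition KL_nbhd ::
  "'x measure \<Rightarrow> ('x \<Rightarrow> real) \<Rightarrow> ('x \<Rightarrow> real) set \<Rightarrow> real \<Rightarrow> ('x \<Rightarrow> real) set" where
  "KL_nbhd M p0 P r = {p \<in> P.
     (AE x in density M p0. 0 < p x) \<and>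
     - (\<integral>x. ln (p x / p0 x) \<partial>density M p0) \<le> r\<^sup>2 \<and>
     (\<integral>\<^sup>+x. ennreal ((ln (p x / p0 x))\<^sup>2) \<partial>density M p0) \<le> ennreal (r\<^sup>2)}"

definition dist_nbhd ::
  "(('x \<Rightarrow> real) \<Rightarrow> ('x \<Rightarrow> real) \<Rightarrow> real) \<Rightarrow> ('x \<Rightarrow> real) \<Rightarrow>
     ('x \<Rightarrow> real) set \<Rightarrow> real \<Rightarrow> ('x \<Rightarrow> real) set" where
  "dist_nbhd d p0 P r = {p \<in> P. d p p0 \<le> r}"

definition dist_to_model ::
  "(('x \<Rightarrow> real) \<Rightarrow> ('x \<Rightarrow> real) \<Rightarrow> real) \<Rightarrow> ('x \<Rightarrow> real) \<Rightarrow> ('x \<Rightarrow> real) set \<Rightarrow> real" where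
  "dist_to_model d p0 P = (INF p\<in>P. d p0 p)"

text \<open>
  A prior \<open>Q n \<alpha>\<close> carries its model with it: the set of densities
  \<open>P\<^bsub>n,\<alpha>\<^esub>\<close> is \<open>space (Q n \<alpha>)\<close> and its \<open>\<sigma>\<close>-field is \<open>sets (Q n \<alpha>)\<close>.
\<close>

definition marginal_likelihood :: "nat \<Rightarrow> ('x \<Rightarrow> real) measure \<Rightarrow> (nat \<Rightarrow> 'x) \<Rightarrow> ennreal" where
  "marginal_likelihood n Q X = (\<integral>\<^sup>+p. (\<Prod>i<n. ennreal (p (X i))) \<partial>Q)"

definition posterior_index ::
  "nat \<Rightarrow> 'a set \<Rightarrow> 'a pmf \<Rightarrow> ('a \<Rightarrow> ('x \<Rightarrow> real) measure) \<Rightarrow> 'a set \<Rightarrow> (nat \<Rightarrow> 'x) \<Rightarrow> ennreal"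
where
  "posterior_index n A lam Q S X =
     (\<integral>\<^sup>+\<alpha>. ennreal (pmf lam \<alpha>) * marginal_likelihood n (Q \<alpha>) X \<partial>count_space S) /
     (\<integral>\<^sup>+\<alpha>. ennreal (pmf lam \<alpha>) * marginal_likelihood n (Q \<alpha>) X \<partial>count_space A)"

definition sample_measure :: "nat \<Rightarrow> 'x measure \<Rightarrow> ('x \<Rightarrow> real) \<Rightarrow> (nat \<Rightarrow> 'x) measure" where
  "sample_measure n M p0 = (\<Pi>\<^sub>M i\<in>{..<n}. density M p0)"

definition expected_posterior ::
  "'x measure \<Rightarrow> ('x \<Rightarrow> real) \<Rightarrow> (nat \<Rightarrow> 'a set) \<Rightarrow> (nat \<Rightarrow> 'a pmf) \<Rightarrow>
     (nat \<Rightarrow> 'a \<Rightarrow> ('x \<Rightarrow> real) measure) \<Rightarrow> nat \<Rightarrow> 'a set \<Rightarrow> ennreal" where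
  "expected_posterior M p0 A lam Q n S =
     (\<integral>\<^sup>+X. posterior_index n (A n) (lam n) (Q n) S X \<partial>sample_measure n M p0)"

text \<open>The indices \<open>\<alpha> \<in> A\<close> with \<open>\<alpha> < b\<close>, respectively \<open>\<alpha> \<greaterapprox> b\<close>, relative to the constant \<open>H\<close>.\<close>

definition idx_below :: "real \<Rightarrow> ('a \<Rightarrow> real) \<Rightarrow> 'a \<Rightarrow> 'a set \<Rightarrow> 'a set" where
  "idx_below H e b A = {\<alpha>\<in>A. (e \<alpha>)\<^sup>2 > H * (e b)\<^sup>2}"

definition idx_above :: "real \<Rightarrow> ('a \<Rightarrow> real) \<Rightarrow> 'a \<Rightarrow> 'a set \<Rightarrow> 'a set" where
  "idx_above H e b A = {\<alpha>\<in>A. (e \<alpha>)\<^sup>2 \<le> H * (e b)\<^sup>2}"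

text \<open>
  In HOL \<open>x / 0 = 0\<close>, so this is the intended quotient only where both denominators are positive.
\<close>

definition prior_ratio ::
  "'x measure \<Rightarrow> ('x \<Rightarrow> real) \<Rightarrow> (('x \<Rightarrow> real) \<Rightarrow> ('x \<Rightarrow> real) \<Rightarrow> real) \<Rightarrow> 'a pmf \<Rightarrow>
     ('a \<Rightarrow> ('x \<Rightarrow> real) measure) \<Rightarrow> ('a \<Rightarrow> real) \<Rightarrow> 'a \<Rightarrow> 'a \<Rightarrow> real \<Rightarrow> real" where
  "prior_ratio M p0 d lam Q e b \<alpha> r =
     pmf lam \<alpha> / pmf lam b *
     (measure (Q \<alpha>) (dist_nbhd d p0 (space (Q \<alpha>)) r) /
      measure (Q b) (KL_nbhd M p0 (space (Q b)) (e b)))"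

definition entropy_cond ::
  "('x \<Rightarrow> real) \<Rightarrow> (('x \<Rightarrow> real) \<Rightarrow> ('x \<Rightarrow> real) \<Rightarrow> real) \<Rightarrow> (nat \<Rightarrow> 'a set) \<Rightarrow>
     (nat \<Rightarrow> 'a \<Rightarrow> ('x \<Rightarrow> real) measure) \<Rightarrow> (nat \<Rightarrow> 'a \<Rightarrow> real) \<Rightarrow> ('a \<Rightarrow> real) \<Rightarrow> bool" where
  "entropy_cond p0 d A Q eps E \<longleftrightarrow>
     (\<forall>n\<ge>1. \<forall>\<alpha>\<in>A n.
        (SUP r\<in>{eps n \<alpha>..}. metric_entropy (r / 3) (dist_nbhd d p0 (space (Q n \<alpha>)) (2 * r)) d)
          \<le> ereal (E \<alpha> * real n * (eps n \<alpha>)\<^sup>2))"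

definition prior_cond_below ::
  "'x measure \<Rightarrow> ('x \<Rightarrow> real) \<Rightarrow> (('x \<Rightarrow> real) \<Rightarrow> ('x \<Rightarrow> real) \<Rightarrow> real) \<Rightarrow> (nat \<Rightarrow> 'a set) \<Rightarrow>
     (nat \<Rightarrow> 'a pmf) \<Rightarrow> (nat \<Rightarrow> 'a \<Rightarrow> ('x \<Rightarrow> real) measure) \<Rightarrow> (nat \<Rightarrow> 'a \<Rightarrow> real) \<Rightarrow> (nat \<Rightarrow> 'a) \<Rightarrow>
     real \<Rightarrow> real \<Rightarrow> real \<Rightarrow> (nat \<Rightarrow> 'a \<Rightarrow> real) \<Rightarrow> bool" where
  "prior_cond_below M p0 d A lam Q eps b H L I mu \<longleftrightarrow>
     (\<forall>n\<ge>1. \<forall>\<alpha>\<in>idx_below H (eps n) (b n) (A n). \<forall>i::nat. real i \<ge> I \<longrightarrow>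
        prior_ratio M p0 d (lam n) (Q n) (eps n) (b n) \<alpha> (real i * eps n \<alpha>)
          \<le> mu n \<alpha> * exp (L * (real i)\<^sup>2 * real n * (eps n \<alpha>)\<^sup>2))"

definition prior_cond_above ::
  "'x measure \<Rightarrow> ('x \<Rightarrow> real) \<Rightarrow> (('x \<Rightarrow> real) \<Rightarrow> ('x \<Rightarrow> real) \<Rightarrow> real) \<Rightarrow> (nat \<Rightarrow> 'a set) \<Rightarrow>
     (nat \<Rightarrow> 'a pmf) \<Rightarrow> (nat \<Rightarrow> 'a \<Rightarrow> ('x \<Rightarrow> real) measure) \<Rightarrow> (nat \<Rightarrow> 'a \<Rightarrow> real) \<Rightarrow> (nat \<Rightarrow> 'a) \<Rightarrow>
     real \<Rightarrow> real \<Rightarrow> real \<Rightarrow> (nat \<Rightarrow> 'a \<Rightarrow> real) \<Rightarrow> bool" where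
  "prior_cond_above M p0 d A lam Q eps b H L I mu \<longleftrightarrow>
     (\<forall>n\<ge>1. \<forall>\<alpha>\<in>idx_above H (eps n) (b n) (A n). \<forall>i::nat. real i \<ge> I \<longrightarrow>
        prior_ratio M p0 d (lam n) (Q n) (eps n) (b n) \<alpha> (real i * eps n (b n))
          \<le> mu n \<alpha> * exp (L * (real i)\<^sup>2 * real n * (eps n (b n))\<^sup>2))"

text \<open>
  The terms of the series are dominated by a multiple of \<open>pmf (lam n)\<close>, so the real-valued
  \<open>infsum\<close> is always a convergent sum.
\<close>

definition prior_cond_sum ::
  "'x measure \<Rightarrow> ('x \<Rightarrow> real) \<Rightarrow> (('x \<Rightarrow> real) \<Rightarrow> ('x \<Rightarrow> real) \<Rightarrow> real) \<Rightarrow> (nat \<Rightarrow> 'a set) \<Rightarrow>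
     (nat \<Rightarrow> 'a pmf) \<Rightarrow> (nat \<Rightarrow> 'a \<Rightarrow> ('x \<Rightarrow> real) measure) \<Rightarrow> (nat \<Rightarrow> 'a \<Rightarrow> real) \<Rightarrow> (nat \<Rightarrow> 'a) \<Rightarrow>
     real \<Rightarrow> real \<Rightarrow> real \<Rightarrow> bool" where
  "prior_cond_sum M p0 d A lam Q eps b H B I \<longleftrightarrow>
     (\<lambda>n. \<Sum>\<^sub>\<infinity>\<alpha>\<in>idx_below H (eps n) (b n) (A n).
        prior_ratio M p0 d (lam n) (Q n) (eps n) (b n) \<alpha> (I * B * eps n \<alpha>))
       \<in> o(\<lambda>n. exp (- 2 * real n * (eps n (b n))\<^sup>2))"

text \<open>
  The suprema are written as upper bounds because a real-valued \<open>SUP\<close> is unspecified for empty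
  or unbounded sets; the last conjunct is the convention for an empty second supremum.
\<close>

definition entropy_bounds ::
  "(nat \<Rightarrow> 'a set) \<Rightarrow> (nat \<Rightarrow> 'a \<Rightarrow> real) \<Rightarrow> (nat \<Rightarrow> 'a) \<Rightarrow> real \<Rightarrow> ('a \<Rightarrow> real) \<Rightarrow>
     real \<Rightarrow> real \<Rightarrow> bool" where
  "entropy_bounds A eps b H E E1 E2 \<longleftrightarrow>
     (\<forall>n\<ge>1. \<forall>\<alpha>\<in>idx_above H (eps n) (b n) (A n). E \<alpha> * (eps n \<alpha>)\<^sup>2 / (eps n (b n))\<^sup>2 \<le> E1) \<and>
     (\<forall>n\<ge>1. \<forall>\<alpha>\<in>idx_below H (eps n) (b n) (A n). E \<alpha> \<le> E2) \<and>
     ((\<forall>n\<ge>1. idx_below H (eps n) (b n) (A n) = {}) \<longrightarrow> E2 = 0)"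

end

theory Submission
  imports Defs
begin

text \<open>
  Testing is replaced by a direct bound on mixture likelihoods. The posterior mass of a set \<open>U\<close> of
  densities is at most \<open>min 1 x\<close>, hence at most \<open>sqrt x\<close>, where \<open>x\<close> is the mixture
  likelihood ratio of \<open>U\<close> divided by a lower bound for the evidence, so only the expectation of the
  square root of a mixture likelihood ratio has to be small. If \<open>U\<close> lies in a ball at distance
  \<open>s\<close> from \<open>p0\<close>, then convexity of the ball and \<open>d \<le> h\<close> bound the affinity between
  \<open>p0\<close> and every finite mixture over \<open>U\<close> by \<open>1 - s\<^sup>2 / 2\<close>; approximation extends this to
  the barycentre of any probability measure on \<open>U\<close>. Integrating out the observations one at a time
  yields \<open>exp (- n s\<^sup>2 / 2)\<close> times the square root of the prior mass of \<open>U\<close>. Cutting each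
  shell around \<open>p0\<close> into small balls, as allowed by the entropy condition, and summing over shells and
  models give the theorem; the evidence is bounded below by Chebyshev's inequality on the
  Kullback-Leibler neighbourhood.
\<close>

section \<open>Affinities of mixtures\<close>

text \<open>Convexity of balls speaks of finite mixtures, while conditioning on observations
  produces integral mixtures, and \<open>d c\<close> is not assumed measurable for centres other
  than \<open>p0\<close>; the passage between the two is therefore made for affinities, by sampling
  finitely many points. The exponents fit together as follows. On shell \<open>j\<close> the
  separation \<open>s = (2 * j - 1) * e / 3\<close> contributes
  \<open>- (2 * j - 1)^2 * n * e^2 / 18\<close>. The square root halves the prior exponent to
  \<open>L * (j + 1)^2 * n * e^2 / 2\<close>, halves the evidence exponent
  \<open>(1 + c) * n * eps^2\<close>, and turns \<open>mu\<close> into \<open>sqrt mu\<close>, the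
  form in which these constants are summed over the models. The central ball is not separated from
  \<open>p0\<close>; there the expectation is bounded without a square root, at the full price
  \<open>exp ((1 + c) * n * eps^2)\<close>. With \<open>c = 1\<close> this is the growth that
  \<open>prior_cond_sum\<close> absorbs. If \<open>n * eps^2 = 1\<close>, the Chebyshev error is
  \<open>2 / c^2\<close> for every \<open>n\<close>, so \<open>c\<close> and the first shell must
  depend on the desired accuracy and are fixed before \<open>n\<close> grows.\<close>

definition esqrt :: "ennreal \<Rightarrow> ennreal" where
  "esqrt x = (if x = \<top> then \<top> else ennreal (sqrt (enn2real x)))"

lemma esqrt_ennreal: "0 \<le> r \<Longrightarrow> esqrt (ennreal r) = ennreal (sqrt r)"
  by (simp add: esqrt_def)

lemma esqrt_top [simp]: "esqrt \<top> = \<top>"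
  by (simp add: esqrt_def)

lemma esqrt_0 [simp]: "esqrt 0 = 0"
  by (simp add: esqrt_def)

lemma esqrt_measurable [measurable]: "esqrt \<in> borel_measurable borel"
  unfolding esqrt_def by measurable

text \<open>Reduces order statements about \<open>esqrt\<close> to products, so that monotonicity
  and suprema need no continuity argument. Infinite arguments are included because mixture
  likelihood ratios may be infinite.\<close>

lemma esqrt_le_iff: "esqrt x \<le> z \<longleftrightarrow> x \<le> z * z"
proof (cases x; cases z)
  fix r s assume r: "0 \<le> r" "x = ennreal r" and s: "0 \<le> s" "z = ennreal s"
  have "sqrt r \<le> s \<longleftrightarrow> r \<le> s * s"
    using r(1) s(1) by (metis abs_of_nonneg real_sqrt_abs2 real_sqrt_le_iff)
  then show ?thesis
    using r s by (simp add: esqrt_ennreal ennreal_mult[symmetric])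
next
  fix s assume "x = \<top>" "0 \<le> s" "z = ennreal s"
  then show ?thesis by (simp add: ennreal_mult[symmetric] top_unique)
qed auto

lemma esqrt_mono: "x \<le> y \<Longrightarrow> esqrt x \<le> esqrt y"
  by (metis esqrt_le_iff order.refl order.trans)

lemma esqrt_mult: "esqrt (x * y) = esqrt x * esqrt y"
proof (cases x; cases y)
  fix r s assume "0 \<le> r" "x = ennreal r" "0 \<le> s" "y = ennreal s"
  then show ?thesis
    by (simp add: esqrt_ennreal ennreal_mult[symmetric] real_sqrt_mult)
next
  fix s assume "x = \<top>" "0 \<le> s" "y = ennreal s"
  then show ?thesis by (cases "s = 0") (auto simp: esqrt_ennreal ennreal_mult_top ennreal_top_mult)
next
  fix s assume "y = \<top>" "0 \<le> s" "x = ennreal s"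
  then show ?thesis by (cases "s = 0") (auto simp: esqrt_ennreal ennreal_mult_top ennreal_top_mult)
qed auto

lemma min_1_le_esqrt: "min 1 x \<le> esqrt x"
proof (cases x)
  case (real r)
  have "min 1 r \<le> sqrt r"
  proof (cases "r \<le> 1")
    case True
    have "r * r \<le> r" using True real by (simp add: mult_left_le)
    then have "r \<le> sqrt r" using real by (intro real_le_rsqrt) (simp add: power2_eq_square)
    then show ?thesis by simp
  qed (simp add: min_def)
  then have "ennreal (min 1 r) \<le> ennreal (sqrt r)" by (rule ennreal_leI)
  then show ?thesis using real by (simp add: esqrt_ennreal min_def split: if_splits)
qed simp

text \<open>
  Maurey's empirical method: the points are chosen one after the other so that the second
  moment of the accumulated deviation from the barycentre grows at most linearly.
\<close>

lemma maurey_selection: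
  fixes f :: "'x \<Rightarrow> 'p \<Rightarrow> real"
  assumes N: "prob_space N" and V: "prob_space V"
    and meas [measurable]: "case_prod f \<in> borel_measurable (N \<Otimes>\<^sub>M V)"
    and bound: "\<And>x p. 0 \<le> f x p \<and> f x p \<le> T"
    and G: "\<And>S. S \<in> sets V \<Longrightarrow> emeasure V S > 0 \<Longrightarrow> S \<inter> G \<noteq> {}"
    and "G \<subseteq> space V"
  shows "\<exists>p::nat \<Rightarrow> 'p. (\<forall>i<m. p i \<in> G) \<and>
    (\<integral>\<^sup>+x. ennreal ((\<Sum>i<m. f x (p i) - (\<integral>q. f x q \<partial>V))\<^sup>2) \<partial>N) \<le> ennreal (real m * T\<^sup>2)"
proof (induction m)
  case 0
  show ?case by simp
next
  case (Suc m)
  interpret N: prob_space N by fact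
  interpret V: prob_space V by fact
  interpret pair_prob_space N V ..
  from Suc obtain p :: "nat \<Rightarrow> 'p" where p: "\<forall>i<m. p i \<in> G"
    and le: "(\<integral>\<^sup>+x. ennreal ((\<Sum>i<m. f x (p i) - (\<integral>q. f x q \<partial>V))\<^sup>2) \<partial>N) \<le> ennreal (real m * T\<^sup>2)"
    by blast
  define c where "c x = (\<integral>q. f x q \<partial>V)" for x
  define S where "S x = (\<Sum>i<m. f x (p i) - c x)" for x
  have pV: "p i \<in> space V" if "i < m" for i using p that assms(6) by auto
  have c_meas [measurable]: "c \<in> borel_measurable N" unfolding c_def by measurable
  have T: "0 \<le> T" using bound[of undefined undefined] by linarith
  have c_bd: "0 \<le> c x \<and> c x \<le> T" if "x \<in> space N" for x
  proof -
    have "integrable V (f x)"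
      using bound that by (intro V.integrable_const_bound[where B=T]) auto
    then show ?thesis unfolding c_def
      using bound V.integral_le_const[of "f x" T] V.integral_ge_const[of "f x" 0]
      by auto
  qed
  have S_meas [measurable]: "S \<in> borel_measurable N"
    unfolding S_def using pV by (intro borel_measurable_sum borel_measurable_diff) auto
  have dev: "\<bar>f x q - c x\<bar> \<le> T" if "x \<in> space N" for x q
    using c_bd[OF that] bound[of x q] by linarith
  have S_bd: "\<bar>S x\<bar> \<le> real m * T" if "x \<in> space N" for x
  proof -
    have "\<bar>S x\<bar> \<le> (\<Sum>i<m. \<bar>f x (p i) - c x\<bar>)" unfolding S_def by (rule sum_abs)
    also have "\<dots> \<le> real (card {..<m}) * T" by (intro sum_bounded_above dev that)
    finally show ?thesis by simp
  qed
  have dev2: "(f x q - c x)\<^sup>2 \<le> T\<^sup>2" if "x \<in> space N" for x q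
    using dev[OF that, of q] T by (metis abs_le_square_iff abs_of_nonneg)
  have S_bd2: "(S x)\<^sup>2 \<le> (real m * T)\<^sup>2" if "x \<in> space N" for x
    using S_bd[OF that] T by (metis abs_le_square_iff abs_of_nonneg mult_nonneg_nonneg of_nat_0_le_iff)
  \<comment> \<open>Expected squared deviation after appending \<open>q\<close>. Its
    \<open>V\<close>-average exceeds the old value by at most \<open>T\<^sup>2\<close>, so some
    admissible \<open>q\<close> does no worse.\<close>
  define \<Phi> where "\<Phi> q = (\<integral>x. (S x + (f x q - c x))\<^sup>2 \<partial>N)" for q
  have \<Phi>_meas [measurable]: "\<Phi> \<in> borel_measurable V" unfolding \<Phi>_def by measurable
  have sq_bd: "(S x + (f x q - c x))\<^sup>2 \<le> ((real m + 1) * T)\<^sup>2" if "x \<in> space N" for x q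
  proof -
    have "\<bar>S x + (f x q - c x)\<bar> \<le> (real m + 1) * T"
      using S_bd[OF that] dev[OF that, of q] by (simp add: algebra_simps)
    then show ?thesis using abs_le_square_iff by fastforce
  qed
  have int2: "integrable (N \<Otimes>\<^sub>M V) (\<lambda>(x, q). (S x + (f x q - c x))\<^sup>2)"
    by (intro P.integrable_const_bound[where B="((real m + 1) * T)\<^sup>2"])
       (auto intro!: AE_I2 sq_bd simp: space_pair_measure)
  have in_x: "(\<integral>q. (S x + (f x q - c x))\<^sup>2 \<partial>V) \<le> (S x)\<^sup>2 + T\<^sup>2" if x: "x \<in> space N" for x
  proof -
    have i1: "integrable V (\<lambda>q. f x q - c x)"
      using dev[OF x] x by (intro V.integrable_const_bound[where B=T]) auto
    have i2: "integrable V (\<lambda>q. (f x q - c x)\<^sup>2)"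
      using dev2[OF x] x by (intro V.integrable_const_bound[where B="T\<^sup>2"]) auto
    have fi: "integrable V (f x)"
      using bound x by (intro V.integrable_const_bound[where B=T]) auto
    \<comment> \<open>As \<open>c x\<close> is the mean of \<open>f x\<close>, the cross term of the
      expanded square vanishes and second moments simply add up.\<close>
    have 0: "(\<integral>q. f x q - c x \<partial>V) = 0"
      using fi by (simp add: c_def V.prob_space)
    have "(\<integral>q. (S x + (f x q - c x))\<^sup>2 \<partial>V) =
      (\<integral>q. (S x)\<^sup>2 + (2 * S x) * (f x q - c x) + (f x q - c x)\<^sup>2 \<partial>V)"
      by (intro Bochner_Integration.integral_cong) (auto simp: power2_eq_square algebra_simps)
    also have "\<dots> = (S x)\<^sup>2 + (\<integral>q. (f x q - c x)\<^sup>2 \<partial>V)"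
      using i1 i2 0 by (simp add: V.prob_space del: Bochner_Integration.integral_diff)
    also have "(\<integral>q. (f x q - c x)\<^sup>2 \<partial>V) \<le> T\<^sup>2"
      using i2 dev2[OF x] by (intro V.integral_le_const AE_I2) auto
    finally show ?thesis by simp
  qed
  have iS: "integrable N (\<lambda>x. (S x)\<^sup>2)"
    using S_bd2 by (intro N.integrable_const_bound[where B="(real m * T)\<^sup>2"]) auto
  have le1: "(\<integral>x. (S x)\<^sup>2 \<partial>N) \<le> real m * T\<^sup>2"
    using le nn_integral_eq_integral[OF iS] T unfolding S_def c_def by simp
  have le2: "(\<integral>q. \<Phi> q \<partial>V) \<le> real (Suc m) * T\<^sup>2"
  proof -
    have "(\<integral>q. \<Phi> q \<partial>V) = (\<integral>x. (\<integral>q. (S x + (f x q - c x))\<^sup>2 \<partial>V) \<partial>N)"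
      unfolding \<Phi>_def using Fubini_integral[OF int2] by simp
    also have "\<dots> \<le> (\<integral>x. (S x)\<^sup>2 + T\<^sup>2 \<partial>N)"
      using integrable_fst[OF int2] iS by (intro integral_mono in_x) auto
    also have "\<dots> \<le> real (Suc m) * T\<^sup>2"
      using iS le1 by (simp add: N.prob_space algebra_simps)
    finally show ?thesis .
  qed
  have \<Phi>_int: "integrable V \<Phi>"
    using integrable_snd[OF int2] by (simp add: \<Phi>_def[abs_def])
  have "\<exists>q\<in>G. \<Phi> q \<le> real (Suc m) * T\<^sup>2"
  proof (rule ccontr)
    \<comment> \<open>\<open>G\<close> itself may fail to be measurable. The sublevel set
      \<open>W\<close> is measurable and misses \<open>G\<close>, hence is null; then \<Phi> exceeds
      the bound almost everywhere, contradicting the bound on its mean.\<close>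
    assume no: "\<not> ?thesis"
    define W where "W = {q \<in> space V. \<Phi> q \<le> real (Suc m) * T\<^sup>2}"
    have [measurable]: "W \<in> sets V" unfolding W_def by measurable
    have "W \<inter> G = {}" using no by (auto simp: W_def)
    then have "emeasure V W = 0" using G[of W] by (auto simp: zero_less_iff_neq_zero)
    then have ae: "AE q in V. \<Phi> q > real (Suc m) * T\<^sup>2"
      by (intro AE_I[where N=W]) (auto simp: W_def)
    have "(\<integral>q. real (Suc m) * T\<^sup>2 \<partial>V) < (\<integral>q. \<Phi> q \<partial>V)"
      using ae \<Phi>_int by (intro V.integral_less_AE_space) (auto simp: V.emeasure_space_1)
    then show False using le2 by (simp add: V.prob_space)
  qed
  then obtain q where q: "q \<in> G" "\<Phi> q \<le> real (Suc m) * T\<^sup>2" by blast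
  show ?case
  proof (intro exI[where x="p(m := q)"] conjI)
    show "\<forall>i<Suc m. (p(m := q)) i \<in> G" using p q by (auto simp: less_Suc_eq)
    have "(\<Sum>i<Suc m. f x ((p(m := q)) i) - c x) = S x + (f x q - c x)" for x
      by (simp add: S_def)
    moreover have "integrable N (\<lambda>x. (S x + (f x q - c x))\<^sup>2)"
      using sq_bd q(1) assms(6) by (intro N.integrable_const_bound[where B="((real m + 1) * T)\<^sup>2"]) auto
    ultimately show "(\<integral>\<^sup>+x. ennreal ((\<Sum>i<Suc m. f x ((p(m := q)) i) - (\<integral>q. f x q \<partial>V))\<^sup>2) \<partial>N)
        \<le> ennreal (real (Suc m) * T\<^sup>2)"
      using q(2) nn_integral_eq_integral[of N "\<lambda>x. (S x + (f x q - c x))\<^sup>2"]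
      unfolding \<Phi>_def c_def by (simp only: zero_le_power2 AE_I2 ennreal_leI)
  qed
qed

text \<open>Converts a second moment into a bound on the mean of a square root. Scaling
  \<open>u\<close> by \<open>t\<^sup>2\<close> and \<delta> by \<open>t\<close> scales all three
  terms by \<open>t\<close>, which explains the power 3.\<close>

lemma sqrt_le_affine_power2:
  fixes u \<delta> :: real
  assumes "0 \<le> u" "0 < \<delta>"
  shows "sqrt u \<le> \<delta> + u\<^sup>2 / \<delta> ^ 3"
proof (cases "u \<le> \<delta>\<^sup>2")
  case True
  then have "sqrt u \<le> \<delta>" using assms by (simp add: real_le_lsqrt)
  then show ?thesis using assms by (simp add: add_increasing2)
next
  case False
  define v where "v = sqrt u"
  have v: "u = v\<^sup>2" "\<delta> \<le> v" "0 \<le> v"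
    using assms False by (auto simp: v_def real_le_rsqrt)
  have "v * \<delta> ^ 3 \<le> v * v ^ 3" using v assms by (intro mult_left_mono power_mono) auto
  then have "v \<le> u\<^sup>2 / \<delta> ^ 3" using v assms by (simp add: pos_le_divide_eq power_numeral_reduce mult.assoc)
  then show ?thesis using assms by (simp add: v_def add_increasing)
qed

text \<open>Truncation at \<open>T\<close> makes Maurey's second moment finite. The barycentre is
  replaced by the average of \<open>m\<close> points of \<open>G\<close>, to which
  \<open>avg\<close> applies since truncation only lowers it; the error is at most
  \<open>\<delta> + T\<^sup>2 / (m * \<delta> ^ 3)\<close>.\<close>

lemma affinity_truncated_barycentre_le:
  fixes g :: "'x \<Rightarrow> 'p \<Rightarrow> real"
  assumes N: "prob_space N" and V: "prob_space V"
    and meas [measurable]: "case_prod g \<in> borel_measurable (N \<Otimes>\<^sub>M V)"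
    and nonneg: "\<And>x p. x \<in> space N \<Longrightarrow> p \<in> G \<Longrightarrow> 0 \<le> g x p"
    and G: "\<And>S. S \<in> sets V \<Longrightarrow> emeasure V S > 0 \<Longrightarrow> S \<inter> G \<noteq> {}"
    and GV: "G \<subseteq> space V"
    and \<kappa>: "0 \<le> \<kappa>"
    and avg: "\<And>p m. 0 < m \<Longrightarrow> (\<And>i. i < m \<Longrightarrow> p i \<in> G) \<Longrightarrow>
      (\<integral>\<^sup>+x. ennreal (sqrt ((\<Sum>i<m. g x (p i)) / real m)) \<partial>N) \<le> ennreal \<kappa>"
    and T: "0 \<le> T"
  shows "(\<integral>\<^sup>+x. esqrt (\<integral>\<^sup>+p. ennreal (min (g x p) T) \<partial>V) \<partial>N) \<le> ennreal \<kappa>"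
proof (rule ennreal_le_epsilon)
  interpret N: prob_space N by fact
  interpret V: prob_space V by fact
  fix \<eta> :: real assume \<eta>: "0 < \<eta>"
  \<comment> \<open>Outside \<open>G\<close> the function \<open>g\<close> may be negative. Clipping
    at 0 is invisible to \<open>ennreal\<close> and supplies the bounds for all arguments that
    \<open>maurey_selection\<close> asks for.\<close>
  define f where "f x p = max 0 (min (g x p) T)" for x p
  have f_bd: "0 \<le> f x p \<and> f x p \<le> T" for x p using T by (auto simp: f_def)
  have f_meas [measurable]: "case_prod f \<in> borel_measurable (N \<Otimes>\<^sub>M V)"
    unfolding f_def[abs_def] by measurable
  define c where "c x = (\<integral>q. f x q \<partial>V)" for x
  have c_meas [measurable]: "c \<in> borel_measurable N" unfolding c_def by measurable
  have c_eq: "(\<integral>\<^sup>+p. ennreal (min (g x p) T) \<partial>V) = ennreal (c x)" and c0: "0 \<le> c x"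
    if "x \<in> space N" for x
  proof -
    have "integrable V (f x)"
      using f_bd that by (intro V.integrable_const_bound[where B=T]) auto
    from nn_integral_eq_integral[OF this] f_bd
    have "(\<integral>\<^sup>+p. ennreal (f x p) \<partial>V) = ennreal (c x)" by (simp add: c_def)
    then show "(\<integral>\<^sup>+p. ennreal (min (g x p) T) \<partial>V) = ennreal (c x)"
      by (simp add: f_def)
    show "0 \<le> c x" unfolding c_def using f_bd by (intro integral_nonneg_AE) auto
  qed
  define \<delta> where "\<delta> = \<eta> / 2"
  have \<delta>: "0 < \<delta>" using \<eta> by (simp add: \<delta>_def)
  \<comment> \<open>Enough points for the second error term to be at most \<delta>, so that both
    together cost at most \<eta>.\<close>
  obtain m :: nat where m: "real m > T\<^sup>2 / (\<delta> ^ 3 * \<delta>)" using reals_Archimedean2 by blast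
  have m0: "0 < m" using m \<delta> T
    by (metis divide_nonneg_nonneg less_eq_real_def mult_nonneg_nonneg not_gr_zero not_less of_nat_0 zero_le_power zero_le_power2)
  have m': "T\<^sup>2 / (real m * \<delta> ^ 3) \<le> \<delta>"
    using m \<delta> m0 by (simp add: divide_simps mult_ac split: if_splits)
  obtain p :: "nat \<Rightarrow> 'p" where p: "\<And>i. i < m \<Longrightarrow> p i \<in> G"
    and le: "(\<integral>\<^sup>+x. ennreal ((\<Sum>i<m. f x (p i) - c x)\<^sup>2) \<partial>N) \<le> ennreal (real m * T\<^sup>2)"
    using maurey_selection[OF N V f_meas f_bd G GV, of m] unfolding c_def by blast
  have pV: "p i \<in> space V" if "i < m" for i using p[OF that] GV by auto
  have [measurable]: "(\<lambda>x. \<Sum>i<m. f x (p i) - c x) \<in> borel_measurable N"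
    using pV by (intro borel_measurable_sum borel_measurable_diff) auto
  have [measurable]: "(\<lambda>x. \<Sum>i<m. g x (p i)) \<in> borel_measurable N"
    using pV by (intro borel_measurable_sum) auto
  have pt: "sqrt (c x) \<le> sqrt ((\<Sum>i<m. g x (p i)) / real m) +
      (\<delta> + 1 / ((real m)\<^sup>2 * \<delta> ^ 3) * (\<Sum>i<m. f x (p i) - c x)\<^sup>2)"
    if x: "x \<in> space N" for x
  proof -
    define a where "a = (\<Sum>i<m. f x (p i)) / real m"
    have a0: "0 \<le> a" unfolding a_def using f_bd by (intro divide_nonneg_nonneg sum_nonneg) auto
    have a_le: "a \<le> (\<Sum>i<m. g x (p i)) / real m"
      unfolding a_def using nonneg[OF x] p by (intro divide_right_mono sum_mono) (auto simp: f_def)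
    have "c x \<le> a + \<bar>a - c x\<bar>" by simp
    then have "sqrt (c x) \<le> sqrt (a + \<bar>a - c x\<bar>)" by simp
    also have "\<dots> \<le> sqrt a + sqrt \<bar>a - c x\<bar>" using a0 by (intro sqrt_add_le_add_sqrt) auto
    also have "sqrt a \<le> sqrt ((\<Sum>i<m. g x (p i)) / real m)" using a_le by simp
    also have "sqrt \<bar>a - c x\<bar> \<le> \<delta> + \<bar>a - c x\<bar>\<^sup>2 / \<delta> ^ 3"
      using \<delta> by (intro sqrt_le_affine_power2) auto
    also have "a - c x = (\<Sum>i<m. f x (p i) - c x) / real m"
      using m0 by (simp add: a_def sum_subtractf field_simps)
    finally show ?thesis using \<delta> m0
      by (simp add: power_divide power_mult_distrib field_simps)
  qed
  have "(\<integral>\<^sup>+x. esqrt (\<integral>\<^sup>+p. ennreal (min (g x p) T) \<partial>V) \<partial>N) = (\<integral>\<^sup>+x. ennreal (sqrt (c x)) \<partial>N)"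
    by (intro nn_integral_cong) (simp add: c_eq c0 esqrt_ennreal)
  also have "\<dots> \<le> (\<integral>\<^sup>+x. ennreal (sqrt ((\<Sum>i<m. g x (p i)) / real m)) +
      (ennreal \<delta> + ennreal (1 / ((real m)\<^sup>2 * \<delta> ^ 3)) * ennreal ((\<Sum>i<m. f x (p i) - c x)\<^sup>2)) \<partial>N)"
  proof (intro nn_integral_mono)
    fix x assume x: "x \<in> space N"
    have "0 \<le> (\<Sum>i<m. g x (p i))" using nonneg[OF x] p by (intro sum_nonneg) auto
    then show "ennreal (sqrt (c x)) \<le> ennreal (sqrt ((\<Sum>i<m. g x (p i)) / real m)) +
      (ennreal \<delta> + ennreal (1 / ((real m)\<^sup>2 * \<delta> ^ 3)) * ennreal ((\<Sum>i<m. f x (p i) - c x)\<^sup>2))"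
      using pt[OF x] \<delta> by (simp add: ennreal_plus[symmetric] ennreal_mult[symmetric] del: ennreal_plus)
  qed
  also have "\<dots> = (\<integral>\<^sup>+x. ennreal (sqrt ((\<Sum>i<m. g x (p i)) / real m)) \<partial>N) +
      (ennreal \<delta> + ennreal (1 / ((real m)\<^sup>2 * \<delta> ^ 3)) *
        (\<integral>\<^sup>+x. ennreal ((\<Sum>i<m. f x (p i) - c x)\<^sup>2) \<partial>N))"
    by (simp add: nn_integral_add nn_integral_cmult N.emeasure_space_1)
  also have "\<dots> \<le> ennreal \<kappa> + (ennreal \<delta> + ennreal (1 / ((real m)\<^sup>2 * \<delta> ^ 3)) * ennreal (real m * T\<^sup>2))"
    using avg[OF m0, of p] p le by (intro add_mono mult_left_mono) auto
  also have "\<dots> = ennreal \<kappa> + ennreal (\<delta> + T\<^sup>2 / (real m * \<delta> ^ 3))"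
  proof -
    have "1 / ((real m)\<^sup>2 * \<delta> ^ 3) * (real m * T\<^sup>2) = T\<^sup>2 / (real m * \<delta> ^ 3)"
      using m0 by (simp add: power2_eq_square)
    moreover have "0 \<le> 1 / ((real m)\<^sup>2 * \<delta> ^ 3)" "0 \<le> T\<^sup>2 / (real m * \<delta> ^ 3)" using \<delta> by simp_all
    ultimately show ?thesis using \<delta> by (simp only: ennreal_mult'[symmetric] ennreal_plus less_imp_le)
  qed
  also have "\<dots> \<le> ennreal \<kappa> + ennreal \<eta>"
    using m' \<delta>_def by (intro add_left_mono ennreal_leI) linarith
  finally show "(\<integral>\<^sup>+x. esqrt (\<integral>\<^sup>+p. ennreal (min (g x p) T) \<partial>V) \<partial>N) \<le> ennreal \<kappa> + ennreal \<eta>" .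
qed

lemma esqrt_SUP_le:
  fixes a :: "nat \<Rightarrow> ennreal"
  shows "esqrt (SUP n. a n) \<le> (SUP n. esqrt (a n))"
  unfolding esqrt_le_iff
proof (rule SUP_least)
  fix n
  have "a n \<le> esqrt (a n) * esqrt (a n)" using esqrt_le_iff by blast
  also have "\<dots> \<le> (SUP n. esqrt (a n)) * (SUP n. esqrt (a n))"
    by (intro mult_mono SUP_upper) auto
  finally show "a n \<le> (SUP n. esqrt (a n)) * (SUP n. esqrt (a n))" .
qed

text \<open>Monotone convergence in the truncation level; the bound \<kappa> does not depend on that
  level.\<close>

lemma affinity_barycentre_le:
  fixes g :: "'x \<Rightarrow> 'p \<Rightarrow> real"
  assumes N: "prob_space N" and V: "prob_space V"
    and meas [measurable]: "case_prod g \<in> borel_measurable (N \<Otimes>\<^sub>M V)"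
    and nonneg: "\<And>x p. x \<in> space N \<Longrightarrow> p \<in> G \<Longrightarrow> 0 \<le> g x p"
    and G: "\<And>S. S \<in> sets V \<Longrightarrow> emeasure V S > 0 \<Longrightarrow> S \<inter> G \<noteq> {}"
    and GV: "G \<subseteq> space V"
    and \<kappa>: "0 \<le> \<kappa>"
    and avg: "\<And>p m. 0 < m \<Longrightarrow> (\<And>i. i < m \<Longrightarrow> p i \<in> G) \<Longrightarrow>
      (\<integral>\<^sup>+x. ennreal (sqrt ((\<Sum>i<m. g x (p i)) / real m)) \<partial>N) \<le> ennreal \<kappa>"
  shows "(\<integral>\<^sup>+x. esqrt (\<integral>\<^sup>+p. ennreal (g x p) \<partial>V) \<partial>N) \<le> ennreal \<kappa>"
proof -
  interpret V: prob_space V by fact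
  define h where "h n x = (\<integral>\<^sup>+p. ennreal (min (g x p) (real n)) \<partial>V)" for n :: nat and x
  have [measurable]: "h n \<in> borel_measurable N" for n unfolding h_def by measurable
  have inc: "incseq (\<lambda>n. ennreal (min (g x p) (real n)))" for x p
    by (intro incseq_SucI ennreal_leI) auto
  have h_inc: "h n x \<le> h (Suc n) x" for n x
    unfolding h_def by (intro nn_integral_mono ennreal_leI) auto
  have sup: "(\<integral>\<^sup>+p. ennreal (g x p) \<partial>V) = (SUP n. h n x)" if "x \<in> space N" for x
  proof -
    have "(\<integral>\<^sup>+p. ennreal (g x p) \<partial>V) = (\<integral>\<^sup>+p. (SUP n. ennreal (min (g x p) (real n))) \<partial>V)"
    proof (intro nn_integral_cong antisym)
      fix p
      obtain n :: nat where "g x p \<le> real n" using real_arch_simple by blast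
      then have "ennreal (g x p) = ennreal (min (g x p) (real n))" by simp
      then show "ennreal (g x p) \<le> (SUP n. ennreal (min (g x p) (real n)))"
        by (metis SUP_upper UNIV_I)
      show "(SUP n. ennreal (min (g x p) (real n))) \<le> ennreal (g x p)"
        by (intro SUP_least ennreal_leI) auto
    qed
    also have "\<dots> = (SUP n. h n x)"
      unfolding h_def using that inc
      by (intro nn_integral_monotone_convergence_SUP) (auto simp: incseq_def le_fun_def)
    finally show ?thesis .
  qed
  have "(\<integral>\<^sup>+x. esqrt (\<integral>\<^sup>+p. ennreal (g x p) \<partial>V) \<partial>N) \<le> (\<integral>\<^sup>+x. (SUP n. esqrt (h n x)) \<partial>N)"
    by (intro nn_integral_mono) (simp add: sup esqrt_SUP_le)
  also have "\<dots> = (SUP n. \<integral>\<^sup>+x. esqrt (h n x) \<partial>N)"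
    using h_inc by (intro nn_integral_monotone_convergence_SUP incseq_SucI) (auto simp: le_fun_def esqrt_mono)
  also have "\<dots> \<le> ennreal \<kappa>"
    unfolding h_def using affinity_truncated_barycentre_le[OF assms] by (intro SUP_least) auto
  finally show ?thesis .
qed

text \<open>Dividing the weight by its total mass \<open>m\<close> reduces to a probability measure,
  and multiplicativity of \<open>esqrt\<close> brings \<open>m\<close> out as the factor
  \<open>esqrt m\<close>. For infinite \<open>m\<close> the right-hand side is infinite because
  \<kappa> is positive.\<close>

lemma affinity_weighted_barycentre_le:
  fixes g :: "'x \<Rightarrow> 'p \<Rightarrow> real" and L :: "'p \<Rightarrow> ennreal"
  assumes N: "prob_space N"
    and [measurable]: "case_prod g \<in> borel_measurable (N \<Otimes>\<^sub>M V)"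
    and L [measurable]: "L \<in> borel_measurable V"
    and nonneg: "\<And>x p. x \<in> space N \<Longrightarrow> p \<in> G \<Longrightarrow> 0 \<le> g x p"
    and G: "\<And>S. S \<in> sets V \<Longrightarrow> (\<integral>\<^sup>+p. L p * indicator S p \<partial>V) > 0 \<Longrightarrow> S \<inter> G \<noteq> {}"
    and GV: "G \<subseteq> space V"
    and \<kappa>: "0 < \<kappa>"
    and avg: "\<And>p m. 0 < m \<Longrightarrow> (\<And>i. i < m \<Longrightarrow> p i \<in> G) \<Longrightarrow>
      (\<integral>\<^sup>+x. ennreal (sqrt ((\<Sum>i<m. g x (p i)) / real m)) \<partial>N) \<le> ennreal \<kappa>"
  shows "(\<integral>\<^sup>+x. esqrt (\<integral>\<^sup>+p. L p * ennreal (g x p) \<partial>V) \<partial>N) \<le> ennreal \<kappa> * esqrt (\<integral>\<^sup>+p. L p \<partial>V)"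
proof -
  define m where "m = (\<integral>\<^sup>+p. L p \<partial>V)"
  consider "m = 0" | "m = \<top>" | "m \<noteq> 0" "m \<noteq> \<top>" by blast
  then show ?thesis
  proof cases
    case 1
    then have "AE p in V. L p = 0" by (simp add: m_def nn_integral_0_iff_AE)
    then have "(\<integral>\<^sup>+p. L p * ennreal (g x p) \<partial>V) = 0" for x
      by (subst nn_integral_cong_AE[where v="\<lambda>_. 0"]) auto
    then show ?thesis by simp
  next
    case 2
    then show ?thesis using \<kappa> by (simp add: m_def ennreal_mult_top)
  next
    case 3
    \<comment> \<open>When \<open>L\<close> is a prior weight times the likelihood of earlier
      observations, this is the posterior after those observations.\<close>
    define V' where "V' = density V (\<lambda>p. L p / m)"
    have sets' [measurable_cong]: "sets V' = sets V" by (simp add: V'_def)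
    have V'_em: "emeasure V' S = (\<integral>\<^sup>+p. L p * indicator S p \<partial>V) / m" if "S \<in> sets V" for S
    proof -
      have "emeasure V' S = (\<integral>\<^sup>+p. L p / m * indicator S p \<partial>V)"
        using that by (simp add: V'_def emeasure_density)
      also have "\<dots> = (\<integral>\<^sup>+p. L p * indicator S p / m \<partial>V)"
        by (intro nn_integral_cong) (auto simp: indicator_def)
      also have "\<dots> = (\<integral>\<^sup>+p. L p * indicator S p \<partial>V) / m"
        using that by (intro nn_integral_divide) auto
      finally show ?thesis .
    qed
    have "emeasure V' (space V') = 1"
      using 3 V'_em[OF sets.top]
      by (simp add: V'_def m_def[symmetric] ennreal_divide_self top.not_eq_extremum cong: nn_integral_cong_simp)
    then have V': "prob_space V'" by (rule prob_spaceI)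
    have "case_prod g \<in> borel_measurable (N \<Otimes>\<^sub>M V')" by measurable
    then have "(\<integral>\<^sup>+x. esqrt (\<integral>\<^sup>+p. ennreal (g x p) \<partial>V') \<partial>N) \<le> ennreal \<kappa>"
    proof (rule affinity_barycentre_le[OF N V' _ nonneg _ _ _ avg])
      fix S assume "S \<in> sets V'" "emeasure V' S > 0"
      then show "S \<inter> G \<noteq> {}"
        using V'_em[of S] G[of S] by (auto simp: sets' zero_less_iff_neq_zero)
    qed (use GV \<kappa> in \<open>auto simp: V'_def\<close>)
    moreover have "(\<integral>\<^sup>+p. L p * ennreal (g x p) \<partial>V) = (\<integral>\<^sup>+p. ennreal (g x p) \<partial>V') * m" if "x \<in> space N" for x
    proof -
      have "(\<integral>\<^sup>+p. ennreal (g x p) \<partial>V') * m = (\<integral>\<^sup>+p. L p / m * ennreal (g x p) * m \<partial>V)"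
        unfolding V'_def using that by (simp add: nn_integral_density nn_integral_multc)
      also have "\<dots> = (\<integral>\<^sup>+p. L p * ennreal (g x p) \<partial>V)"
        using 3 by (intro nn_integral_cong)
          (metis ennreal_divide_times ennreal_times_divide mult.commute mult.assoc mult_divide_eq_ennreal)
      finally show ?thesis by simp
    qed
    moreover have "(\<lambda>x. esqrt (\<integral>\<^sup>+p. ennreal (g x p) \<partial>V')) \<in> borel_measurable N"
    proof -
      interpret V': prob_space V' by fact
      show ?thesis by measurable
    qed
    ultimately show ?thesis
      by (simp add: esqrt_mult nn_integral_multc mult_right_mono m_def[symmetric] cong: nn_integral_cong)
  qed
qed

text \<open>
  The iterated form: integrating out the observations one at a time replaces, at each step, the
  posterior mixture by its barycentre.
\<close>

lemma affinity_product_mixture_le: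
  fixes g :: "'x \<Rightarrow> 'p \<Rightarrow> real" and L :: "'p \<Rightarrow> ennreal"
  assumes N: "prob_space N" and V: "sigma_finite_measure V"
    and [measurable]: "case_prod g \<in> borel_measurable (N \<Otimes>\<^sub>M V)"
    and L [measurable]: "L \<in> borel_measurable V"
    and nonneg: "\<And>x p. x \<in> space N \<Longrightarrow> p \<in> G \<Longrightarrow> 0 \<le> g x p"
    and G: "\<And>S. S \<in> sets V \<Longrightarrow> (\<integral>\<^sup>+p. L p * indicator S p \<partial>V) > 0 \<Longrightarrow> S \<inter> G \<noteq> {}"
    and GV: "G \<subseteq> space V"
    and \<kappa>: "0 < \<kappa>"
    and avg: "\<And>p m. 0 < m \<Longrightarrow> (\<And>i. i < m \<Longrightarrow> p i \<in> G) \<Longrightarrow>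
      (\<integral>\<^sup>+x. ennreal (sqrt ((\<Sum>i<m. g x (p i)) / real m)) \<partial>N) \<le> ennreal \<kappa>"
  shows "(\<integral>\<^sup>+X. esqrt (\<integral>\<^sup>+p. L p * (\<Prod>i<n. ennreal (g (X i) p)) \<partial>V) \<partial>PiM {..<n} (\<lambda>_. N))
    \<le> ennreal (\<kappa> ^ n) * esqrt (\<integral>\<^sup>+p. L p \<partial>V)"
proof (induction n)
  case 0
  show ?case by (simp add: PiM_empty nn_integral_count_space_finite)
next
  case (Suc n)
  interpret N: prob_space N by fact
  interpret V: sigma_finite_measure V by fact
  interpret P: product_prob_space "\<lambda>_::nat. N" ..
  have gm: "(\<lambda>(X, p). g (X i) p) \<in> borel_measurable (PiM {..<m} (\<lambda>_. N) \<Otimes>\<^sub>M V)"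
    if "i < m" for i m
  proof -
    have [measurable]: "(\<lambda>Z. (fst Z i, snd Z)) \<in> PiM {..<m} (\<lambda>_. N) \<Otimes>\<^sub>M V \<rightarrow>\<^sub>M N \<Otimes>\<^sub>M V"
      using that by (intro measurable_Pair measurable_compose[OF measurable_fst measurable_component_singleton] measurable_snd) auto
    have "(\<lambda>Z. case_prod g (fst Z i, snd Z)) \<in> borel_measurable (PiM {..<m} (\<lambda>_. N) \<Otimes>\<^sub>M V)"
      by measurable
    then show ?thesis by (simp add: case_prod_beta')
  qed
  have Lm: "(\<lambda>(X, p). L p * (\<Prod>i<m. ennreal (g (X i) p))) \<in>
      borel_measurable (PiM {..<m} (\<lambda>_. N) \<Otimes>\<^sub>M V)" for m
  proof -
    have "(\<lambda>Z. \<Prod>i<m. ennreal (g (fst Z i) (snd Z))) \<in> borel_measurable (PiM {..<m} (\<lambda>_. N) \<Otimes>\<^sub>M V)"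
      using gm[unfolded case_prod_beta'] by (intro borel_measurable_prod_ennreal measurable_compose[OF _ measurable_ennreal]) auto
    moreover have "(\<lambda>Z. L (snd Z)) \<in> borel_measurable (PiM {..<m} (\<lambda>_. N) \<Otimes>\<^sub>M V)"
      using L by (rule measurable_compose[OF measurable_snd])
    ultimately show ?thesis unfolding case_prod_beta' by (rule borel_measurable_times_ennreal[rotated])
  qed
  define F where "F m X = esqrt (\<integral>\<^sup>+p. L p * (\<Prod>i<m. ennreal (g (X i) p)) \<partial>V)" for m and X :: "nat \<Rightarrow> 'x"
  have step: "(\<integral>\<^sup>+y. F (Suc n) (X(n := y)) \<partial>N) \<le> ennreal \<kappa> * F n X"
    if X: "X \<in> space (PiM {..<n} (\<lambda>_. N))" for X
  proof -
    have "(\<integral>\<^sup>+y. esqrt (\<integral>\<^sup>+p. (L p * (\<Prod>i<n. ennreal (g (X i) p))) * ennreal (g y p) \<partial>V) \<partial>N)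
      \<le> ennreal \<kappa> * esqrt (\<integral>\<^sup>+p. L p * (\<Prod>i<n. ennreal (g (X i) p)) \<partial>V)"
    proof (rule affinity_weighted_barycentre_le[OF N _ _ nonneg _ GV \<kappa> avg])
      show [measurable]: "(\<lambda>p. L p * (\<Prod>i<n. ennreal (g (X i) p))) \<in> borel_measurable V"
        using measurable_compose[OF measurable_Pair1'[OF X] Lm[of n]] by simp
      \<comment> \<open>A set charged by the reweighted measure is already charged by
        \<open>L\<close>, so the hypothesis on \<open>G\<close> survives fixing the earlier
        observations.\<close>
      fix S assume S [measurable]: "S \<in> sets V"
        and pos: "0 < (\<integral>\<^sup>+p. L p * (\<Prod>i<n. ennreal (g (X i) p)) * indicator S p \<partial>V)"
      have "(\<integral>\<^sup>+p. L p * indicator S p \<partial>V) \<noteq> 0"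
      proof
        assume "(\<integral>\<^sup>+p. L p * indicator S p \<partial>V) = 0"
        then have "AE p in V. L p * indicator S p = 0" by (simp add: nn_integral_0_iff_AE)
        then have "AE p in V. L p * (\<Prod>i<n. ennreal (g (X i) p)) * indicator S p = 0" by auto
        then have "(\<integral>\<^sup>+p. L p * (\<Prod>i<n. ennreal (g (X i) p)) * indicator S p \<partial>V) = 0"
          by (subst nn_integral_cong_AE) auto
        with pos show False by simp
      qed
      then show "S \<inter> G \<noteq> {}" using G[OF S] by (simp add: zero_less_iff_neq_zero)
    qed auto
    moreover have "(\<Prod>i<Suc n. ennreal (g ((X(n := y)) i) p)) = (\<Prod>i<n. ennreal (g (X i) p)) * ennreal (g y p)"
      for y p
      by (subst prod.lessThan_Suc) (intro arg_cong2[where f="(*)"] prod.cong, auto)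
    ultimately show ?thesis unfolding F_def by (simp only: mult.assoc)
  qed
  have Fm: "F m \<in> borel_measurable (PiM {..<m} (\<lambda>_. N))" for m
    unfolding F_def[abs_def]
    using V.borel_measurable_nn_integral[OF Lm] by (rule measurable_compose[OF _ esqrt_measurable])
  have "integral\<^sup>N (PiM {..<Suc n} (\<lambda>_. N)) (F (Suc n)) =
      (\<integral>\<^sup>+X. (\<integral>\<^sup>+y. F (Suc n) (X(n := y)) \<partial>N) \<partial>PiM {..<n} (\<lambda>_. N))"
    using P.product_nn_integral_insert[of "{..<n}" n "F (Suc n)"] Fm[of "Suc n"]
    by (simp add: lessThan_Suc)
  also have "\<dots> \<le> (\<integral>\<^sup>+X. ennreal \<kappa> * F n X \<partial>PiM {..<n} (\<lambda>_. N))"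
    by (intro nn_integral_mono step)
  also have "\<dots> = ennreal \<kappa> * integral\<^sup>N (PiM {..<n} (\<lambda>_. N)) (F n)"
    by (intro nn_integral_cmult Fm)
  also have "\<dots> \<le> ennreal \<kappa> * (ennreal (\<kappa> ^ n) * esqrt (\<integral>\<^sup>+p. L p \<partial>V))"
    using Suc unfolding F_def by (intro mult_left_mono) auto
  also have "\<dots> = ennreal (\<kappa> ^ Suc n) * esqrt (\<integral>\<^sup>+p. L p \<partial>V)"
    using \<kappa> by (simp add: ennreal_mult mult.assoc)
  finally show ?case unfolding F_def .
qed

text \<open>
  Only balls around \<open>p0\<close> are assumed measurable. The pieces cut out by the covering balls are
  therefore replaced by hulls, which is why the mixture lemmas above ask merely that \<open>G\<close> meets every set
  of positive mass.
\<close>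

lemma measurable_hull:
  assumes "finite_measure V" "U \<subseteq> space V"
  obtains W where "W \<in> sets V" "U \<subseteq> W"
    "\<And>S. S \<in> sets V \<Longrightarrow> S \<subseteq> W \<Longrightarrow> emeasure V S > 0 \<Longrightarrow> S \<inter> U \<noteq> {}"
proof -
  interpret finite_measure V by fact
  \<comment> \<open>The infimum of the masses of measurable supersets is attained, by intersecting a
    minimising sequence.\<close>
  define C where "C = emeasure V ` {W \<in> sets V. U \<subseteq> W}"
  have "C \<noteq> {}" using assms(2) by (auto simp: C_def)
  then obtain f :: "nat \<Rightarrow> ennreal" where f: "range f \<subseteq> C" "Inf C = (INF i. f i)"
    using ennreal_Inf_countable_INF by blast
  have "\<forall>i. \<exists>W. W \<in> sets V \<and> U \<subseteq> W \<and> emeasure V W = f i"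
  proof
    fix i
    have "f i \<in> C" using f(1) by auto
    then show "\<exists>W. W \<in> sets V \<and> U \<subseteq> W \<and> emeasure V W = f i" by (auto simp: C_def)
  qed
  then obtain W where W: "\<And>i. W i \<in> sets V" "\<And>i. U \<subseteq> W i" "\<And>i. emeasure V (W i) = f i"
    by metis
  define Z where "Z = (\<Inter>i. W i)"
  have Z [measurable]: "Z \<in> sets V" unfolding Z_def using W(1) by auto
  have UZ: "U \<subseteq> Z" unfolding Z_def using W(2) by auto
  have ZI: "emeasure V Z \<le> Inf C"
    unfolding f(2)
  proof (rule INF_greatest)
    fix i
    show "emeasure V Z \<le> f i" unfolding W(3)[symmetric]
      by (intro emeasure_mono W(1)) (auto simp: Z_def)
  qed
  show ?thesis
  proof (rule that[OF Z UZ])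
    fix S assume S: "S \<in> sets V" "S \<subseteq> Z" "emeasure V S > 0"
    show "S \<inter> U \<noteq> {}"
    proof
      \<comment> \<open>Removing \<open>S\<close> would leave a measurable superset of
        \<open>U\<close> with mass below the infimum; finiteness of \<open>V\<close> makes the
        decrease strict.\<close>
      assume "S \<inter> U = {}"
      then have "emeasure V (Z - S) \<in> C" using S UZ by (auto simp: C_def)
      then have le: "emeasure V Z \<le> emeasure V (Z - S)" using ZI by (meson Inf_lower order.trans)
      have "emeasure V (Z - S) = emeasure V Z - emeasure V S"
        using S by (intro emeasure_Diff) auto
      moreover have "emeasure V S \<le> emeasure V Z" using S by (intro emeasure_mono) auto
      ultimately show False using le S(3)
        by (metis emeasure_finite ennreal_between leD top.not_eq_extremum zero_less_iff_neq_zero order_less_le_trans)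
    qed
  qed
qed

section \<open>Sums, coverings and second moments\<close>

text \<open>Either some term reaches 1, or truncation changes no term. This allows every covering
  piece to be truncated, and then put under a square root, by itself.\<close>

lemma min_1_suminf_le:
  fixes a :: "nat \<Rightarrow> ennreal"
  shows "min 1 (\<Sum>k. a k) \<le> (\<Sum>k. min 1 (a k))"
proof (cases "\<exists>k. 1 \<le> a k")
  case True
  then obtain k where "1 \<le> a k" by blast
  then have "1 = sum (\<lambda>k. min 1 (a k)) {k}" by simp
  also have "\<dots> \<le> (\<Sum>k. min 1 (a k))" by (rule sum_le_suminf) auto
  finally show ?thesis by (simp add: min_le_iff_disj)
next
  case False
  then have "min 1 (a k) = a k" for k by (metis min.absorb2 linear)
  then show ?thesis by simp
qed

lemma min_1_sum_le:
  fixes a :: "'b \<Rightarrow> ennreal"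
  assumes "finite F"
  shows "min 1 (\<Sum>c\<in>F. a c) \<le> (\<Sum>c\<in>F. min 1 (a c))"
proof (cases "\<exists>c\<in>F. 1 \<le> a c")
  case True
  then obtain c where c: "c \<in> F" "1 \<le> a c" by blast
  then have "1 = sum (\<lambda>k. min 1 (a k)) {c}" by simp
  also have "\<dots> \<le> (\<Sum>c\<in>F. min 1 (a c))" using assms c by (intro sum_mono2) auto
  finally show ?thesis by (simp add: min_le_iff_disj)
next
  case False
  then have "min 1 (a c) = a c" if "c \<in> F" for c using that by (metis min.absorb2 linear)
  then show ?thesis by simp
qed

lemma nn_integral_count_space_mono_set:
  "S \<subseteq> A \<Longrightarrow> (\<integral>\<^sup>+\<alpha>. f \<alpha> \<partial>count_space S) \<le> (\<integral>\<^sup>+\<alpha>. f \<alpha> \<partial>count_space A)"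
  by (auto simp: nn_integral_count_space_indicator intro!: nn_integral_mono split: split_indicator)

lemma tendsto_0_ennrealI:
  fixes f :: "nat \<Rightarrow> ennreal"
  assumes "\<And>\<eta>::real. 0 < \<eta> \<Longrightarrow> \<forall>\<^sub>F n in sequentially. f n \<le> ennreal \<eta>"
  shows "f \<longlonglongrightarrow> 0"
proof (rule order_tendstoI)
  fix a :: ennreal assume a: "0 < a"
  then obtain y where "0 < y" "y < a" using dense by blast
  then obtain \<eta> where \<eta>: "0 < ennreal \<eta>" "ennreal \<eta> < a" by (cases y) auto
  then have "0 < \<eta>" by simp
  from assms[OF this] show "\<forall>\<^sub>F n in sequentially. f n < a"
    by eventually_elim (use \<eta> in auto)
qed simp

text \<open>\<open>infsum\<close> falls back to 0 on families that are not summable; domination by a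
  multiple of a probability mass function excludes this.\<close>

lemma nn_integral_count_space_eq_infsum:
  fixes f :: "'a \<Rightarrow> real"
  assumes "\<And>\<alpha>. \<alpha> \<in> S \<Longrightarrow> 0 \<le> f \<alpha>" "\<And>\<alpha>. \<alpha> \<in> S \<Longrightarrow> f \<alpha> \<le> C * pmf p \<alpha>"
  shows "(\<integral>\<^sup>+\<alpha>. ennreal (f \<alpha>) \<partial>count_space S) = ennreal (\<Sum>\<^sub>\<infinity>\<alpha>\<in>S. f \<alpha>)"
proof -
  have "Infinite_Set_Sum.abs_summable_on f S"
  proof (rule Infinite_Set_Sum.abs_summable_on_comparison_test')
    show "Infinite_Set_Sum.abs_summable_on (\<lambda>\<alpha>. C * pmf p \<alpha>) S"
      unfolding Infinite_Set_Sum.abs_summable_on_def set_integrable_def by (simp add: integrable_pmf)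
  qed (use assms in auto)
  then show ?thesis
    using nn_integral_conv_infsetsum[of f S] infsetsum_infsum[of f S] assms(1) by simp
qed

lemma summable_exp_neg: "summable (\<lambda>k. exp (- real k))"
proof -
  have "summable (\<lambda>k. exp (- 1 :: real) ^ k)" by (rule summable_geometric) simp
  then show ?thesis by (simp add: exp_of_nat_mult[symmetric])
qed

lemma suminf_exp_neg_nonneg: "0 \<le> (\<Sum>k. exp (- real k))"
  by (intro suminf_nonneg summable_exp_neg) simp

text \<open>Half the prior exponent at the outer radius \<open>j + 1\<close> of a shell, minus half
  the squared separation \<open>(2 * j - 1) / 3\<close>. The threshold \<open>1 / 18\<close> is half
  of \<open>1 / 9\<close>.\<close>

lemma shell_exponent_le:
  fixes j L :: real
  assumes "L \<le> 1 / 18" "0 \<le> j"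
  shows "L * (j + 1)\<^sup>2 / 2 - (2 * j - 1)\<^sup>2 / 18 \<le> - (7 * j\<^sup>2 - 10 * j + 1) / 36"
proof -
  have "L * (j + 1)\<^sup>2 \<le> 1 / 18 * (j + 1)\<^sup>2" using assms by (intro mult_right_mono) auto
  then show ?thesis by (simp add: power2_eq_square field_simps)
qed

lemma dist_nbhd_eq_empty:
  assumes "bdd_below ((\<lambda>p. d p0 p) ` P)" "s < dist_to_model d p0 P" "\<And>p. p \<in> P \<Longrightarrow> d p p0 = d p0 p"
  shows "dist_nbhd d p0 P s = {}"
proof -
  have "s < d p p0" if "p \<in> P" for p
    using cINF_lower[OF assms(1) that] assms(2) assms(3)[OF that] unfolding dist_to_model_def by linarith
  then show ?thesis by (force simp: dist_nbhd_def)
qed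

lemma covering_number_attained:
  assumes "covering_number r S d = enat k"
  obtains F where "finite F" "F \<subseteq> S" "S \<subseteq> (\<Union>c\<in>F. {q\<in>S. d c q < r})" "card F = k"
proof -
  let ?C = "{enat (card F) |F. finite F \<and> F \<subseteq> S \<and> S \<subseteq> (\<Union>c\<in>F. {q\<in>S. d c q < r})}"
  have "?C \<noteq> {}"
  proof
    assume "?C = {}"
    then have "covering_number r S d = \<infinity>" unfolding covering_number_def by (simp add: Inf_enat_def)
    with assms show False by simp
  qed
  then have "Inf ?C \<in> ?C" by (rule wellorder_InfI[OF ex_in_conv[THEN iffD2, THEN someI_ex]])
  then show ?thesis using assms that unfolding covering_number_def by auto
qed

lemma metric_entropy_cover:
  assumes "metric_entropy r S d \<le> ereal x"
  obtains F where "finite F" "F \<subseteq> S" "real (card F) \<le> exp x" "S \<subseteq> (\<Union>c\<in>F. {q. d c q < r})"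
proof (cases "covering_number r S d")
  case (enat k)
  then obtain F where F: "finite F" "F \<subseteq> S" "S \<subseteq> (\<Union>c\<in>F. {q\<in>S. d c q < r})" "card F = k"
    by (rule covering_number_attained)
  have "real k \<le> exp x"
  proof (cases "k = 0")
    case False
    then have "ln (real k) \<le> x" using assms enat by (simp add: metric_entropy_def)
    then show ?thesis using False by (metis exp_ln exp_le_cancel_iff of_nat_0_less_iff not_gr_zero)
  qed simp
  then show ?thesis using that[of F] F by auto
next
  case infinity
  then show ?thesis using assms by (simp add: metric_entropy_def)
qed

text \<open>Independence enters through iterated integration: with the first \<open>n\<close>
  coordinates fixed, the cross term with the next one integrates to zero.\<close>

lemma iid_sum_second_moment:
  fixes W :: "'x \<Rightarrow> real"
  assumes N: "prob_space N" and [measurable]: "W \<in> borel_measurable N"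
    and int: "integrable N W" and int2: "integrable N (\<lambda>x. (W x)\<^sup>2)" and zero: "(\<integral>x. W x \<partial>N) = 0"
  shows "(\<integral>\<^sup>+X. ennreal ((\<Sum>i<n. W (X i))\<^sup>2) \<partial>PiM {..<n} (\<lambda>_. N)) =
    ennreal (real n * (\<integral>x. (W x)\<^sup>2 \<partial>N))"
proof (induction n)
  case 0
  then show ?case by simp
next
  case (Suc n)
  interpret N: prob_space N by fact
  interpret P: product_prob_space "\<lambda>_::nat. N" ..
  interpret Pn: prob_space "PiM {..<n} (\<lambda>_. N)" by (intro prob_space_PiM N)
  define F where "F m X = ennreal ((\<Sum>i<m. W (X i))\<^sup>2)" for m and X :: "nat \<Rightarrow> 'x"
  have F [measurable]: "F m \<in> borel_measurable (PiM {..<m} (\<lambda>_. N))" for m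
    unfolding F_def[abs_def] by measurable
  have step: "(\<integral>\<^sup>+y. F (Suc n) (X(n := y)) \<partial>N) = F n X + ennreal (\<integral>x. (W x)\<^sup>2 \<partial>N)" for X
  proof -
    let ?S = "\<Sum>i<n. W (X i)"
    have *: "(\<Sum>i<Suc n. W ((X(n := y)) i))\<^sup>2 = ?S\<^sup>2 + 2 * ?S * W y + (W y)\<^sup>2" for y
      by (simp add: power2_sum)
    have "(\<integral>\<^sup>+y. F (Suc n) (X(n := y)) \<partial>N) = (\<integral>\<^sup>+y. ennreal (?S\<^sup>2 + 2 * ?S * W y + (W y)\<^sup>2) \<partial>N)"
      unfolding F_def * ..
    also have "\<dots> = ennreal (\<integral>y. ?S\<^sup>2 + 2 * ?S * W y + (W y)\<^sup>2 \<partial>N)"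
    proof (rule nn_integral_eq_integral)
      show "integrable N (\<lambda>y. ?S\<^sup>2 + 2 * ?S * W y + (W y)\<^sup>2)" using int int2 by auto
      show "AE y in N. 0 \<le> ?S\<^sup>2 + 2 * ?S * W y + (W y)\<^sup>2"
        by (rule AE_I2) (simp only: *[symmetric] zero_le_power2)
    qed
    also have "(\<integral>y. ?S\<^sup>2 + 2 * ?S * W y + (W y)\<^sup>2 \<partial>N) = ?S\<^sup>2 + (\<integral>x. (W x)\<^sup>2 \<partial>N)"
      using int int2 zero by (simp add: N.prob_space)
    finally show ?thesis by (simp add: F_def ennreal_plus)
  qed
  have "integral\<^sup>N (PiM {..<Suc n} (\<lambda>_. N)) (F (Suc n)) =
      (\<integral>\<^sup>+X. (\<integral>\<^sup>+y. F (Suc n) (X(n := y)) \<partial>N) \<partial>PiM {..<n} (\<lambda>_. N))"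
    using P.product_nn_integral_insert[of "{..<n}" n "F (Suc n)"] F[of "Suc n"]
    by (simp add: lessThan_Suc)
  also have "\<dots> = integral\<^sup>N (PiM {..<n} (\<lambda>_. N)) (F n) + ennreal (\<integral>x. (W x)\<^sup>2 \<partial>N)"
    unfolding step by (subst nn_integral_add) (auto simp: Pn.emeasure_space_1)
  also have "\<dots> = ennreal (real (Suc n) * (\<integral>x. (W x)\<^sup>2 \<partial>N))"
    using Suc unfolding F_def by (simp add: ennreal_plus[symmetric] distrib_right add.commute del: ennreal_plus)
  finally show ?case unfolding F_def .
qed

section \<open>Likelihood ratios on shells around the true density\<close>

locale density_model =
  fixes M :: "'x measure" and p0 :: "'x \<Rightarrow> real"
    and d :: "('x \<Rightarrow> real) \<Rightarrow> ('x \<Rightarrow> real) \<Rightarrow> real"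
  assumes p0: "p0 \<in> prob_densities M"
    and d_metric: "density_metric M d"
    and d_le_h: "\<And>p q. p \<in> prob_densities M \<Longrightarrow> q \<in> prob_densities M \<Longrightarrow> d p q \<le> hellinger M p q"
    and d_convex: "convex_balls M d"
begin

abbreviation "P0 \<equiv> density M (\<lambda>x. ennreal (p0 x))"

text \<open>Ratios rather than densities, so that all integrals run over powers of the probability
  measure \<open>P0\<close>. Where \<open>p0\<close> vanishes the quotient is 0, but such points are
  \<open>P0\<close>-null.\<close>

definition lik_ratio :: "nat \<Rightarrow> ('x \<Rightarrow> real) \<Rightarrow> (nat \<Rightarrow> 'x) \<Rightarrow> ennreal" where
  "lik_ratio n p X = (\<Prod>i<n. ennreal (p (X i) / p0 (X i)))"

lemma p0_measurable [measurable]: "p0 \<in> borel_measurable M"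
  and p0_nonneg: "x \<in> space M \<Longrightarrow> 0 \<le> p0 x"
  and p0_mass: "(\<integral>\<^sup>+x. ennreal (p0 x) \<partial>M) = 1"
  using p0 by (auto simp: prob_densities_def)

lemma prob_space_P0: "prob_space P0"
  by (rule prob_spaceI) (simp add: emeasure_density p0_mass cong: nn_integral_cong_simp)

lemma AE_p0_pos: "AE x in P0. 0 < p0 x"
  by (subst AE_density) auto

lemma d_nonneg: "p \<in> prob_densities M \<Longrightarrow> q \<in> prob_densities M \<Longrightarrow> 0 \<le> d p q"
  and d_commute: "p \<in> prob_densities M \<Longrightarrow> q \<in> prob_densities M \<Longrightarrow> d p q = d q p"
  and d_triangle: "p \<in> prob_densities M \<Longrightarrow> q \<in> prob_densities M \<Longrightarrow> r \<in> prob_densities M \<Longrightarrow>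
    d p r \<le> d p q + d q r"
  using d_metric unfolding density_metric_def by blast+

lemma convex_combination_density:
  assumes p: "p \<in> prob_densities M" and q: "q \<in> prob_densities M" and t: "t \<in> {0..1}"
  shows "(\<lambda>x. (1 - t) * p x + t * q x) \<in> prob_densities M"
proof -
  have [measurable]: "p \<in> borel_measurable M" "q \<in> borel_measurable M"
    using p q by (auto simp: prob_densities_def)
  have nn: "0 \<le> p x" "0 \<le> q x" if "x \<in> space M" for x
    using p q that by (auto simp: prob_densities_def)
  have "(\<integral>\<^sup>+x. ennreal ((1 - t) * p x + t * q x) \<partial>M) =
      (\<integral>\<^sup>+x. ennreal (1 - t) * ennreal (p x) + ennreal t * ennreal (q x) \<partial>M)"
    using t nn by (intro nn_integral_cong) (simp add: ennreal_mult[symmetric] ennreal_plus[symmetric] del: ennreal_plus)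
  also have "\<dots> = ennreal (1 - t) * 1 + ennreal t * 1"
    using p q by (simp add: nn_integral_add nn_integral_cmult prob_densities_def)
  also have "\<dots> = 1" using t by (simp add: ennreal_plus[symmetric] del: ennreal_plus)
  finally show ?thesis using t nn by (auto simp: prob_densities_def)
qed

text \<open>Two-point convexity iterated: an average of \<open>m + 1\<close> points is a convex
  combination of the average of the first \<open>m\<close> and the last one, with weight
  \<open>1 / (m + 1)\<close>.\<close>

lemma average_in_ball:
  assumes c: "c \<in> prob_densities M"
  shows "0 < m \<Longrightarrow> (\<And>i. i < m \<Longrightarrow> p i \<in> prob_densities M \<and> d c (p i) < r) \<Longrightarrow>
    (\<lambda>x. (\<Sum>i<m. p i x) / real m) \<in> prob_densities M \<and> d c (\<lambda>x. (\<Sum>i<m. p i x) / real m) < r"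
proof (induction m)
  case (Suc m)
  show ?case
  proof (cases "m = 0")
    case True
    then show ?thesis using Suc.prems(2)[of 0] by simp
  next
    case False
    let ?a = "\<lambda>x. (\<Sum>i<m. p i x) / real m" and ?t = "1 / (real m + 1)"
    have a: "?a \<in> prob_densities M" "d c ?a < r" using Suc False by auto
    have q: "p m \<in> prob_densities M" "d c (p m) < r" using Suc.prems(2) by auto
    have t: "?t \<in> {0..1}" by simp
    have eq: "(\<lambda>x. (\<Sum>i<Suc m. p i x) / real (Suc m)) = (\<lambda>x. (1 - ?t) * ?a x + ?t * p m x)"
    proof
      fix x
      have "1 - ?t = real m / (real m + 1)" by (simp add: field_simps)
      then show "(\<Sum>i<Suc m. p i x) / real (Suc m) = (1 - ?t) * ?a x + ?t * p m x"
        using False by (simp add: add_divide_distrib add.commute)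
    qed
    show ?thesis unfolding eq
      using convex_combination_density[OF a(1) q(1) t] d_convex c a q t
      unfolding convex_balls_def by blast
  qed
qed simp

text \<open>The affinity equals one minus half the squared Hellinger distance. The exponential form
  multiplies well over observations and provides the strictly positive \<kappa> that the weighted
  mixture bound requires.\<close>

lemma affinity_le:
  assumes q: "q \<in> prob_densities M" and s: "0 \<le> s" "s \<le> d p0 q"
  shows "(\<integral>\<^sup>+x. ennreal (sqrt (q x / p0 x)) \<partial>P0) \<le> ennreal (exp (- s\<^sup>2 / 2))"
proof -
  have [measurable]: "q \<in> borel_measurable M" and q1: "(\<integral>\<^sup>+x. ennreal (q x) \<partial>M) = 1"
    using q by (auto simp: prob_densities_def)
  have nn: "0 \<le> q x" "0 \<le> p0 x" if "x \<in> space M" for x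
    using q that p0_nonneg by (auto simp: prob_densities_def)
  have ip: "integrable M p0" "integrable M q"
    using nn p0_mass q1 by (auto intro!: integrableI_nn_integral_finite[where x=1])
  have Ip: "integral\<^sup>L M p0 = 1" "integral\<^sup>L M q = 1"
    using nn p0_mass q1 by (simp_all add: integral_eq_nn_integral)
  have amgm: "sqrt (q x * p0 x) \<le> q x + p0 x" if "x \<in> space M" for x
    using nn[OF that] arith_geo_mean_sqrt[of "q x" "p0 x"] by auto
  have ii: "integrable M (\<lambda>x. sqrt (q x * p0 x))"
  proof (rule Bochner_Integration.integrable_bound[of M "\<lambda>x. q x + p0 x"])
    show "integrable M (\<lambda>x. q x + p0 x)" using ip by simp
    show "AE x in M. norm (sqrt (q x * p0 x)) \<le> norm (q x + p0 x)"
    proof (rule AE_I2)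
      fix x assume x: "x \<in> space M"
      show "norm (sqrt (q x * p0 x)) \<le> norm (q x + p0 x)"
        unfolding real_norm_def using amgm[OF x] nn[OF x] by simp
    qed
  qed measurable
  have sq: "(sqrt (p0 x) - sqrt (q x))\<^sup>2 = p0 x + q x - 2 * sqrt (q x * p0 x)" if "x \<in> space M" for x
    using nn[OF that] by (simp add: power2_diff real_sqrt_mult)
  have h: "(\<integral>x. (sqrt (p0 x) - sqrt (q x))\<^sup>2 \<partial>M) = 2 - 2 * (\<integral>x. sqrt (q x * p0 x) \<partial>M)"
    using ip ii Ip by (simp add: sq cong: Bochner_Integration.integral_cong)
  have h0: "0 \<le> (\<integral>x. (sqrt (p0 x) - sqrt (q x))\<^sup>2 \<partial>M)" by simp
  have "s \<le> hellinger M p0 q" using d_le_h[OF p0 q] s by simp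
  then have "s\<^sup>2 \<le> (hellinger M p0 q)\<^sup>2" using s by (intro power_mono) auto
  then have "s\<^sup>2 \<le> (\<integral>x. (sqrt (p0 x) - sqrt (q x))\<^sup>2 \<partial>M)"
    unfolding hellinger_def real_sqrt_pow2[OF h0] .
  then have "(\<integral>x. sqrt (q x * p0 x) \<partial>M) \<le> 1 + (- s\<^sup>2 / 2)" unfolding h by simp
  also have "\<dots> \<le> exp (- s\<^sup>2 / 2)" by (rule exp_ge_add_one_self)
  finally have le: "(\<integral>x. sqrt (q x * p0 x) \<partial>M) \<le> exp (- s\<^sup>2 / 2)" .
  have p0_meas': "(\<lambda>x. ennreal (p0 x)) \<in> borel_measurable M"
    and q_meas': "(\<lambda>x. ennreal (sqrt (q x / p0 x))) \<in> borel_measurable M" by measurable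
  have "(\<integral>\<^sup>+x. ennreal (sqrt (q x / p0 x)) \<partial>P0) = (\<integral>\<^sup>+x. ennreal (sqrt (q x * p0 x)) \<partial>M)"
    unfolding nn_integral_density[OF p0_meas' q_meas']
  proof (rule nn_integral_cong)
    fix x assume x: "x \<in> space M"
    \<comment> \<open>Where \<open>p0\<close> vanishes both sides are 0, so mass of \<open>q\<close>
      off the support of \<open>p0\<close> does no harm.\<close>
    have "p0 x * sqrt (q x / p0 x) = sqrt (q x * p0 x)"
      using nn[OF x] by (cases "p0 x = 0") (auto simp: real_sqrt_mult real_sqrt_divide field_simps)
    then show "ennreal (p0 x) * ennreal (sqrt (q x / p0 x)) = ennreal (sqrt (q x * p0 x))"
      using nn[OF x] by (simp add: ennreal_mult[symmetric])
  qed
  also have "\<dots> = ennreal (\<integral>x. sqrt (q x * p0 x) \<partial>M)"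
    using ii nn by (intro nn_integral_eq_integral AE_I2) auto
  also have "\<dots> \<le> ennreal (exp (- s\<^sup>2 / 2))" using le by (rule ennreal_leI)
  finally show ?thesis .
qed

end

section \<open>One model with its prior: covering pieces and shells\<close>

locale prior = density_model M p0 d
  for M :: "'x measure" and p0 :: "'x \<Rightarrow> real" and d +
  fixes Q :: "('x \<Rightarrow> real) measure"
  assumes prior_prob: "prob_space Q"
    and model: "space Q \<subseteq> prob_densities M"
    and model_measurable: "(\<lambda>(x, p). p x) \<in> borel_measurable (M \<Otimes>\<^sub>M Q)"
    and nbhd_measurable: "\<And>r. dist_nbhd d p0 (space Q) r \<in> sets Q"
begin

lemma ratio_measurable [measurable]: "(\<lambda>(x, p). p x / p0 x) \<in> borel_measurable (P0 \<Otimes>\<^sub>M Q)"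
proof -
  have "(\<lambda>Z. (case Z of (x, p) \<Rightarrow> p x) / p0 (fst Z)) \<in> borel_measurable (M \<Otimes>\<^sub>M Q)"
    by (rule borel_measurable_divide[OF model_measurable measurable_compose[OF measurable_fst p0_measurable]])
  moreover have "sets (P0 \<Otimes>\<^sub>M Q) = sets (M \<Otimes>\<^sub>M Q)" by (rule sets_pair_measure_cong) auto
  ultimately show ?thesis
    by (simp only: measurable_cong_sets[OF \<open>sets (P0 \<Otimes>\<^sub>M Q) = sets (M \<Otimes>\<^sub>M Q)\<close> refl] case_prod_beta')
qed

lemma lik_ratio_measurable [measurable]:
  "(\<lambda>(X, p). lik_ratio n p X) \<in> borel_measurable (sample_measure n M p0 \<Otimes>\<^sub>M Q)"
proof -
  have "(\<lambda>Z. ennreal (snd Z (fst Z i) / p0 (fst Z i))) \<in> borel_measurable (sample_measure n M p0 \<Otimes>\<^sub>M Q)"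
    if "i < n" for i
  proof -
    have "(\<lambda>Z. (fst Z i, snd Z)) \<in> sample_measure n M p0 \<Otimes>\<^sub>M Q \<rightarrow>\<^sub>M P0 \<Otimes>\<^sub>M Q"
      unfolding sample_measure_def using that
      by (intro measurable_Pair measurable_compose[OF measurable_fst measurable_component_singleton] measurable_snd) auto
    from measurable_compose[OF this ratio_measurable] show ?thesis
      by (simp add: case_prod_beta')
  qed
  then show ?thesis
    unfolding lik_ratio_def case_prod_beta' by (intro borel_measurable_prod_ennreal) auto
qed

lemma lik_ratio_section_measurable:
  assumes "X \<in> space (sample_measure n M p0)"
  shows "(\<lambda>p. lik_ratio n p X) \<in> borel_measurable Q"
  using measurable_compose[OF measurable_Pair1'[OF assms] lik_ratio_measurable[of n]] by simp

lemma model_nonneg: "p \<in> space Q \<Longrightarrow> x \<in> space M \<Longrightarrow> 0 \<le> p x"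
  using model by (auto simp: prob_densities_def)

text \<open>Finite averages of points in the piece stay in the ball around \<open>c\<close>, hence
  at distance at least \<open>s\<close> from \<open>p0\<close> by the triangle inequality. The
  separation is demanded only if the ball meets \<open>Sh\<close>, because covering balls that miss
  the shell may lie anywhere.\<close>

lemma ball_piece_bound:
  assumes Sh [measurable]: "Sh \<in> sets Q" and c: "c \<in> prob_densities M" and s: "0 \<le> s"
    and sep: "\<And>q. q \<in> Sh \<Longrightarrow> d c q < r \<Longrightarrow> r + s \<le> d p0 c" and \<theta>: "0 \<le> \<theta>"
  obtains W where "W \<in> sets Q" "{q \<in> Sh. d c q < r} \<subseteq> W"
    "(\<integral>\<^sup>+X. esqrt (ennreal \<theta> * (\<integral>\<^sup>+p. lik_ratio n p X * indicator W p \<partial>Q)) \<partial>sample_measure n M p0)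
      \<le> ennreal (sqrt (\<theta> * measure Q Sh) * exp (- real n * s\<^sup>2 / 2))"
proof -
  interpret Q: prob_space Q by (rule prior_prob)
  define U where "U = {q \<in> Sh. d c q < r}"
  have U_space: "U \<subseteq> space Q" using sets.sets_into_space[OF Sh] by (auto simp: U_def)
  obtain W0 where W0 [measurable]: "W0 \<in> sets Q" and UW0: "U \<subseteq> W0"
    and hull: "\<And>S. S \<in> sets Q \<Longrightarrow> S \<subseteq> W0 \<Longrightarrow> emeasure Q S > 0 \<Longrightarrow> S \<inter> U \<noteq> {}"
    using measurable_hull[OF _ U_space] Q.finite_measure_axioms by blast
  \<comment> \<open>Cutting the hull back to \<open>Sh\<close> bounds its prior mass by that of
    \<open>Sh\<close> and keeps every point of the piece.\<close>
  define W where "W = W0 \<inter> Sh"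
  have W [measurable]: "W \<in> sets Q" by (simp add: W_def)
  have avg: "(\<integral>\<^sup>+x. ennreal (sqrt ((\<Sum>i<m. p i x / p0 x) / real m)) \<partial>P0) \<le> ennreal (exp (- s\<^sup>2 / 2))"
    if m: "0 < m" and p: "\<And>i. i < m \<Longrightarrow> p i \<in> U" for p :: "nat \<Rightarrow> 'x \<Rightarrow> real" and m
  proof -
    let ?a = "\<lambda>x. (\<Sum>i<m. p i x) / real m"
    have pi: "p i \<in> prob_densities M \<and> d c (p i) < r" if "i < m" for i
      using p[OF that] U_space model by (auto simp: U_def)
    have a: "?a \<in> prob_densities M" "d c ?a < r"
      using average_in_ball[OF c m, of p r] pi by auto
    \<comment> \<open>Since \<open>m\<close> is positive, \<open>p 0\<close> witnesses that the ball
      meets \<open>Sh\<close>.\<close>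
    have "r + s \<le> d p0 c" using sep[of "p 0"] p[OF m] by (auto simp: U_def)
    also have "\<dots> \<le> d p0 ?a + d ?a c" by (rule d_triangle[OF p0 a(1) c])
    finally have "s \<le> d p0 ?a" using a(2) d_commute[OF a(1) c] by simp
    from affinity_le[OF a(1) s this]
    show ?thesis by (simp add: sum_divide_distrib[symmetric] mult.commute)
  qed
  have main: "(\<integral>\<^sup>+X. esqrt (\<integral>\<^sup>+p. (ennreal \<theta> * indicator W p) * (\<Prod>i<n. ennreal (p (X i) / p0 (X i))) \<partial>Q)
      \<partial>PiM {..<n} (\<lambda>_. P0))
    \<le> ennreal (exp (- s\<^sup>2 / 2) ^ n) * esqrt (\<integral>\<^sup>+p. ennreal \<theta> * indicator W p \<partial>Q)"
  proof (rule affinity_product_mixture_le[where g="\<lambda>x p. p x / p0 x" and G=U,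
        OF prob_space_P0 Q.sigma_finite_measure_axioms ratio_measurable _ _ _ U_space _ avg])
    fix S assume S: "S \<in> sets Q" and pos: "0 < (\<integral>\<^sup>+p. ennreal \<theta> * indicator W p * indicator S p \<partial>Q)"
    have "(\<integral>\<^sup>+p. ennreal \<theta> * indicator W p * indicator S p \<partial>Q) = ennreal \<theta> * emeasure Q (S \<inter> W)"
      using S by (simp add: mult.assoc nn_integral_cmult indicator_inter_arith[symmetric] Int_commute)
    then have "emeasure Q (S \<inter> W) > 0" using pos by (auto simp: zero_less_iff_neq_zero)
    then show "S \<inter> U \<noteq> {}" using hull[of "S \<inter> W"] S by (auto simp: W_def)
  qed (use U_space model_nonneg p0_nonneg in auto)
  have "(\<integral>\<^sup>+X. esqrt (ennreal \<theta> * (\<integral>\<^sup>+p. lik_ratio n p X * indicator W p \<partial>Q)) \<partial>sample_measure n M p0)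
    = (\<integral>\<^sup>+X. esqrt (\<integral>\<^sup>+p. (ennreal \<theta> * indicator W p) * (\<Prod>i<n. ennreal (p (X i) / p0 (X i))) \<partial>Q)
      \<partial>sample_measure n M p0)"
  proof (intro nn_integral_cong arg_cong[where f=esqrt])
    fix X assume "X \<in> space (sample_measure n M p0)"
    note [measurable] = lik_ratio_section_measurable[OF this]
    have "ennreal \<theta> * (\<integral>\<^sup>+p. lik_ratio n p X * indicator W p \<partial>Q) =
        (\<integral>\<^sup>+p. ennreal \<theta> * (lik_ratio n p X * indicator W p) \<partial>Q)"
      by (rule nn_integral_cmult[symmetric]) measurable
    then show "ennreal \<theta> * (\<integral>\<^sup>+p. lik_ratio n p X * indicator W p \<partial>Q) =
      (\<integral>\<^sup>+p. (ennreal \<theta> * indicator W p) * (\<Prod>i<n. ennreal (p (X i) / p0 (X i))) \<partial>Q)"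
      by (simp add: lik_ratio_def mult_ac)
  qed
  also have "\<dots> \<le> ennreal (exp (- s\<^sup>2 / 2) ^ n) * esqrt (\<integral>\<^sup>+p. ennreal \<theta> * indicator W p \<partial>Q)"
    unfolding sample_measure_def by (rule main)
  also have "(\<integral>\<^sup>+p. ennreal \<theta> * indicator W p \<partial>Q) = ennreal (\<theta> * measure Q W)"
    using \<theta> by (simp add: nn_integral_cmult Q.emeasure_eq_measure ennreal_mult)
  also have "esqrt \<dots> \<le> ennreal (sqrt (\<theta> * measure Q Sh))"
    using \<theta> by (subst esqrt_ennreal)
      (auto intro!: ennreal_leI mult_left_mono Q.finite_measure_mono simp: W_def)
  also have "exp (- s\<^sup>2 / 2) ^ n = exp (- real n * s\<^sup>2 / 2)"
    by (simp add: exp_of_nat_mult[symmetric])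
  also have "ennreal (exp (- real n * s\<^sup>2 / 2)) * ennreal (sqrt (\<theta> * measure Q Sh)) =
      ennreal (sqrt (\<theta> * measure Q Sh) * exp (- real n * s\<^sup>2 / 2))"
    by (subst mult.commute, rule ennreal_mult''[symmetric]) simp
  finally have "(\<integral>\<^sup>+X. esqrt (ennreal \<theta> * (\<integral>\<^sup>+p. lik_ratio n p X * indicator W p \<partial>Q)) \<partial>sample_measure n M p0)
      \<le> ennreal (sqrt (\<theta> * measure Q Sh) * exp (- real n * s\<^sup>2 / 2))"
    by (simp add: mult_left_mono)
  moreover have "U \<subseteq> W" using UW0 by (auto simp: W_def U_def)
  ultimately show ?thesis using that W unfolding U_def by blast
qed

lemma lik_ratio_integral_measurable:
  assumes [measurable]: "W \<in> sets Q"
  shows "(\<lambda>X. \<integral>\<^sup>+p. lik_ratio n p X * indicator W p \<partial>Q) \<in> borel_measurable (sample_measure n M p0)"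
proof -
  interpret Q: prob_space Q by (rule prior_prob)
  show ?thesis by measurable
qed

text \<open>
  Shells \<open>k e < d p p0 \<le> (k + 1) e\<close>, covered by balls of radius \<open>(k + 1) e / 6\<close>: a ball that meets
  the shell is at distance at least \<open>k e - 2 (k + 1) e / 6 = (2 k - 1) e / 3\<close> from \<open>p0\<close>.
\<close>

lemma far_mass_bound:
  assumes e: "0 < e" and k0: "1 \<le> k0" and \<theta>: "0 \<le> \<theta>"
    and cover: "\<And>k. k0 \<le> k \<Longrightarrow> \<exists>F. finite F \<and> F \<subseteq> space Q \<and> real (card F) \<le> Nc \<and>
      dist_nbhd d p0 (space Q) ((real k + 1) * e) \<subseteq> (\<Union>c\<in>F. {q. d c q < (real k + 1) * e / 6})"
  shows "(\<integral>\<^sup>+X. min 1 (ennreal \<theta> *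
        (\<integral>\<^sup>+p. lik_ratio n p X * indicator (space Q - dist_nbhd d p0 (space Q) (real k0 * e)) p \<partial>Q))
      \<partial>sample_measure n M p0)
    \<le> (\<Sum>k. ennreal (Nc * sqrt (\<theta> * measure Q (dist_nbhd d p0 (space Q) ((real (k + k0) + 1) * e))) *
        exp (- real n * (2 * real (k + k0) - 1)\<^sup>2 * e\<^sup>2 / 18)))"
proof -
  interpret Q: prob_space Q by (rule prior_prob)
  define C where "C r = dist_nbhd d p0 (space Q) r" for r
  have C [measurable]: "C r \<in> sets Q" for r unfolding C_def by (rule nbhd_measurable)
  \<comment> \<open>Measurable because only balls around \<open>p0\<close> enter.\<close>
  define Sh where "Sh k = C ((real k + 1) * e) - C (real k * e)" for k :: nat
  have Sh [measurable]: "Sh k \<in> sets Q" for k by (simp add: Sh_def)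
  obtain F where F: "\<And>k. k0 \<le> k \<Longrightarrow> finite (F k)" "\<And>k. k0 \<le> k \<Longrightarrow> F k \<subseteq> space Q"
    "\<And>k. k0 \<le> k \<Longrightarrow> real (card (F k)) \<le> Nc"
    "\<And>k. k0 \<le> k \<Longrightarrow> C ((real k + 1) * e) \<subseteq> (\<Union>c\<in>F k. {q. d c q < (real k + 1) * e / 6})"
    using cover unfolding C_def by metis
  define R where "R k c W \<longleftrightarrow> W \<in> sets Q \<and> {q \<in> Sh k. d c q < (real k + 1) * e / 6} \<subseteq> W \<and>
      (\<integral>\<^sup>+X. esqrt (ennreal \<theta> * (\<integral>\<^sup>+p. lik_ratio n p X * indicator W p \<partial>Q)) \<partial>sample_measure n M p0)
      \<le> ennreal (sqrt (\<theta> * measure Q (Sh k)) * exp (- real n * ((2 * real k - 1) * e / 3)\<^sup>2 / 2))" for k c W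
  have "\<exists>W. R k c W"
    if k: "k0 \<le> k" and c: "c \<in> F k" for k c
  proof (rule ball_piece_bound[of "Sh k" c "(2 * real k - 1) * e / 3" "(real k + 1) * e / 6" \<theta>])
    show cM: "c \<in> prob_densities M" using F(2)[OF k] c model by auto
    have "1 \<le> real k" using k k0 by simp
    then show "0 \<le> (2 * real k - 1) * e / 3" using e by simp
    fix q assume q: "q \<in> Sh k" "d c q < (real k + 1) * e / 6"
    have qM: "q \<in> prob_densities M" and "q \<in> space Q"
      using q(1) model sets.sets_into_space[OF Sh] by blast+
    then have "real k * e < d q p0" using q(1) by (auto simp: Sh_def C_def dist_nbhd_def)
    also have "d q p0 \<le> d q c + d c p0" by (rule d_triangle[OF qM cM p0])
    finally have "real k * e < d c q + d p0 c"
      using d_commute[OF qM cM] d_commute[OF p0 cM] by simp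
    then show "(real k + 1) * e / 6 + (2 * real k - 1) * e / 3 \<le> d p0 c"
      using q(2) by (simp add: field_simps)
  qed (use \<theta> in \<open>auto simp: R_def\<close>)
  then obtain W where R: "\<And>k c. k0 \<le> k \<Longrightarrow> c \<in> F k \<Longrightarrow> R k c (W k c)"
    by metis
  note W = R[unfolded R_def, THEN conjunct1]
    and W_cover = R[unfolded R_def, THEN conjunct2, THEN conjunct1]
    and W_le = R[unfolded R_def, THEN conjunct2, THEN conjunct2]
  define y where "y k c X = ennreal \<theta> * (\<integral>\<^sup>+p. lik_ratio n p X * indicator (W (k + k0) c) p \<partial>Q)" for k c X
  have y_meas: "y k c \<in> borel_measurable (sample_measure n M p0)" if "c \<in> F (k + k0)" for k c
    unfolding y_def[abs_def] using lik_ratio_integral_measurable[OF W[of "k + k0" c]] that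
    by (intro borel_measurable_times_ennreal) auto
  \<comment> \<open>Domination suffices: the hulls may overlap and reach beyond their balls.\<close>
  have ind: "indicator (space Q - C (real k0 * e)) p \<le>
      (\<Sum>k. \<Sum>c\<in>F (k + k0). (indicator (W (k + k0) c) p :: ennreal))" if p: "p \<in> space Q" for p
  proof (cases "p \<in> C (real k0 * e)")
    case False
    \<comment> \<open>The ceiling matches shells that are open on the inside and closed on the
      outside; the point lies beyond \<open>real k0 * e\<close>, so the natural subtraction loses
      nothing.\<close>
    define k where "k = nat \<lceil>d p p0 / e\<rceil> - 1"
    have "real k0 * e < d p p0" using False p by (auto simp: C_def dist_nbhd_def)
    then have k0': "real k0 < d p p0 / e" using e by (simp add: pos_less_divide_eq)
    then have c1: "int k0 + 1 \<le> \<lceil>d p p0 / e\<rceil>" by linarith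
    then have kk: "k0 \<le> k" unfolding k_def by linarith
    have "real k + 1 = of_int \<lceil>d p p0 / e\<rceil>" unfolding k_def using c1 by linarith
    then have "real k < d p p0 / e" "d p p0 / e \<le> real k + 1" by linarith+
    then have "real k * e < d p p0" "d p p0 \<le> (real k + 1) * e"
      using e by (simp_all add: pos_less_divide_eq pos_divide_le_eq)
    then have pS: "p \<in> Sh k" using p by (auto simp: Sh_def C_def dist_nbhd_def)
    then have "p \<in> C ((real k + 1) * e)" by (simp add: Sh_def)
    then obtain c where c: "c \<in> F k" "d c p < (real k + 1) * e / 6" using F(4)[OF kk] by auto
    have "p \<in> W k c" using W_cover[OF kk c(1)] pS c(2) by auto
    have "indicator (space Q - C (real k0 * e)) p \<le> (indicator (W k c) p :: ennreal)"
      using \<open>p \<in> W k c\<close> by (simp add: indicator_def)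
    also have "\<dots> \<le> (\<Sum>c\<in>F k. indicator (W k c) p)"
      using c(1) F(1)[OF kk] by (intro member_le_sum) auto
    also have "\<dots> = (\<Sum>k\<in>{k - k0}. \<Sum>c\<in>F (k + k0). indicator (W (k + k0) c) p)" using kk by simp
    also have "\<dots> \<le> (\<Sum>k. \<Sum>c\<in>F (k + k0). indicator (W (k + k0) c) p)"
      by (intro sum_le_suminf) auto
    finally show ?thesis .
  qed (simp add: indicator_def)
  have pt: "min 1 (ennreal \<theta> * (\<integral>\<^sup>+p. lik_ratio n p X * indicator (space Q - C (real k0 * e)) p \<partial>Q))
      \<le> (\<Sum>k. \<Sum>c\<in>F (k + k0). esqrt (y k c X))" if X: "X \<in> space (sample_measure n M p0)" for X
  proof -
    have meas: "(\<lambda>p. lik_ratio n p X * indicator (W (k + k0) c) p) \<in> borel_measurable Q"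
      if "c \<in> F (k + k0)" for k c
      using lik_ratio_section_measurable[OF X] W[of "k + k0" c] that
      by (intro borel_measurable_times_ennreal borel_measurable_indicator) auto
    have "(\<integral>\<^sup>+p. lik_ratio n p X * indicator (space Q - C (real k0 * e)) p \<partial>Q)
       \<le> (\<integral>\<^sup>+p. (\<Sum>k. \<Sum>c\<in>F (k + k0). lik_ratio n p X * indicator (W (k + k0) c) p) \<partial>Q)"
      using ind by (intro nn_integral_mono) (simp add: sum_distrib_left[symmetric] mult_left_mono)
    also have "\<dots> = (\<Sum>k. \<integral>\<^sup>+p. (\<Sum>c\<in>F (k + k0). lik_ratio n p X * indicator (W (k + k0) c) p) \<partial>Q)"
      using meas by (intro nn_integral_suminf borel_measurable_sum) auto
    also have "\<dots> = (\<Sum>k. \<Sum>c\<in>F (k + k0). \<integral>\<^sup>+p. lik_ratio n p X * indicator (W (k + k0) c) p \<partial>Q)"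
      using meas by (intro suminf_cong nn_integral_sum) auto
    finally have "ennreal \<theta> * (\<integral>\<^sup>+p. lik_ratio n p X * indicator (space Q - C (real k0 * e)) p \<partial>Q)
      \<le> ennreal \<theta> * \<dots>" by (intro mult_left_mono) auto
    also have "\<dots> = (\<Sum>k. \<Sum>c\<in>F (k + k0). y k c X)"
      unfolding y_def by (simp add: sum_distrib_left[symmetric] ennreal_suminf_cmult)
    finally have "min 1 (ennreal \<theta> * (\<integral>\<^sup>+p. lik_ratio n p X * indicator (space Q - C (real k0 * e)) p \<partial>Q))
      \<le> min 1 (\<Sum>k. \<Sum>c\<in>F (k + k0). y k c X)" by (rule min.mono[OF order.refl])
    also have "\<dots> \<le> (\<Sum>k. min 1 (\<Sum>c\<in>F (k + k0). y k c X))" by (rule min_1_suminf_le)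
    also have "\<dots> \<le> (\<Sum>k. \<Sum>c\<in>F (k + k0). esqrt (y k c X))"
      using F(1) by (intro suminf_le order.trans[OF min_1_sum_le] sum_mono min_1_le_esqrt) auto
    finally show ?thesis .
  qed
  have em: "(\<lambda>X. esqrt (y k c X)) \<in> borel_measurable (sample_measure n M p0)" if "c \<in> F (k + k0)" for k c
    using y_meas[OF that] by measurable
  have "(\<integral>\<^sup>+X. min 1 (ennreal \<theta> *
        (\<integral>\<^sup>+p. lik_ratio n p X * indicator (space Q - C (real k0 * e)) p \<partial>Q)) \<partial>sample_measure n M p0)
     \<le> (\<integral>\<^sup>+X. (\<Sum>k. \<Sum>c\<in>F (k + k0). esqrt (y k c X)) \<partial>sample_measure n M p0)"
    by (intro nn_integral_mono pt)
  also have "\<dots> = (\<Sum>k. \<integral>\<^sup>+X. (\<Sum>c\<in>F (k + k0). esqrt (y k c X)) \<partial>sample_measure n M p0)"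
    using em by (intro nn_integral_suminf borel_measurable_sum) auto
  also have "\<dots> = (\<Sum>k. \<Sum>c\<in>F (k + k0). \<integral>\<^sup>+X. esqrt (y k c X) \<partial>sample_measure n M p0)"
    using em by (intro suminf_cong nn_integral_sum) auto
  also have "\<dots> \<le> (\<Sum>k. ennreal (Nc * sqrt (\<theta> * measure Q (C ((real (k + k0) + 1) * e))) *
        exp (- real n * (2 * real (k + k0) - 1)\<^sup>2 * e\<^sup>2 / 18)))"
  proof (intro suminf_le)
    fix k
    let ?j = "k + k0"
    let ?b = "sqrt (\<theta> * measure Q (C ((real ?j + 1) * e))) * exp (- real n * (2 * real ?j - 1)\<^sup>2 * e\<^sup>2 / 18)"
    have b0: "0 \<le> ?b" using \<theta> by simp
    have ex: "- real n * ((2 * real ?j - 1) * e / 3)\<^sup>2 / 2 = - real n * (2 * real ?j - 1)\<^sup>2 * e\<^sup>2 / 18"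
      by (simp add: power_mult_distrib power_divide)
    have "(\<integral>\<^sup>+X. esqrt (y k c X) \<partial>sample_measure n M p0) \<le> ennreal ?b" if c: "c \<in> F ?j" for c
    proof -
      have "(\<integral>\<^sup>+X. esqrt (y k c X) \<partial>sample_measure n M p0) \<le>
        ennreal (sqrt (\<theta> * measure Q (Sh ?j)) * exp (- real n * (2 * real ?j - 1)\<^sup>2 * e\<^sup>2 / 18))"
        using W_le[of ?j c] c unfolding y_def ex by simp
      \<comment> \<open>The shell is enlarged to its outer ball, whose prior mass is what the prior
        conditions control.\<close>
      also have "\<dots> \<le> ennreal ?b"
        using \<theta> by (intro ennreal_leI mult_right_mono real_sqrt_le_mono mult_left_mono Q.finite_measure_mono)
          (auto simp: Sh_def)
      finally show ?thesis .
    qed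
    then have "(\<Sum>c\<in>F ?j. \<integral>\<^sup>+X. esqrt (y k c X) \<partial>sample_measure n M p0) \<le> of_nat (card (F ?j)) * ennreal ?b"
      by (intro sum_bounded_above)
    also have "\<dots> = ennreal (real (card (F ?j)) * ?b)"
      using b0 by (simp add: ennreal_mult ennreal_of_nat_eq_real_of_nat)
    also have "\<dots> \<le> ennreal (Nc * ?b)"
      using F(3)[of ?j] b0 by (intro ennreal_leI mult_right_mono) auto
    finally show "(\<Sum>c\<in>F ?j. \<integral>\<^sup>+X. esqrt (y k c X) \<partial>sample_measure n M p0) \<le>
      ennreal (Nc * sqrt (\<theta> * measure Q (C ((real ?j + 1) * e))) *
        exp (- real n * (2 * real ?j - 1)\<^sup>2 * e\<^sup>2 / 18))" by (simp only: mult.assoc)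
  qed auto
  finally show ?thesis unfolding C_def .
qed

end

section \<open>Moments and lower deviations of likelihood ratios\<close>

context density_model
begin

lemma prob_space_sample: "prob_space (sample_measure n M p0)"
  unfolding sample_measure_def by (intro prob_space_PiM prob_space_P0)

lemma AE_sample_pos:
  "AE X in sample_measure n M p0. X \<in> space (sample_measure n M p0) \<and> (\<forall>i<n. X i \<in> space M \<and> 0 < p0 (X i))"
proof -
  have "AE X in sample_measure n M p0. 0 < p0 (X i)" if "i < n" for i
    unfolding sample_measure_def using that AE_p0_pos prob_space_P0
    by (intro AE_PiM_component) auto
  then have ae: "AE X in sample_measure n M p0. \<forall>i\<in>{..<n}. 0 < p0 (X i)"
    by (intro AE_finite_allI) auto
  have sp: "X i \<in> space M" if "X \<in> space (sample_measure n M p0)" "i < n" for X i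
    using that by (auto simp: sample_measure_def space_PiM PiE_def)
  show ?thesis by (rule AE_mp[OF ae], rule AE_I2) (use sp in auto)
qed

text \<open>Only an inequality, since \<open>p\<close> may put mass where \<open>p0\<close>
  vanishes.\<close>

lemma expectation_lik_ratio_le:
  assumes p: "p \<in> prob_densities M"
  shows "(\<integral>\<^sup>+X. lik_ratio n p X \<partial>sample_measure n M p0) \<le> 1"
proof -
  interpret P0: prob_space P0 by (rule prob_space_P0)
  interpret P: product_prob_space "\<lambda>_::nat. P0" ..
  have [measurable]: "p \<in> borel_measurable M" and p1: "(\<integral>\<^sup>+x. ennreal (p x) \<partial>M) = 1"
    and nn: "\<And>x. x \<in> space M \<Longrightarrow> 0 \<le> p x"
    using p by (auto simp: prob_densities_def)
  have m1: "(\<lambda>x. ennreal (p0 x)) \<in> borel_measurable M" "(\<lambda>x. ennreal (p x / p0 x)) \<in> borel_measurable M"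
    by measurable
  have "(\<integral>\<^sup>+x. ennreal (p x / p0 x) \<partial>P0) = (\<integral>\<^sup>+x. ennreal (p0 x) * ennreal (p x / p0 x) \<partial>M)"
    by (rule nn_integral_density[OF m1])
  also have "\<dots> \<le> (\<integral>\<^sup>+x. ennreal (p x) \<partial>M)"
  proof (rule nn_integral_mono)
    fix x assume x: "x \<in> space M"
    have "p0 x * (p x / p0 x) \<le> p x" using nn[OF x] by (cases "p0 x = 0") auto
    then show "ennreal (p0 x) * ennreal (p x / p0 x) \<le> ennreal (p x)"
      using p0_nonneg[OF x] by (simp only: ennreal_mult'[symmetric] ennreal_leI)
  qed
  finally have le: "(\<integral>\<^sup>+x. ennreal (p x / p0 x) \<partial>P0) \<le> 1" by (simp add: p1)
  have "(\<integral>\<^sup>+X. lik_ratio n p X \<partial>sample_measure n M p0) = (\<Prod>i<n. \<integral>\<^sup>+x. ennreal (p x / p0 x) \<partial>P0)"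
    unfolding lik_ratio_def sample_measure_def
    by (rule P.product_nn_integral_prod) (use m1(2) in auto)
  also have "\<dots> \<le> 1" using le by (simp add: power_le_one)
  finally show ?thesis .
qed

text \<open>Chebyshev's inequality for the log likelihood ratio: its mean is at least
  \<open>- n * e^2\<close> and its variance at most \<open>n * e^2\<close>, so a further drop by
  \<open>c * n * e^2\<close> has probability at most \<open>1 / (c^2 * n * e^2)\<close>.\<close>

lemma lik_ratio_lower_deviation:
  assumes p: "p \<in> KL_nbhd M p0 (prob_densities M) e" and e: "0 < e" and n: "1 \<le> n" and c: "0 < c"
  shows "emeasure (sample_measure n M p0)
      {X \<in> space (sample_measure n M p0). lik_ratio n p X < ennreal (exp (- (1 + c) * real n * e\<^sup>2))}
    \<le> ennreal (1 / (c\<^sup>2 * real n * e\<^sup>2))"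
proof -
  interpret P0: prob_space P0 by (rule prob_space_P0)
  interpret S: prob_space "sample_measure n M p0" by (rule prob_space_sample)
  have [measurable]: "p \<in> borel_measurable M"
    and pos: "AE x in P0. 0 < p x"
    and m1: "- (\<integral>x. ln (p x / p0 x) \<partial>P0) \<le> e\<^sup>2"
    and m2: "(\<integral>\<^sup>+x. ennreal ((ln (p x / p0 x))\<^sup>2) \<partial>P0) \<le> ennreal (e\<^sup>2)"
    using p by (auto simp: KL_nbhd_def prob_densities_def)
  define Y where "Y x = ln (p x / p0 x)" for x
  have Ym [measurable]: "Y \<in> borel_measurable P0" unfolding Y_def[abs_def] by measurable
  have Y2: "integrable P0 (\<lambda>x. (Y x)\<^sup>2)"
    using m2 by (intro integrableI_bounded) (auto simp: Y_def top_unique less_top[symmetric])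
  have Y1: "integrable P0 Y" by (rule P0.square_integrable_imp_integrable[OF Ym Y2])
  define \<mu> where "\<mu> = (\<integral>x. Y x \<partial>P0)"
  define W where "W x = Y x - \<mu>" for x
  have Wm [measurable]: "W \<in> borel_measurable P0" unfolding W_def[abs_def] by measurable
  have W1: "integrable P0 W" unfolding W_def[abs_def] using Y1 by simp
  have W0: "(\<integral>x. W x \<partial>P0) = 0" unfolding W_def using Y1 P0.prob_space by (simp add: \<mu>_def)
  have W2: "integrable P0 (\<lambda>x. (W x)\<^sup>2)"
    unfolding W_def power2_diff using Y1 Y2 by simp
  have "ennreal (\<integral>x. (Y x)\<^sup>2 \<partial>P0) \<le> ennreal (e\<^sup>2)"
    using m2 nn_integral_eq_integral[OF Y2] by (simp add: Y_def)
  then have "(\<integral>x. (Y x)\<^sup>2 \<partial>P0) \<le> e\<^sup>2" by (simp add: ennreal_le_iff)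
  moreover have "(\<integral>x. (W x)\<^sup>2 \<partial>P0) = (\<integral>x. (Y x)\<^sup>2 \<partial>P0) - \<mu>\<^sup>2"
    unfolding W_def \<mu>_def by (rule P0.variance_eq[OF Y1 Y2])
  ultimately have var: "(\<integral>x. (W x)\<^sup>2 \<partial>P0) \<le> e\<^sup>2" using zero_le_power2[of \<mu>] by linarith
  define a where "a = c * real n * e\<^sup>2"
  have a: "0 < a" using c e n by (simp add: a_def)
  have [measurable]: "(\<lambda>X. \<Sum>i<n. W (X i)) \<in> borel_measurable (sample_measure n M p0)"
    unfolding sample_measure_def by measurable
  have pos_all: "AE X in sample_measure n M p0. \<forall>i\<in>{..<n}. 0 < p (X i)"
  proof (intro AE_finite_allI)
    show "AE X in sample_measure n M p0. 0 < p (X i)" if "i \<in> {..<n}" for i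
      unfolding sample_measure_def using that pos prob_space_P0
      by (intro AE_PiM_component) auto
  qed simp
  \<comment> \<open>Only almost surely: where \<open>p\<close> or \<open>p0\<close> vanishes,
    \<open>ln\<close> takes a default value and the product is not the exponential of the
    sum.\<close>
  have ev: "AE X in sample_measure n M p0.
      lik_ratio n p X < ennreal (exp (- (1 + c) * real n * e\<^sup>2)) \<longrightarrow> a\<^sup>2 \<le> (\<Sum>i<n. W (X i))\<^sup>2"
    using pos_all AE_sample_pos
  proof eventually_elim
    case (elim X)
    have "lik_ratio n p X = (\<Prod>i<n. ennreal (exp (Y (X i))))"
      unfolding lik_ratio_def Y_def using elim by (intro prod.cong) auto
    also have "\<dots> = ennreal (exp (\<Sum>i<n. Y (X i)))" by (simp add: prod_ennreal exp_sum)
    finally have L: "lik_ratio n p X = ennreal (exp (\<Sum>i<n. Y (X i)))" .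
    have sumW: "(\<Sum>i<n. W (X i)) = (\<Sum>i<n. Y (X i)) - real n * \<mu>"
      by (simp add: W_def sum_subtractf)
    have "- e\<^sup>2 \<le> \<mu>" using m1 by (simp add: \<mu>_def Y_def)
    then have "real n * (- e\<^sup>2) \<le> real n * \<mu>" by (rule mult_left_mono) simp
    then have nm: "- (real n * e\<^sup>2) \<le> real n * \<mu>" by simp
    show ?case
    proof
      assume "lik_ratio n p X < ennreal (exp (- (1 + c) * real n * e\<^sup>2))"
      then have "(\<Sum>i<n. Y (X i)) < - (1 + c) * real n * e\<^sup>2"
        unfolding L by (simp add: ennreal_less_iff)
      then have "(\<Sum>i<n. Y (X i)) < - (real n * e\<^sup>2) - a" by (simp add: a_def algebra_simps)
      then have "a \<le> - (\<Sum>i<n. W (X i))" using nm sumW by linarith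
      then have "a\<^sup>2 \<le> (- (\<Sum>i<n. W (X i)))\<^sup>2" using a by (intro power_mono) auto
      then show "a\<^sup>2 \<le> (\<Sum>i<n. W (X i))\<^sup>2" by simp
    qed
  qed
  have "emeasure (sample_measure n M p0)
      {X \<in> space (sample_measure n M p0). lik_ratio n p X < ennreal (exp (- (1 + c) * real n * e\<^sup>2))}
    \<le> emeasure (sample_measure n M p0)
      {X \<in> space (sample_measure n M p0). 1 \<le> ennreal (1 / a\<^sup>2) * ennreal ((\<Sum>i<n. W (X i))\<^sup>2)}"
  proof (rule emeasure_mono_AE)
    show "AE X in sample_measure n M p0.
      X \<in> {X \<in> space (sample_measure n M p0). lik_ratio n p X < ennreal (exp (- (1 + c) * real n * e\<^sup>2))} \<longrightarrow>
      X \<in> {X \<in> space (sample_measure n M p0). 1 \<le> ennreal (1 / a\<^sup>2) * ennreal ((\<Sum>i<n. W (X i))\<^sup>2)}"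
      using ev
    proof eventually_elim
      case (elim X)
      have "1 \<le> ennreal (1 / a\<^sup>2) * ennreal ((\<Sum>i<n. W (X i))\<^sup>2)" if "a\<^sup>2 \<le> (\<Sum>i<n. W (X i))\<^sup>2"
        using that a by (simp add: ennreal_mult'[symmetric] flip: ennreal_1)
      then show ?case using elim by auto
    qed
    show "{X \<in> space (sample_measure n M p0). 1 \<le> ennreal (1 / a\<^sup>2) * ennreal ((\<Sum>i<n. W (X i))\<^sup>2)}
        \<in> sets (sample_measure n M p0)" by measurable
  qed
  also have "\<dots> \<le> ennreal (1 / a\<^sup>2) * (\<integral>\<^sup>+X. ennreal ((\<Sum>i<n. W (X i))\<^sup>2) *
      indicator (space (sample_measure n M p0)) X \<partial>sample_measure n M p0)"
    by (rule nn_integral_Markov_inequality) measurable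
  also have "(\<integral>\<^sup>+X. ennreal ((\<Sum>i<n. W (X i))\<^sup>2) * indicator (space (sample_measure n M p0)) X
      \<partial>sample_measure n M p0) = (\<integral>\<^sup>+X. ennreal ((\<Sum>i<n. W (X i))\<^sup>2) \<partial>sample_measure n M p0)"
    by (intro nn_integral_cong) simp
  also have "\<dots> = ennreal (real n * (\<integral>x. (W x)\<^sup>2 \<partial>P0))"
    unfolding sample_measure_def by (rule iid_sum_second_moment[OF prob_space_P0 Wm W1 W2 W0])
  also have "ennreal (1 / a\<^sup>2) * \<dots> \<le> ennreal (1 / a\<^sup>2) * ennreal (real n * e\<^sup>2)"
    using var by (intro mult_left_mono ennreal_leI) auto
  also have "\<dots> = ennreal (1 / a\<^sup>2 * (real n * e\<^sup>2))"
    by (subst ennreal_mult') auto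
  also have "1 / a\<^sup>2 * (real n * e\<^sup>2) = 1 / (c\<^sup>2 * real n * e\<^sup>2)"
    using c e n by (simp add: a_def power2_eq_square)
  finally show ?thesis .
qed

end

section \<open>Evidence and total mass under one prior\<close>

context prior
begin

text \<open>By Fubini, since every likelihood ratio has expectation at most one. This serves the
  central ball, where no separation from \<open>p0\<close> is available.\<close>

lemma lik_ratio_mass_le:
  assumes W: "W \<in> sets Q"
  shows "(\<integral>\<^sup>+X. (\<integral>\<^sup>+p. lik_ratio n p X * indicator W p \<partial>Q) \<partial>sample_measure n M p0) \<le> emeasure Q W"
proof -
  interpret Q: prob_space Q by (rule prior_prob)
  interpret S: prob_space "sample_measure n M p0" by (rule prob_space_sample)
  interpret SQ: pair_prob_space "sample_measure n M p0" Q ..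
  have m: "(\<lambda>Z. lik_ratio n (snd Z) (fst Z) * indicator W (snd Z)) \<in>
      borel_measurable (sample_measure n M p0 \<Otimes>\<^sub>M Q)"
    using lik_ratio_measurable[of n] W unfolding case_prod_beta' by measurable
  have "(\<integral>\<^sup>+X. (\<integral>\<^sup>+p. lik_ratio n p X * indicator W p \<partial>Q) \<partial>sample_measure n M p0) =
      (\<integral>\<^sup>+p. (\<integral>\<^sup>+X. lik_ratio n p X * indicator W p \<partial>sample_measure n M p0) \<partial>Q)"
    using SQ.Fubini[OF m] by simp
  also have "\<dots> \<le> (\<integral>\<^sup>+p. indicator W p \<partial>Q)"
  proof (rule nn_integral_mono)
    fix p assume "p \<in> space Q"
    then have "(\<integral>\<^sup>+X. lik_ratio n p X \<partial>sample_measure n M p0) \<le> 1"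
      using model expectation_lik_ratio_le by blast
    then show "(\<integral>\<^sup>+X. lik_ratio n p X * indicator W p \<partial>sample_measure n M p0) \<le> indicator W p"
      by (auto simp: indicator_def)
  qed
  also have "\<dots> = emeasure Q W" using W by simp
  finally show ?thesis .
qed

text \<open>
  Chebyshev's inequality is applied to each density separately; by Markov's inequality most densities then
  have a large likelihood ratio simultaneously, which costs a factor \<open>2\<close> but avoids Jensen's inequality.
\<close>

lemma evidence_lower_bound:
  assumes K: "0 < measure Q (KL_nbhd M p0 (space Q) e)" and e: "0 < e" and n: "1 \<le> n" and c: "0 < c"
  shows "emeasure (sample_measure n M p0)
      {X \<in> space (sample_measure n M p0). (\<integral>\<^sup>+p. lik_ratio n p X \<partial>Q) <
        ennreal (exp (- (1 + c) * real n * e\<^sup>2) * measure Q (KL_nbhd M p0 (space Q) e) / 2)}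
    \<le> ennreal (2 / (c\<^sup>2 * real n * e\<^sup>2))"
proof -
  interpret Q: prob_space Q by (rule prior_prob)
  interpret S: prob_space "sample_measure n M p0" by (rule prob_space_sample)
  interpret SQ: pair_prob_space "sample_measure n M p0" Q ..
  define B where "B = KL_nbhd M p0 (space Q) e"
  define w where "w = measure Q B"
  define t where "t = exp (- (1 + c) * real n * e\<^sup>2)"
  have t: "0 < t" by (simp add: t_def)
  have w: "0 < w" using K by (simp add: w_def B_def)
  \<comment> \<open>Positive mass forces measurability, because \<open>measure\<close> is 0 on sets
    outside the \<sigma>-field.\<close>
  then have B [measurable]: "B \<in> sets Q" by (metis measure_notin_sets w_def less_irrefl)
  define \<tau> where "\<tau> = 1 / (c\<^sup>2 * real n * e\<^sup>2)"
  have \<tau>: "0 \<le> \<tau>" by (simp add: \<tau>_def)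
  \<comment> \<open>Pairs of a sample and a density with too small a likelihood ratio;
    \<open>u X\<close> below is the prior mass of such densities inside \<open>B\<close>.\<close>
  define D where "D = {Z \<in> space (sample_measure n M p0 \<Otimes>\<^sub>M Q). lik_ratio n (snd Z) (fst Z) < ennreal t}"
  have D [measurable]: "D \<in> sets (sample_measure n M p0 \<Otimes>\<^sub>M Q)"
    unfolding D_def using lik_ratio_measurable[of n] unfolding case_prod_beta' by measurable
  define u where "u X = (\<integral>\<^sup>+p. indicator D (X, p) * indicator B p \<partial>Q)" for X
  have um: "(\<lambda>Z. indicator D (fst Z, snd Z) * (indicator B (snd Z) :: ennreal)) \<in>
      borel_measurable (sample_measure n M p0 \<Otimes>\<^sub>M Q)"
    by measurable
  have u_meas [measurable]: "u \<in> borel_measurable (sample_measure n M p0)"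
    unfolding u_def[abs_def] using um
    by (intro Q.borel_measurable_nn_integral) (simp add: case_prod_beta')
  have Eu: "(\<integral>\<^sup>+X. u X \<partial>sample_measure n M p0) \<le> ennreal (\<tau> * w)"
  proof -
    have "(\<integral>\<^sup>+X. u X \<partial>sample_measure n M p0) =
        (\<integral>\<^sup>+p. (\<integral>\<^sup>+X. indicator D (X, p) * indicator B p \<partial>sample_measure n M p0) \<partial>Q)"
      unfolding u_def using SQ.Fubini[OF um] by simp
    also have "\<dots> \<le> (\<integral>\<^sup>+p. ennreal \<tau> * indicator B p \<partial>Q)"
    proof (rule nn_integral_mono)
      fix p assume p: "p \<in> space Q"
      show "(\<integral>\<^sup>+X. indicator D (X, p) * indicator B p \<partial>sample_measure n M p0) \<le> ennreal \<tau> * indicator B p"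
      proof (cases "p \<in> B")
        case True
        then have "p \<in> KL_nbhd M p0 (prob_densities M) e"
          using model by (auto simp: B_def KL_nbhd_def)
        from lik_ratio_lower_deviation[OF this e n c]
        have le: "emeasure (sample_measure n M p0)
          {X \<in> space (sample_measure n M p0). lik_ratio n p X < ennreal t} \<le> ennreal \<tau>"
          by (simp add: t_def \<tau>_def)
        have "(\<lambda>X. (X, p)) -` D \<inter> space (sample_measure n M p0) =
            {X \<in> space (sample_measure n M p0). lik_ratio n p X < ennreal t}"
          using p by (auto simp: D_def space_pair_measure)
        moreover have "(\<lambda>X. (X, p)) -` D \<inter> space (sample_measure n M p0) \<in> sets (sample_measure n M p0)"
          by (rule measurable_sets[OF measurable_Pair2'[OF p] D])
        ultimately have Ds: "{X \<in> space (sample_measure n M p0). lik_ratio n p X < ennreal t} \<in> sets (sample_measure n M p0)"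
          by simp
        have "(\<integral>\<^sup>+X. indicator D (X, p) * indicator B p \<partial>sample_measure n M p0) =
          (\<integral>\<^sup>+X. indicator {X \<in> space (sample_measure n M p0). lik_ratio n p X < ennreal t} X \<partial>sample_measure n M p0)"
          using True p by (intro nn_integral_cong) (auto simp: D_def space_pair_measure indicator_def)
        also have "\<dots> = emeasure (sample_measure n M p0)
          {X \<in> space (sample_measure n M p0). lik_ratio n p X < ennreal t}"
          by (rule nn_integral_indicator[OF Ds])
        finally show ?thesis using le True by simp
      qed simp
    qed
    also have "\<dots> = ennreal \<tau> * emeasure Q B" by (rule nn_integral_cmult_indicator[OF B])
    also have "\<dots> = ennreal (\<tau> * w)" using \<tau> by (simp add: Q.emeasure_eq_measure w_def ennreal_mult)
    finally show ?thesis .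
  qed
  \<comment> \<open>If the bad densities carried less than \<open>w / 2\<close>, the others would
    carry more than \<open>w / 2\<close> with ratio at least \<open>t\<close>, which pushes the
    evidence above \<open>t * w / 2\<close>.\<close>
  have sub: "{X \<in> space (sample_measure n M p0). (\<integral>\<^sup>+p. lik_ratio n p X \<partial>Q) < ennreal (t * w / 2)}
    \<subseteq> {X \<in> space (sample_measure n M p0). 1 \<le> ennreal (2 / w) * u X}"
  proof safe
    fix X assume X: "X \<in> space (sample_measure n M p0)"
      and lt: "(\<integral>\<^sup>+p. lik_ratio n p X \<partial>Q) < ennreal (t * w / 2)"
    note [measurable] = lik_ratio_section_measurable[OF X]
    have DX [measurable]: "Pair X -` D \<inter> B \<in> sets Q" using sets_Pair1[OF D, of X] by auto
    have "ennreal (t * w) = (\<integral>\<^sup>+p. ennreal t * indicator B p \<partial>Q)"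
      using t by (subst nn_integral_cmult_indicator[OF B]) (simp add: Q.emeasure_eq_measure w_def ennreal_mult)
    also have "\<dots> \<le> (\<integral>\<^sup>+p. lik_ratio n p X + ennreal t * indicator (Pair X -` D \<inter> B) p \<partial>Q)"
    proof (rule nn_integral_mono)
      fix p assume p: "p \<in> space Q"
      show "ennreal t * indicator B p \<le> lik_ratio n p X + ennreal t * indicator (Pair X -` D \<inter> B) p"
        using p X by (auto simp: indicator_def D_def space_pair_measure not_less intro: order.trans)
    qed
    also have "\<dots> = (\<integral>\<^sup>+p. lik_ratio n p X \<partial>Q) + ennreal t * emeasure Q (Pair X -` D \<inter> B)"
      using DX by (subst nn_integral_add) (auto simp: nn_integral_cmult)
    also have "emeasure Q (Pair X -` D \<inter> B) = u X"
    proof -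
      have "u X = (\<integral>\<^sup>+p. indicator (Pair X -` D \<inter> B) p \<partial>Q)"
        unfolding u_def by (intro nn_integral_cong) (simp add: indicator_inter_arith indicator_vimage)
      then show ?thesis using nn_integral_indicator[OF DX] by simp
    qed
    finally have le: "ennreal (t * w) \<le> (\<integral>\<^sup>+p. lik_ratio n p X \<partial>Q) + ennreal t * u X" .
    show "1 \<le> ennreal (2 / w) * u X"
    proof (cases "u X")
      case (real v)
      obtain l where l: "(\<integral>\<^sup>+p. lik_ratio n p X \<partial>Q) = ennreal l" "0 \<le> l"
        using lt by (cases "\<integral>\<^sup>+p. lik_ratio n p X \<partial>Q") auto
      have "l < t * w / 2" using lt l t w by (simp add: ennreal_less_iff)
      moreover have "t * w \<le> l + t * v"
        using le l real t by (simp add: ennreal_mult'[symmetric] ennreal_plus[symmetric] del: ennreal_plus)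
      ultimately have "t * (w / 2) < t * v" by simp
      then have "w / 2 < v" using t by simp
      then have "1 \<le> 2 / w * v" using w by (simp add: field_simps)
      then show ?thesis using real w by (simp add: ennreal_mult'[symmetric] flip: ennreal_1)
    next
      case top
      then show ?thesis using w by (simp add: ennreal_mult_top)
    qed
  qed
  have "emeasure (sample_measure n M p0)
      {X \<in> space (sample_measure n M p0). (\<integral>\<^sup>+p. lik_ratio n p X \<partial>Q) < ennreal (t * w / 2)}
    \<le> emeasure (sample_measure n M p0) {X \<in> space (sample_measure n M p0). 1 \<le> ennreal (2 / w) * u X}"
    by (rule emeasure_mono[OF sub]) measurable
  also have "\<dots> \<le> ennreal (2 / w) * (\<integral>\<^sup>+X. u X * indicator (space (sample_measure n M p0)) X \<partial>sample_measure n M p0)"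
    by (rule nn_integral_Markov_inequality) measurable
  also have "(\<integral>\<^sup>+X. u X * indicator (space (sample_measure n M p0)) X \<partial>sample_measure n M p0) =
      (\<integral>\<^sup>+X. u X \<partial>sample_measure n M p0)"
    by (intro nn_integral_cong) simp
  also have "ennreal (2 / w) * \<dots> \<le> ennreal (2 / w) * ennreal (\<tau> * w)"
    by (rule mult_left_mono[OF Eu]) simp
  also have "\<dots> = ennreal (2 / w * (\<tau> * w))" using w by (subst ennreal_mult') auto
  also have "2 / w * (\<tau> * w) = 2 / (c\<^sup>2 * real n * e\<^sup>2)" using w by (simp add: \<tau>_def)
  finally show ?thesis unfolding t_def w_def B_def .
qed

text \<open>The near part is bounded linearly by its prior mass, the far part through shells. The
  near radius \<open>r\<close> is free above \<open>real k0 * e\<close>: shells start at an integer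
  multiple, while the near mass is controlled at a radius given by other constants. The overlap is
  harmless.\<close>

lemma index_bound:
  assumes e: "0 < e" and k0: "1 \<le> k0" and \<theta>: "0 \<le> \<theta>" and r: "real k0 * e \<le> r"
    and cover: "\<And>k. k0 \<le> k \<Longrightarrow> \<exists>F. finite F \<and> F \<subseteq> space Q \<and> real (card F) \<le> Nc \<and>
      dist_nbhd d p0 (space Q) ((real k + 1) * e) \<subseteq> (\<Union>c\<in>F. {q. d c q < (real k + 1) * e / 6})"
  shows "(\<integral>\<^sup>+X. min 1 (ennreal \<theta> * (\<integral>\<^sup>+p. lik_ratio n p X \<partial>Q)) \<partial>sample_measure n M p0)
    \<le> ennreal (\<theta> * measure Q (dist_nbhd d p0 (space Q) r)) +
      (\<Sum>k. ennreal (Nc * sqrt (\<theta> * measure Q (dist_nbhd d p0 (space Q) ((real (k + k0) + 1) * e))) *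
        exp (- real n * (2 * real (k + k0) - 1)\<^sup>2 * e\<^sup>2 / 18)))"
proof -
  interpret Q: prob_space Q by (rule prior_prob)
  define C where "C r = dist_nbhd d p0 (space Q) r" for r
  have C [measurable]: "C r \<in> sets Q" for r unfolding C_def by (rule nbhd_measurable)
  have C': "space Q - C r \<in> sets Q" for r by measurable
  have "(\<integral>\<^sup>+X. min 1 (ennreal \<theta> * (\<integral>\<^sup>+p. lik_ratio n p X \<partial>Q)) \<partial>sample_measure n M p0) \<le>
    (\<integral>\<^sup>+X. ennreal \<theta> * (\<integral>\<^sup>+p. lik_ratio n p X * indicator (C r) p \<partial>Q) +
      min 1 (ennreal \<theta> * (\<integral>\<^sup>+p. lik_ratio n p X * indicator (space Q - C (real k0 * e)) p \<partial>Q)) \<partial>sample_measure n M p0)"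
  proof (rule nn_integral_mono)
    fix X assume X: "X \<in> space (sample_measure n M p0)"
    note [measurable] = lik_ratio_section_measurable[OF X]
    have "(\<integral>\<^sup>+p. lik_ratio n p X \<partial>Q) \<le>
      (\<integral>\<^sup>+p. lik_ratio n p X * indicator (C r) p + lik_ratio n p X * indicator (space Q - C (real k0 * e)) p \<partial>Q)"
      using r by (intro nn_integral_mono) (auto simp: indicator_def C_def dist_nbhd_def)
    also have "\<dots> = (\<integral>\<^sup>+p. lik_ratio n p X * indicator (C r) p \<partial>Q) +
      (\<integral>\<^sup>+p. lik_ratio n p X * indicator (space Q - C (real k0 * e)) p \<partial>Q)"
      by (rule nn_integral_add) measurable
    finally have "ennreal \<theta> * (\<integral>\<^sup>+p. lik_ratio n p X \<partial>Q) \<le> ennreal \<theta> * \<dots>" by (rule mult_left_mono) simp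
    then have le: "ennreal \<theta> * (\<integral>\<^sup>+p. lik_ratio n p X \<partial>Q) \<le>
      ennreal \<theta> * (\<integral>\<^sup>+p. lik_ratio n p X * indicator (C r) p \<partial>Q) +
      ennreal \<theta> * (\<integral>\<^sup>+p. lik_ratio n p X * indicator (space Q - C (real k0 * e)) p \<partial>Q)"
      by (simp only: distrib_left)
    \<comment> \<open>Only the far summand keeps its truncation, since the square-root bound acts on
      truncated quantities.\<close>
    have min_add: "min 1 z \<le> x + min 1 y" if "z \<le> x + y" for x y z :: ennreal
      using that by (cases "y \<le> 1") (auto simp: min_def intro: order.trans add_increasing)
    show "min 1 (ennreal \<theta> * (\<integral>\<^sup>+p. lik_ratio n p X \<partial>Q)) \<le>
      ennreal \<theta> * (\<integral>\<^sup>+p. lik_ratio n p X * indicator (C r) p \<partial>Q) +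
      min 1 (ennreal \<theta> * (\<integral>\<^sup>+p. lik_ratio n p X * indicator (space Q - C (real k0 * e)) p \<partial>Q))"
      by (rule min_add[OF le])
  qed
  also have "\<dots> = (\<integral>\<^sup>+X. ennreal \<theta> * (\<integral>\<^sup>+p. lik_ratio n p X * indicator (C r) p \<partial>Q) \<partial>sample_measure n M p0) +
     (\<integral>\<^sup>+X. min 1 (ennreal \<theta> * (\<integral>\<^sup>+p. lik_ratio n p X * indicator (space Q - C (real k0 * e)) p \<partial>Q)) \<partial>sample_measure n M p0)"
    using lik_ratio_integral_measurable[OF C, of n r] lik_ratio_integral_measurable[OF C', of n "real k0 * e"]
    by (intro nn_integral_add borel_measurable_min borel_measurable_times_ennreal) auto
  also have "\<dots> \<le> ennreal (\<theta> * measure Q (C r)) +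
      (\<Sum>k. ennreal (Nc * sqrt (\<theta> * measure Q (C ((real (k + k0) + 1) * e))) *
        exp (- real n * (2 * real (k + k0) - 1)\<^sup>2 * e\<^sup>2 / 18)))"
  proof (rule add_mono)
    have "(\<integral>\<^sup>+X. ennreal \<theta> * (\<integral>\<^sup>+p. lik_ratio n p X * indicator (C r) p \<partial>Q) \<partial>sample_measure n M p0) =
      ennreal \<theta> * (\<integral>\<^sup>+X. (\<integral>\<^sup>+p. lik_ratio n p X * indicator (C r) p \<partial>Q) \<partial>sample_measure n M p0)"
      by (rule nn_integral_cmult[OF lik_ratio_integral_measurable[OF C]])
    also have "\<dots> \<le> ennreal \<theta> * emeasure Q (C r)"
      by (rule mult_left_mono[OF lik_ratio_mass_le[OF C]]) simp
    also have "\<dots> = ennreal (\<theta> * measure Q (C r))" using \<theta> by (simp add: Q.emeasure_eq_measure ennreal_mult)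
    finally show "(\<integral>\<^sup>+X. ennreal \<theta> * (\<integral>\<^sup>+p. lik_ratio n p X * indicator (C r) p \<partial>Q) \<partial>sample_measure n M p0) \<le> \<dots>" .
    show "(\<integral>\<^sup>+X. min 1 (ennreal \<theta> *
        (\<integral>\<^sup>+p. lik_ratio n p X * indicator (space Q - C (real k0 * e)) p \<partial>Q)) \<partial>sample_measure n M p0)
      \<le> (\<Sum>k. ennreal (Nc * sqrt (\<theta> * measure Q (C ((real (k + k0) + 1) * e))) *
        exp (- real n * (2 * real (k + k0) - 1)\<^sup>2 * e\<^sup>2 / 18)))"
      unfolding C_def by (rule far_mass_bound[OF e k0 \<theta> cover])
  qed
  finally show ?thesis unfolding C_def .
qed

end

section \<open>From likelihood ratios to the posterior of the index\<close>

context density_model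
begin

text \<open>The product of true densities is common to all models and therefore cancels in the
  posterior.\<close>

lemma marginal_likelihood_eq:
  assumes Q: "prior M p0 d Q" and X: "X \<in> space (sample_measure n M p0)"
    and pos: "\<forall>i<n. X i \<in> space M \<and> 0 < p0 (X i)"
  shows "marginal_likelihood n Q X = (\<Prod>i<n. ennreal (p0 (X i))) * (\<integral>\<^sup>+p. lik_ratio n p X \<partial>Q)"
proof -
  interpret prior M p0 d Q by fact
  have "marginal_likelihood n Q X = (\<integral>\<^sup>+p. (\<Prod>i<n. ennreal (p0 (X i))) * lik_ratio n p X \<partial>Q)"
    unfolding marginal_likelihood_def lik_ratio_def prod.distrib[symmetric]
  proof (intro nn_integral_cong prod.cong refl)
    fix p i assume "p \<in> space Q" "i \<in> {..<n}"
    then have "0 < p0 (X i)" "0 \<le> p (X i)" using pos model_nonneg by auto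
    then show "ennreal (p (X i)) = ennreal (p0 (X i)) * ennreal (p (X i) / p0 (X i))"
      by (simp add: ennreal_mult'[symmetric])
  qed
  also have "\<dots> = (\<Prod>i<n. ennreal (p0 (X i))) * (\<integral>\<^sup>+p. lik_ratio n p X \<partial>Q)"
    by (rule nn_integral_cmult[OF lik_ratio_section_measurable[OF X]])
  finally show ?thesis .
qed

text \<open>Each summand of the numerator is itself a summand of the denominator, hence the bound 1;
  keeping only the summand of \<open>b\<close> in the denominator gives the other bound. Truncation
  is thus obtained model by model.\<close>

lemma posterior_index_le:
  assumes priors: "\<And>\<alpha>. \<alpha> \<in> A \<Longrightarrow> prior M p0 d (Q \<alpha>)"
    and b: "b \<in> A" "0 < pmf lam b" and S: "S \<subseteq> A" and t: "0 < t"
    and X: "X \<in> space (sample_measure n M p0)"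
    and pos: "\<forall>i<n. X i \<in> space M \<and> 0 < p0 (X i)"
    and ge: "ennreal t \<le> (\<integral>\<^sup>+p. lik_ratio n p X \<partial>Q b)"
  shows "posterior_index n A lam Q S X \<le>
    (\<integral>\<^sup>+\<alpha>. min 1 (ennreal (pmf lam \<alpha> / (pmf lam b * t)) * (\<integral>\<^sup>+p. lik_ratio n p X \<partial>Q \<alpha>)) \<partial>count_space S)"
proof -
  define c where "c = (\<Prod>i<n. p0 (X i))"
  have c: "0 < c" unfolding c_def using pos by (intro prod_pos) auto
  have c_eq: "(\<Prod>i<n. ennreal (p0 (X i))) = ennreal c"
    unfolding c_def using pos by (intro prod_ennreal) (auto intro: less_imp_le)
  define l where "l \<alpha> = (\<integral>\<^sup>+p. lik_ratio n p X \<partial>Q \<alpha>)" for \<alpha>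
  define f where "f \<alpha> = ennreal (pmf lam \<alpha>) * marginal_likelihood n (Q \<alpha>) X" for \<alpha>
  have f_eq: "f \<alpha> = ennreal (c * pmf lam \<alpha>) * l \<alpha>" if "\<alpha> \<in> A" for \<alpha>
    unfolding f_def l_def marginal_likelihood_eq[OF priors[OF that] X pos] c_eq
    using c by (simp add: ennreal_mult mult_ac)
  define D where "D = (\<integral>\<^sup>+\<alpha>. f \<alpha> \<partial>count_space A)"
  have f_le_D: "f \<alpha> \<le> D" if "\<alpha> \<in> A" for \<alpha>
    unfolding D_def using nn_integral_ge_point[OF that] .
  have "ennreal (c * (pmf lam b * t)) = ennreal (c * pmf lam b) * ennreal t"
    using c b t by (simp add: ennreal_mult'[symmetric] mult.assoc)
  also have "\<dots> \<le> f b" unfolding f_eq[OF b(1)] using ge by (intro mult_left_mono) (simp_all add: l_def)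
  also have "\<dots> \<le> D" by (rule f_le_D[OF b(1)])
  finally have D_ge: "ennreal (c * (pmf lam b * t)) \<le> D" .
  have D0: "0 < c * (pmf lam b * t)" using c b t by simp
  have "posterior_index n A lam Q S X = (\<integral>\<^sup>+\<alpha>. f \<alpha> / D \<partial>count_space S)"
    unfolding posterior_index_def f_def[symmetric] D_def[symmetric]
    by (subst nn_integral_divide) auto
  also have "\<dots> \<le> (\<integral>\<^sup>+\<alpha>. min 1 (ennreal (pmf lam \<alpha> / (pmf lam b * t)) * l \<alpha>) \<partial>count_space S)"
  proof (rule nn_integral_mono)
    fix \<alpha> assume "\<alpha> \<in> space (count_space S)"
    then have a: "\<alpha> \<in> A" using S by auto
    have Dpos: "0 < D" using D_ge D0 by (metis ennreal_less_zero_iff order_less_le_trans)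
    have inv: "inverse D \<le> inverse (ennreal (c * (pmf lam b * t)))"
    proof (cases D)
      case (real r)
      then have le: "c * (pmf lam b * t) \<le> r" using D_ge by simp
      then have "inverse r \<le> inverse (c * (pmf lam b * t))" using D0 by (rule le_imp_inverse_le)
      moreover have "inverse D = ennreal (inverse r)"
        "inverse (ennreal (c * (pmf lam b * t))) = ennreal (inverse (c * (pmf lam b * t)))"
        using real le D0 inverse_ennreal[of r] inverse_ennreal[OF D0] by (simp_all only:)
      ultimately show ?thesis by (simp only: ennreal_leI)
    qed simp
    \<comment> \<open>An infinite denominator makes the quotient 0.\<close>
    have "f \<alpha> / D \<le> 1"
    proof (cases "D = \<top>")
      case False
      have "f \<alpha> / D \<le> D / D" by (rule divide_right_mono_ennreal[OF f_le_D[OF a]])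
      also have "\<dots> = 1" using Dpos False by (intro ennreal_divide_self) (auto simp: less_top)
      finally show ?thesis .
    qed simp
    moreover have "f \<alpha> / D \<le> ennreal (pmf lam \<alpha> / (pmf lam b * t)) * l \<alpha>"
    proof -
      have "f \<alpha> / D \<le> f \<alpha> / ennreal (c * (pmf lam b * t))"
        unfolding divide_ennreal_def by (intro mult_left_mono inv) auto
      also have "\<dots> = ennreal (c * pmf lam \<alpha>) * l \<alpha> * ennreal (inverse (c * (pmf lam b * t)))"
        unfolding f_eq[OF a] divide_ennreal_def using D0 by (simp add: inverse_ennreal)
      also have "\<dots> = ennreal (c * pmf lam \<alpha> * inverse (c * (pmf lam b * t))) * l \<alpha>"
        using c D0 by (simp add: ennreal_mult'[symmetric] mult_ac)
      also have "c * pmf lam \<alpha> * inverse (c * (pmf lam b * t)) = pmf lam \<alpha> / (pmf lam b * t)"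
        using c by (simp add: field_simps)
      finally show ?thesis .
    qed
    ultimately show "f \<alpha> / D \<le> min 1 (ennreal (pmf lam \<alpha> / (pmf lam b * t)) * l \<alpha>)" by simp
  qed
  finally show ?thesis unfolding l_def .
qed

lemma posterior_index_le_1:
  assumes S: "S \<subseteq> A"
  shows "posterior_index n A lam Q S X \<le> 1"
proof -
  let ?f = "\<lambda>\<alpha>. ennreal (pmf lam \<alpha>) * marginal_likelihood n (Q \<alpha>) X"
  let ?N = "\<integral>\<^sup>+\<alpha>. ?f \<alpha> \<partial>count_space S" and ?D = "\<integral>\<^sup>+\<alpha>. ?f \<alpha> \<partial>count_space A"
  have le: "?N \<le> ?D" by (rule nn_integral_count_space_mono_set[OF S])
  have "?N / ?D \<le> 1"
  proof (cases "?D = 0 \<or> ?D = \<top>")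
    case True
    then show ?thesis using le by auto
  next
    case False
    have "?N / ?D \<le> ?D / ?D" by (rule divide_right_mono_ennreal[OF le])
    also have "\<dots> = 1" using False by (intro ennreal_divide_self) (auto simp: less_top)
    finally show ?thesis .
  qed
  then show ?thesis by (simp add: posterior_index_def)
qed

text \<open>Where the evidence of model \<open>b\<close> is small the posterior is bounded by 1,
  elsewhere by truncated ratios. Countability of \<open>S\<close> lets sum and expectation be
  interchanged.\<close>

lemma expectation_posterior_index_le:
  assumes A: "countable A" and priors: "\<And>\<alpha>. \<alpha> \<in> A \<Longrightarrow> prior M p0 d (Q \<alpha>)"
    and b: "b \<in> A" "0 < pmf lam b" and S: "S \<subseteq> A" and t: "0 < t"
  shows "(\<integral>\<^sup>+X. posterior_index n A lam Q S X \<partial>sample_measure n M p0) \<le>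
    emeasure (sample_measure n M p0)
      {X \<in> space (sample_measure n M p0). (\<integral>\<^sup>+p. lik_ratio n p X \<partial>Q b) < ennreal t} +
    (\<integral>\<^sup>+\<alpha>. (\<integral>\<^sup>+X. min 1 (ennreal (pmf lam \<alpha> / (pmf lam b * t)) * (\<integral>\<^sup>+p. lik_ratio n p X \<partial>Q \<alpha>))
      \<partial>sample_measure n M p0) \<partial>count_space S)"
proof -
  interpret P: prob_space "sample_measure n M p0" by (rule prob_space_sample)
  have cS: "countable S" using countable_subset[OF S A] .
  interpret CS: sigma_finite_measure "count_space S" by (rule sigma_finite_measure_count_space_countable[OF cS])
  have lm: "(\<lambda>X. \<integral>\<^sup>+p. lik_ratio n p X \<partial>Q \<alpha>) \<in> borel_measurable (sample_measure n M p0)"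
    if "\<alpha> \<in> A" for \<alpha>
  proof -
    interpret prior M p0 d "Q \<alpha>" by (rule priors[OF that])
    interpret Q: prob_space "Q \<alpha>" by (rule prior_prob)
    show ?thesis by (rule Q.borel_measurable_nn_integral[OF lik_ratio_measurable])
  qed
  define g where "g X \<alpha> = min 1 (ennreal (pmf lam \<alpha> / (pmf lam b * t)) * (\<integral>\<^sup>+p. lik_ratio n p X \<partial>Q \<alpha>))" for X \<alpha>
  have gm: "(\<lambda>X. g X \<alpha>) \<in> borel_measurable (sample_measure n M p0)" if "\<alpha> \<in> A" for \<alpha>
    unfolding g_def using lm[OF that] by (intro borel_measurable_min borel_measurable_times_ennreal) auto
  have gm2: "case_prod g \<in> borel_measurable (sample_measure n M p0 \<Otimes>\<^sub>M count_space S)"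
  proof -
    have "(\<lambda>(\<alpha>, X). g X \<alpha>) \<in> borel_measurable (count_space S \<Otimes>\<^sub>M sample_measure n M p0)"
      using S gm by (intro measurable_pair_measure_countable1[OF cS]) auto
    from measurable_pair_swap[OF this] show ?thesis by simp
  qed
  define Bad where "Bad = {X \<in> space (sample_measure n M p0). (\<integral>\<^sup>+p. lik_ratio n p X \<partial>Q b) < ennreal t}"
  have Bad: "Bad \<in> sets (sample_measure n M p0)"
    unfolding Bad_def using lm[OF b(1)] by measurable
  have "(\<integral>\<^sup>+X. posterior_index n A lam Q S X \<partial>sample_measure n M p0) \<le>
    (\<integral>\<^sup>+X. indicator Bad X + (\<integral>\<^sup>+\<alpha>. g X \<alpha> \<partial>count_space S) \<partial>sample_measure n M p0)"
  proof (rule nn_integral_mono_AE, use AE_sample_pos[of n] in eventually_elim)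
    case (elim X)
    show ?case
    proof (cases "X \<in> Bad")
      case True
      then show ?thesis by (intro order.trans[OF posterior_index_le_1[OF S]]) simp
    next
      case False
      then have "ennreal t \<le> (\<integral>\<^sup>+p. lik_ratio n p X \<partial>Q b)" using elim by (auto simp: Bad_def)
      then have "posterior_index n A lam Q S X \<le> (\<integral>\<^sup>+\<alpha>. g X \<alpha> \<partial>count_space S)"
        unfolding g_def using elim by (intro posterior_index_le[OF priors b S t]) auto
      then show ?thesis by (simp add: False)
    qed
  qed
  also have "\<dots> = (\<integral>\<^sup>+X. indicator Bad X \<partial>sample_measure n M p0) +
      (\<integral>\<^sup>+X. (\<integral>\<^sup>+\<alpha>. g X \<alpha> \<partial>count_space S) \<partial>sample_measure n M p0)"
    using Bad CS.borel_measurable_nn_integral[OF gm2] by (intro nn_integral_add) auto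
  also have "(\<integral>\<^sup>+X. (\<integral>\<^sup>+\<alpha>. g X \<alpha> \<partial>count_space S) \<partial>sample_measure n M p0) =
      (\<integral>\<^sup>+\<alpha>. (\<integral>\<^sup>+X. g X \<alpha> \<partial>sample_measure n M p0) \<partial>count_space S)"
    using S gm by (intro nn_integral_count_space_nn_integral[OF cS]) auto
  also have "(\<integral>\<^sup>+X. indicator Bad X \<partial>sample_measure n M p0) = emeasure (sample_measure n M p0) Bad"
    by (rule nn_integral_indicator[OF Bad])
  finally show ?thesis unfolding Bad_def g_def .
qed

end

section \<open>Model selection\<close>

lemma expected_posterior_empty: "expected_posterior M p0 A lam Q n {} = 0"
  by (simp add: expected_posterior_def posterior_index_def nn_integral_empty)

lemma prior_ratio_nonneg: "0 \<le> prior_ratio M p0 d lam Q e b \<alpha> r"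
  by (simp add: prior_ratio_def)

locale model_selection = density_model M p0 d
  for M :: "'x measure" and p0 :: "'x \<Rightarrow> real" and d +
  fixes A :: "nat \<Rightarrow> 'a set"
    and lam :: "nat \<Rightarrow> 'a pmf"
    and Q :: "nat \<Rightarrow> 'a \<Rightarrow> ('x \<Rightarrow> real) measure"
    and eps :: "nat \<Rightarrow> 'a \<Rightarrow> real"
    and b :: "nat \<Rightarrow> 'a"
  assumes A_countable: "\<And>n. n \<ge> 1 \<Longrightarrow> countable (A n)"
    and priors: "\<And>n \<alpha>. n \<ge> 1 \<Longrightarrow> \<alpha> \<in> A n \<Longrightarrow> prior M p0 d (Q n \<alpha>)"
    and eps_pos: "\<And>n \<alpha>. n \<ge> 1 \<Longrightarrow> \<alpha> \<in> A n \<Longrightarrow> 0 < eps n \<alpha>"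
    and b_in_A: "\<And>n. n \<ge> 1 \<Longrightarrow> b n \<in> A n"
    and b_weight_pos: "\<And>n. n \<ge> 1 \<Longrightarrow> 0 < pmf (lam n) (b n)"
    and b_mass_pos: "\<And>n. n \<ge> 1 \<Longrightarrow>
          0 < measure (Q n (b n)) (KL_nbhd M p0 (space (Q n (b n))) (eps n (b n)))"
begin

abbreviation "\<tau> n \<equiv> real n * (eps n (b n))\<^sup>2"

abbreviation "ratio n \<alpha> r \<equiv> prior_ratio M p0 d (lam n) (Q n) (eps n) (b n) \<alpha> r"

abbreviation "lower H n \<equiv> idx_below H (eps n) (b n) (A n)"

abbreviation "upper H n \<equiv> idx_above H (eps n) (b n) (A n)"

lemma ratio_infsum:
  assumes n: "n \<ge> 1" and S: "S \<subseteq> A n"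
  shows "(\<integral>\<^sup>+\<alpha>. ennreal (ratio n \<alpha> (r \<alpha>)) \<partial>count_space S) = ennreal (\<Sum>\<^sub>\<infinity>\<alpha>\<in>S. ratio n \<alpha> (r \<alpha>))"
proof (rule nn_integral_count_space_eq_infsum[OF prior_ratio_nonneg])
  let ?w = "measure (Q n (b n)) (KL_nbhd M p0 (space (Q n (b n))) (eps n (b n)))"
  fix \<alpha> assume "\<alpha> \<in> S"
  then interpret prior M p0 d "Q n \<alpha>" using priors n S by auto
  interpret Qa: prob_space "Q n \<alpha>" by (rule prior_prob)
  have "measure (Q n \<alpha>) (dist_nbhd d p0 (space (Q n \<alpha>)) (r \<alpha>)) \<le> 1" by simp
  then have "ratio n \<alpha> (r \<alpha>) \<le> pmf (lam n) \<alpha> / pmf (lam n) (b n) * (1 / ?w)"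
    unfolding prior_ratio_def using b_mass_pos[OF n] b_weight_pos[OF n]
    by (intro mult_left_mono divide_right_mono) auto
  then show "ratio n \<alpha> (r \<alpha>) \<le> 1 / (pmf (lam n) (b n) * ?w) * pmf (lam n) \<alpha>" by simp
qed

text \<open>The entropy condition is applied at \<open>r = (k + 1) * e / 2\<close>: then
  \<open>2 * r\<close> is the outer radius of shell \<open>k\<close> and \<open>r / 3\<close> the
  covering radius. The condition on \<open>k0\<close> puts \<open>r\<close> in the range where the
  supremum is taken.\<close>

lemma entropy_cover:
  assumes ent: "entropy_cond p0 d A Q eps E" and n: "n \<ge> 1" and a: "\<alpha> \<in> A n"
    and e: "0 < e" and k0: "eps n \<alpha> \<le> (real k0 + 1) / 2 * e" and k: "k0 \<le> k"
    and F: "E \<alpha> * real n * (eps n \<alpha>)\<^sup>2 \<le> x"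
  shows "\<exists>F. finite F \<and> F \<subseteq> space (Q n \<alpha>) \<and> real (card F) \<le> exp x \<and>
      dist_nbhd d p0 (space (Q n \<alpha>)) ((real k + 1) * e) \<subseteq> (\<Union>c\<in>F. {q. d c q < (real k + 1) * e / 6})"
proof -
  define r where "r = (real k + 1) / 2 * e"
  have "(real k0 + 1) / 2 * e \<le> r" unfolding r_def using k e by (intro mult_right_mono) auto
  then have "r \<in> {eps n \<alpha>..}" using k0 by simp
  then have "metric_entropy (r / 3) (dist_nbhd d p0 (space (Q n \<alpha>)) (2 * r)) d \<le>
      (SUP r\<in>{eps n \<alpha>..}. metric_entropy (r / 3) (dist_nbhd d p0 (space (Q n \<alpha>)) (2 * r)) d)"
    by (rule SUP_upper)
  also have "\<dots> \<le> ereal (E \<alpha> * real n * (eps n \<alpha>)\<^sup>2)"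
    using ent n a unfolding entropy_cond_def by blast
  also have "\<dots> \<le> ereal x" using F by simp
  finally obtain F where F: "finite F" "F \<subseteq> dist_nbhd d p0 (space (Q n \<alpha>)) (2 * r)" "real (card F) \<le> exp x"
    "dist_nbhd d p0 (space (Q n \<alpha>)) (2 * r) \<subseteq> (\<Union>c\<in>F. {q. d c q < r / 3})"
    by (rule metric_entropy_cover)
  have r': "2 * r = (real k + 1) * e" "r / 3 = (real k + 1) * e / 6" by (simp_all add: r_def)
  have "F \<subseteq> space (Q n \<alpha>)" using F(2) by (auto simp: dist_nbhd_def)
  then show ?thesis using F unfolding r' by (intro exI[of _ F] conjI)
qed

text \<open>
  \<open>\<omega>\<close> measures by how much the separation exponent beats the entropy, the prior mass and the
  evidence exponents on the first shell; the term \<open>k\<close> makes the sum over the shells geometric.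
\<close>

lemma expected_posterior_bound:
  fixes e r :: "'a \<Rightarrow> real"
  assumes n: "n \<ge> 1" and S: "S \<subseteq> A n" and c: "0 < c" and k0: "1 \<le> k0"
    and ent: "entropy_cond p0 d A Q eps E"
    and e: "\<And>\<alpha>. \<alpha> \<in> S \<Longrightarrow> 0 < e \<alpha>"
    and r: "\<And>\<alpha>. \<alpha> \<in> S \<Longrightarrow> real k0 * e \<alpha> \<le> r \<alpha>"
    and eps_le: "\<And>\<alpha>. \<alpha> \<in> S \<Longrightarrow> eps n \<alpha> \<le> (real k0 + 1) / 2 * e \<alpha>"
    and F: "\<And>\<alpha>. \<alpha> \<in> S \<Longrightarrow> E \<alpha> * real n * (eps n \<alpha>)\<^sup>2 \<le> F * (real n * (e \<alpha>)\<^sup>2)"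
    and prior_le: "\<And>\<alpha> k. \<alpha> \<in> S \<Longrightarrow> k0 \<le> k \<Longrightarrow>
      ratio n \<alpha> ((real k + 1) * e \<alpha>) \<le> \<mu> \<alpha> * exp (L * (real k + 1)\<^sup>2 * real n * (e \<alpha>)\<^sup>2)"
    and rate: "\<And>\<alpha> k. \<alpha> \<in> S \<Longrightarrow> (1 + c) / 2 * \<tau> n + real n * (e \<alpha>)\<^sup>2 *
        (F + L * (real (k + k0) + 1)\<^sup>2 / 2 - (2 * real (k + k0) - 1)\<^sup>2 / 18) \<le> - \<omega> - real k"
  shows "expected_posterior M p0 A lam Q n S \<le>
      ennreal (2 / (c\<^sup>2 * \<tau> n)) +
      ennreal (2 * exp ((1 + c) * \<tau> n) * (\<Sum>\<^sub>\<infinity>\<alpha>\<in>S. ratio n \<alpha> (r \<alpha>))) +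
      (\<integral>\<^sup>+\<alpha>. ennreal (sqrt (\<mu> \<alpha>)) \<partial>count_space S) * ennreal (sqrt 2 * exp (- \<omega>) * (\<Sum>k. exp (- real k)))"
proof -
  define wK where "wK = measure (Q n (b n)) (KL_nbhd M p0 (space (Q n (b n))) (eps n (b n)))"
  define lb where "lb = pmf (lam n) (b n)"
  have w: "0 < wK" unfolding wK_def by (rule b_mass_pos[OF n])
  have lb: "0 < lb" unfolding lb_def by (rule b_weight_pos[OF n])
  \<comment> \<open>The level of \<open>evidence_lower_bound\<close>; its factor
    \<open>1 / 2\<close> reappears as the factor 2 in \<open>\<theta>_ratio\<close>.\<close>
  define t where "t = exp (- (1 + c) * \<tau> n) * wK / 2"
  have t: "0 < t" using w by (simp add: t_def)
  define \<theta> where "\<theta> \<alpha> = pmf (lam n) \<alpha> / (lb * t)" for \<alpha>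
  have \<theta>: "0 \<le> \<theta> \<alpha>" for \<alpha> using lb t by (simp add: \<theta>_def)
  have \<theta>_ratio: "\<theta> \<alpha> * measure (Q n \<alpha>) (dist_nbhd d p0 (space (Q n \<alpha>)) s) =
      2 * exp ((1 + c) * \<tau> n) * ratio n \<alpha> s" for \<alpha> s
  proof -
    have "x / (lb * (exp (- y) * wK / 2)) * m = 2 * exp y * (x / lb * (m / wK))" for x y m
      using w lb by (simp add: exp_minus field_simps)
    then show ?thesis
      unfolding \<theta>_def t_def prior_ratio_def wK_def[symmetric] lb_def[symmetric] mult_minus_left .
  qed
  define G where "G = (\<Sum>k. exp (- real k))"
  note sG = summable_exp_neg
  have G0: "0 \<le> G" unfolding G_def by (rule suminf_exp_neg_nonneg)
  have per: "(\<integral>\<^sup>+X. min 1 (ennreal (pmf (lam n) \<alpha> / (pmf (lam n) (b n) * t)) * (\<integral>\<^sup>+p. lik_ratio n p X \<partial>Q n \<alpha>))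
      \<partial>sample_measure n M p0) \<le>
      ennreal (2 * exp ((1 + c) * \<tau> n)) * ennreal (ratio n \<alpha> (r \<alpha>)) +
      ennreal (sqrt (\<mu> \<alpha>)) * ennreal (sqrt 2 * exp (- \<omega>) * G)"
    if a: "\<alpha> \<in> S" for \<alpha>
  proof -
    have aA: "\<alpha> \<in> A n" using a S by auto
    interpret prior M p0 d "Q n \<alpha>" by (rule priors[OF n aA])
    let ?ne = "real n * (e \<alpha>)\<^sup>2"
    have "(\<integral>\<^sup>+X. min 1 (ennreal (\<theta> \<alpha>) * (\<integral>\<^sup>+p. lik_ratio n p X \<partial>Q n \<alpha>)) \<partial>sample_measure n M p0)
      \<le> ennreal (\<theta> \<alpha> * measure (Q n \<alpha>) (dist_nbhd d p0 (space (Q n \<alpha>)) (r \<alpha>))) +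
       (\<Sum>k. ennreal (exp (F * ?ne) *
          sqrt (\<theta> \<alpha> * measure (Q n \<alpha>) (dist_nbhd d p0 (space (Q n \<alpha>)) ((real (k + k0) + 1) * e \<alpha>))) *
          exp (- real n * (2 * real (k + k0) - 1)\<^sup>2 * (e \<alpha>)\<^sup>2 / 18)))"
      by (rule index_bound[OF e[OF a] k0 \<theta> r[OF a] entropy_cover[OF ent n aA e[OF a] eps_le[OF a] _ F[OF a]]])
    also have "\<dots> \<le> ennreal (2 * exp ((1 + c) * \<tau> n)) * ennreal (ratio n \<alpha> (r \<alpha>)) +
        (\<Sum>k. ennreal (sqrt (\<mu> \<alpha>) * (sqrt 2 * exp (- \<omega>)) * exp (- real k)))"
    proof (intro add_mono suminf_le ennreal_leI)
      show "ennreal (\<theta> \<alpha> * measure (Q n \<alpha>) (dist_nbhd d p0 (space (Q n \<alpha>)) (r \<alpha>))) \<le>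
          ennreal (2 * exp ((1 + c) * \<tau> n)) * ennreal (ratio n \<alpha> (r \<alpha>))"
        unfolding \<theta>_ratio by (simp add: ennreal_mult' prior_ratio_nonneg)
      fix k
      let ?j = "real (k + k0)"
      let ?x = "ratio n \<alpha> ((?j + 1) * e \<alpha>)"
      have x: "?x \<le> \<mu> \<alpha> * exp (L * (?j + 1)\<^sup>2 * real n * (e \<alpha>)\<^sup>2)"
        using prior_le[OF a, of "k + k0"] by simp
      have se: "sqrt (exp y) = exp (y / 2)" for y :: real
        by (rule real_sqrt_unique) (simp_all add: power2_eq_square exp_add[symmetric])
      have "sqrt (2 * exp ((1 + c) * \<tau> n) * ?x) \<le>
          sqrt (2 * exp ((1 + c) * \<tau> n) * (\<mu> \<alpha> * exp (L * (?j + 1)\<^sup>2 * real n * (e \<alpha>)\<^sup>2)))"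
        using x by (intro real_sqrt_le_mono mult_left_mono) auto
      also have "\<dots> = sqrt (\<mu> \<alpha>) * sqrt 2 *
          (exp ((1 + c) * \<tau> n / 2) * exp (L * (?j + 1)\<^sup>2 * real n * (e \<alpha>)\<^sup>2 / 2))"
        by (simp add: real_sqrt_mult se)
      finally have sq: "sqrt (2 * exp ((1 + c) * \<tau> n) * ?x) \<le> sqrt (\<mu> \<alpha>) * sqrt 2 *
          (exp ((1 + c) * \<tau> n / 2) * exp (L * (?j + 1)\<^sup>2 * real n * (e \<alpha>)\<^sup>2 / 2))" .
      have "0 \<le> \<mu> \<alpha> * exp (L * (?j + 1)\<^sup>2 * real n * (e \<alpha>)\<^sup>2)"
        using x prior_ratio_nonneg by (rule order.trans[rotated])
      \<comment> \<open>The sign of \<open>\<mu> \<alpha>\<close> comes from its dominating a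
        nonnegative prior ratio.\<close>
      then have \<mu>0: "0 \<le> \<mu> \<alpha>" by (simp add: zero_le_mult_iff)
      have "exp (F * ?ne) * sqrt (2 * exp ((1 + c) * \<tau> n) * ?x) *
          exp (- real n * (2 * ?j - 1)\<^sup>2 * (e \<alpha>)\<^sup>2 / 18) \<le>
        exp (F * ?ne) * (sqrt (\<mu> \<alpha>) * sqrt 2 *
          (exp ((1 + c) * \<tau> n / 2) * exp (L * (?j + 1)\<^sup>2 * real n * (e \<alpha>)\<^sup>2 / 2))) *
          exp (- real n * (2 * ?j - 1)\<^sup>2 * (e \<alpha>)\<^sup>2 / 18)"
        by (intro mult_right_mono mult_left_mono sq) auto
      also have "\<dots> = sqrt (\<mu> \<alpha>) * sqrt 2 * exp (F * ?ne + ((1 + c) * \<tau> n / 2 +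
          L * (?j + 1)\<^sup>2 * real n * (e \<alpha>)\<^sup>2 / 2) + - real n * (2 * ?j - 1)\<^sup>2 * (e \<alpha>)\<^sup>2 / 18)"
        by (simp only: exp_add mult_ac)
      also have "F * ?ne + ((1 + c) * \<tau> n / 2 +
          L * (?j + 1)\<^sup>2 * real n * (e \<alpha>)\<^sup>2 / 2) + - real n * (2 * ?j - 1)\<^sup>2 * (e \<alpha>)\<^sup>2 / 18 =
        (1 + c) / 2 * \<tau> n + ?ne * (F + L * (?j + 1)\<^sup>2 / 2 - (2 * ?j - 1)\<^sup>2 / 18)"
        by (simp add: algebra_simps add_divide_distrib)
      also have "sqrt (\<mu> \<alpha>) * sqrt 2 * exp \<dots> \<le> sqrt (\<mu> \<alpha>) * sqrt 2 * exp (- \<omega> - real k)"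
        using rate[OF a, of k] \<mu>0 by (intro mult_left_mono) auto
      also have "\<dots> = sqrt (\<mu> \<alpha>) * (sqrt 2 * exp (- \<omega>)) * exp (- real k)"
        by (simp add: exp_diff exp_minus field_simps)
      finally show "exp (F * ?ne) *
          sqrt (\<theta> \<alpha> * measure (Q n \<alpha>) (dist_nbhd d p0 (space (Q n \<alpha>)) ((?j + 1) * e \<alpha>))) *
          exp (- real n * (2 * ?j - 1)\<^sup>2 * (e \<alpha>)\<^sup>2 / 18) \<le>
          sqrt (\<mu> \<alpha>) * (sqrt 2 * exp (- \<omega>)) * exp (- real k)"
        unfolding \<theta>_ratio .
    qed auto
    also have "(\<Sum>k. ennreal (sqrt (\<mu> \<alpha>) * (sqrt 2 * exp (- \<omega>)) * exp (- real k))) =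
        ennreal (sqrt (\<mu> \<alpha>)) * ennreal (sqrt 2 * exp (- \<omega>) * G)"
    proof -
      have "(\<Sum>k. ennreal (sqrt (\<mu> \<alpha>) * (sqrt 2 * exp (- \<omega>)) * exp (- real k))) =
          (\<Sum>k. ennreal (sqrt (\<mu> \<alpha>)) * ennreal (sqrt 2 * exp (- \<omega>)) * ennreal (exp (- real k)))"
        by (simp add: ennreal_mult'' mult.assoc)
      also have "\<dots> = ennreal (sqrt (\<mu> \<alpha>)) * ennreal (sqrt 2 * exp (- \<omega>)) * (\<Sum>k. ennreal (exp (- real k)))"
        by simp
      also have "(\<Sum>k. ennreal (exp (- real k))) = ennreal G"
        unfolding G_def by (rule suminf_ennreal2[OF _ sG]) simp
      finally show ?thesis using G0 by (simp add: ennreal_mult'' mult.assoc)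
    qed
    finally show ?thesis unfolding \<theta>_def lb_def .
  qed
  have "expected_posterior M p0 A lam Q n S \<le>
    emeasure (sample_measure n M p0)
      {X \<in> space (sample_measure n M p0). (\<integral>\<^sup>+p. lik_ratio n p X \<partial>Q n (b n)) < ennreal t} +
    (\<integral>\<^sup>+\<alpha>. (\<integral>\<^sup>+X. min 1 (ennreal (pmf (lam n) \<alpha> / (pmf (lam n) (b n) * t)) * (\<integral>\<^sup>+p. lik_ratio n p X \<partial>Q n \<alpha>))
      \<partial>sample_measure n M p0) \<partial>count_space S)"
    unfolding expected_posterior_def
    by (rule expectation_posterior_index_le[OF A_countable[OF n] priors[OF n] b_in_A[OF n] b_weight_pos[OF n] S t])
  also have "\<dots> \<le> ennreal (2 / (c\<^sup>2 * \<tau> n)) +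
    (\<integral>\<^sup>+\<alpha>. ennreal (2 * exp ((1 + c) * \<tau> n)) * ennreal (ratio n \<alpha> (r \<alpha>)) +
      ennreal (sqrt (\<mu> \<alpha>)) * ennreal (sqrt 2 * exp (- \<omega>) * G) \<partial>count_space S)"
  proof (intro add_mono nn_integral_mono per)
    interpret prior M p0 d "Q n (b n)" by (rule priors[OF n b_in_A[OF n]])
    show "emeasure (sample_measure n M p0)
      {X \<in> space (sample_measure n M p0). (\<integral>\<^sup>+p. lik_ratio n p X \<partial>Q n (b n)) < ennreal t} \<le>
      ennreal (2 / (c\<^sup>2 * \<tau> n))"
      using evidence_lower_bound[OF b_mass_pos[OF n] eps_pos[OF n b_in_A[OF n]] n c]
      unfolding t_def wK_def by (simp add: mult.assoc)
  qed simp
  also have "(\<integral>\<^sup>+\<alpha>. ennreal (2 * exp ((1 + c) * \<tau> n)) * ennreal (ratio n \<alpha> (r \<alpha>)) +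
      ennreal (sqrt (\<mu> \<alpha>)) * ennreal (sqrt 2 * exp (- \<omega>) * G) \<partial>count_space S) =
    ennreal (2 * exp ((1 + c) * \<tau> n)) * (\<integral>\<^sup>+\<alpha>. ennreal (ratio n \<alpha> (r \<alpha>)) \<partial>count_space S) +
    (\<integral>\<^sup>+\<alpha>. ennreal (sqrt (\<mu> \<alpha>)) \<partial>count_space S) * ennreal (sqrt 2 * exp (- \<omega>) * G)"
    by (simp add: nn_integral_add nn_integral_cmult nn_integral_multc)
  also have "ennreal (2 * exp ((1 + c) * \<tau> n)) * (\<integral>\<^sup>+\<alpha>. ennreal (ratio n \<alpha> (r \<alpha>)) \<partial>count_space S) =
    ennreal (2 * exp ((1 + c) * \<tau> n) * (\<Sum>\<^sub>\<infinity>\<alpha>\<in>S. ratio n \<alpha> (r \<alpha>)))"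
    unfolding ratio_infsum[OF n S] by (simp add: ennreal_mult')
  finally show ?thesis unfolding G_def by (simp add: add.assoc)
qed

section \<open>Distant models, and scale comparison with the reference index\<close>

abbreviation "distant H n s \<equiv> {\<alpha> \<in> upper H n. dist_to_model d p0 (space (Q n \<alpha>)) > s}"

text \<open>A model farther than \<open>s\<close> has an empty ball of radius \<open>s'\<close>, so
  the central-ball term of the posterior bound vanishes for it.\<close>

lemma ratio_distant:
  assumes n: "n \<ge> 1" and a: "\<alpha> \<in> distant H n s" and s: "s' \<le> s"
  shows "ratio n \<alpha> s' = 0"
proof -
  interpret prior M p0 d "Q n \<alpha>" using a priors[OF n] by (auto simp: idx_above_def)
  have "dist_nbhd d p0 (space (Q n \<alpha>)) s' = {}"
  proof (rule dist_nbhd_eq_empty)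
    show "bdd_below ((\<lambda>p. d p0 p) ` space (Q n \<alpha>))"
      using model d_nonneg[OF p0] by (intro bdd_belowI[of _ 0]) auto
    show "s' < dist_to_model d p0 (space (Q n \<alpha>))" using a s by auto
    show "d p p0 = d p0 p" if "p \<in> space (Q n \<alpha>)" for p
      using model that d_commute[OF p0] by auto
  qed
  then show ?thesis by (simp add: prior_ratio_def)
qed

lemma infsum_ratio_distant:
  assumes "n \<ge> 1" "s' \<le> s"
  shows "(\<Sum>\<^sub>\<infinity>\<alpha>\<in>distant H n s. ratio n \<alpha> s') = 0"
  using ratio_distant[OF assms(1) _ assms(2)] by (intro infsum_0) auto

lemma lower_scale:
  assumes "\<alpha> \<in> lower H n" "1 \<le> H"
  shows "\<tau> n \<le> real n * (eps n \<alpha>)\<^sup>2"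
proof -
  have "1 * (eps n (b n))\<^sup>2 \<le> H * (eps n (b n))\<^sup>2" using assms(2) by (intro mult_right_mono) auto
  then have "(eps n (b n))\<^sup>2 \<le> (eps n \<alpha>)\<^sup>2" using assms(1) by (simp add: idx_below_def)
  then show ?thesis by (intro mult_left_mono) auto
qed

text \<open>A model above the reference index may have a scale up to \<open>sqrt H\<close> times
  larger, and its entropy is controlled only from that scale on; the first shell must therefore
  start late enough.\<close>

lemma upper_scale:
  assumes n: "n \<ge> 1" and a: "\<alpha> \<in> upper H n" and H: "1 \<le> H" and k0: "2 * sqrt H \<le> real k0 + 1"
  shows "eps n \<alpha> \<le> (real k0 + 1) / 2 * eps n (b n)"
proof -
  have pos: "0 < eps n (b n)" using eps_pos[OF n b_in_A[OF n]] .
  have "(eps n \<alpha>)\<^sup>2 \<le> H * (eps n (b n))\<^sup>2" using a by (simp add: idx_above_def)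
  also have "\<dots> = (sqrt H * eps n (b n))\<^sup>2" using H by (simp add: power_mult_distrib)
  finally have "eps n \<alpha> \<le> sqrt H * eps n (b n)"
    by (rule power2_le_imp_le) (use H pos in auto)
  also have "\<dots> \<le> (real k0 + 1) / 2 * eps n (b n)" using k0 pos by (intro mult_right_mono) auto
  finally show ?thesis .
qed

lemma upper_entropy:
  assumes n: "n \<ge> 1" and a: "\<alpha> \<in> upper H n" and E: "entropy_bounds A eps b H E E1 E2"
  shows "E \<alpha> * real n * (eps n \<alpha>)\<^sup>2 \<le> E1 * \<tau> n"
proof -
  have pos: "0 < (eps n (b n))\<^sup>2" using eps_pos[OF n b_in_A[OF n]] by simp
  have "E \<alpha> * (eps n \<alpha>)\<^sup>2 / (eps n (b n))\<^sup>2 \<le> E1" using E n a unfolding entropy_bounds_def by blast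
  then have "E \<alpha> * (eps n \<alpha>)\<^sup>2 \<le> E1 * (eps n (b n))\<^sup>2" using pos by (simp add: pos_divide_le_eq)
  then have "real n * (E \<alpha> * (eps n \<alpha>)\<^sup>2) \<le> real n * (E1 * (eps n (b n))\<^sup>2)" by (rule mult_left_mono) simp
  then show ?thesis by (simp only: mult_ac)
qed

lemma lower_entropy:
  assumes n: "n \<ge> 1" and a: "\<alpha> \<in> lower H n" and E: "entropy_bounds A eps b H E E1 E2"
  shows "E \<alpha> * real n * (eps n \<alpha>)\<^sup>2 \<le> E2 * (real n * (eps n \<alpha>)\<^sup>2)"
proof -
  have "E \<alpha> \<le> E2" using E n a unfolding entropy_bounds_def by blast
  then have "E \<alpha> * (real n * (eps n \<alpha>)\<^sup>2) \<le> E2 * (real n * (eps n \<alpha>)\<^sup>2)" by (rule mult_right_mono) simp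
  then show ?thesis by (simp only: mult_ac)
qed

text \<open>The outer radius of shell \<open>k\<close> is the multiple \<open>k + 1\<close> of the
  scale, so the prior condition is used at \<open>i = Suc k\<close>.\<close>

lemma lower_prior:
  assumes n: "n \<ge> 1" and a: "\<alpha> \<in> lower H n" and P: "prior_cond_below M p0 d A lam Q eps b H L I mu"
    and k: "I \<le> real k + 1"
  shows "ratio n \<alpha> ((real k + 1) * eps n \<alpha>) \<le> mu n \<alpha> * exp (L * (real k + 1)\<^sup>2 * real n * (eps n \<alpha>)\<^sup>2)"
proof -
  have k1: "real (Suc k) = real k + 1" by simp
  have "real (Suc k) \<ge> I" using k by simp
  then have "ratio n \<alpha> (real (Suc k) * eps n \<alpha>) \<le> mu n \<alpha> * exp (L * (real (Suc k))\<^sup>2 * real n * (eps n \<alpha>)\<^sup>2)"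
    using P n a unfolding prior_cond_below_def by blast
  then show ?thesis unfolding k1 .
qed

lemma upper_prior:
  assumes n: "n \<ge> 1" and a: "\<alpha> \<in> upper H n" and P: "prior_cond_above M p0 d A lam Q eps b H L I mu"
    and k: "I \<le> real k + 1"
  shows "ratio n \<alpha> ((real k + 1) * eps n (b n)) \<le> mu n \<alpha> * exp (L * (real k + 1)\<^sup>2 * real n * (eps n (b n))\<^sup>2)"
proof -
  have k1: "real (Suc k) = real k + 1" by simp
  have "real (Suc k) \<ge> I" using k by simp
  then have "ratio n \<alpha> (real (Suc k) * eps n (b n)) \<le>
      mu n \<alpha> * exp (L * (real (Suc k))\<^sup>2 * real n * (eps n (b n))\<^sup>2)"
    using P n a unfolding prior_cond_above_def by blast
  then show ?thesis unfolding k1 .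
qed

text \<open>The choice is \<open>c = 1\<close> and \<omega> equal to
  \<open>3 / 2 * \<tau> n\<close>: of this, \<open>\<tau> n\<close> pays for the sum of the
  \<open>sqrt (mu n \<alpha>)\<close>, and the remaining half makes the shell term small.\<close>

lemma expected_posterior_bound_increasing_rate:
  fixes e r :: "'a \<Rightarrow> real"
  assumes n: "n \<ge> 1" and S: "S \<subseteq> A n" and k0: "6 \<le> k0"
    and ent: "entropy_cond p0 d A Q eps E"
    and e: "\<And>\<alpha>. \<alpha> \<in> S \<Longrightarrow> 0 < e \<alpha>"
    and r: "\<And>\<alpha>. \<alpha> \<in> S \<Longrightarrow> real k0 * e \<alpha> \<le> r \<alpha>"
    and eps_le: "\<And>\<alpha>. \<alpha> \<in> S \<Longrightarrow> eps n \<alpha> \<le> (real k0 + 1) / 2 * e \<alpha>"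
    and F: "\<And>\<alpha>. \<alpha> \<in> S \<Longrightarrow> E \<alpha> * real n * (eps n \<alpha>)\<^sup>2 \<le> F * (real n * (e \<alpha>)\<^sup>2)"
    and prior_le: "\<And>\<alpha> k. \<alpha> \<in> S \<Longrightarrow> k0 \<le> k \<Longrightarrow>
      ratio n \<alpha> ((real k + 1) * e \<alpha>) \<le> mu n \<alpha> * exp (L * (real k + 1)\<^sup>2 * real n * (e \<alpha>)\<^sup>2)"
    and scale: "\<And>\<alpha>. \<alpha> \<in> S \<Longrightarrow> \<tau> n \<le> real n * (e \<alpha>)\<^sup>2"
    and \<tau>2: "2 \<le> \<tau> n" and L: "L \<le> 1 / 18" and Fk: "36 * (F + 1) \<le> (real k0 + 1)\<^sup>2"
    and mu: "(\<integral>\<^sup>+\<alpha>. ennreal (sqrt (mu n \<alpha>)) \<partial>count_space (A n)) \<le> ennreal (exp (\<tau> n))"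
  shows "expected_posterior M p0 A lam Q n S \<le>
      ennreal (2 / \<tau> n + 2 * exp (2 * \<tau> n) * (\<Sum>\<^sub>\<infinity>\<alpha>\<in>S. ratio n \<alpha> (r \<alpha>)) +
        sqrt 2 * exp (- \<tau> n / 2) * (\<Sum>k. exp (- real k)))"
proof -
  let ?G = "\<Sum>k. exp (- real k)" and ?s = "\<Sum>\<^sub>\<infinity>\<alpha>\<in>S. ratio n \<alpha> (r \<alpha>)"
  have rate: "(1 + 1) / 2 * \<tau> n + real n * (e \<alpha>)\<^sup>2 *
        (F + L * (real (k + k0) + 1)\<^sup>2 / 2 - (2 * real (k + k0) - 1)\<^sup>2 / 18) \<le> - (3 / 2 * \<tau> n) - real k"
    if a: "\<alpha> \<in> S" for \<alpha> k
  proof -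
    define j where "j = real (k + k0)"
    have j: "6 \<le> j" "real k + 6 \<le> j" using k0 by (simp_all add: j_def)
    have "(real k0 + 1)\<^sup>2 \<le> (j + 1)\<^sup>2" by (intro power_mono) (simp_all add: j_def)
    then have "36 * (F + 1) \<le> (j + 1)\<^sup>2" by (rule order.trans[OF Fk])
    moreover have "36 * (F + 1) \<le> y \<Longrightarrow> F \<le> y / 36 - 1" for y by simp
    ultimately have "F \<le> (j + 1)\<^sup>2 / 36 - 1" by blast
    then have "F + L * (j + 1)\<^sup>2 / 2 - (2 * j - 1)\<^sup>2 / 18 \<le>
        (j + 1)\<^sup>2 / 36 - 1 + - (7 * j\<^sup>2 - 10 * j + 1) / 36"
      using shell_exponent_le[OF L, of j] j by linarith
    \<comment> \<open>The \<open>- 1\<close>, provided by the \<open>+ 1\<close> in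
      \<open>Fk\<close>, offsets the evidence exponent; the other term, with
      \<open>6 \<le> j\<close>, pays for \<omega> and for the geometric decay.\<close>
    also have "\<dots> = - 1 - j * (j - 2) / 6" by (simp add: power2_eq_square field_simps)
    also have "\<dots> \<le> - 1 - j * 4 / 6"
      using j by (intro diff_left_mono divide_right_mono mult_left_mono) auto
    finally have X: "F + L * (j + 1)\<^sup>2 / 2 - (2 * j - 1)\<^sup>2 / 18 \<le> - (1 + 2 * j / 3)" by simp
    have "real n * (e \<alpha>)\<^sup>2 * (F + L * (j + 1)\<^sup>2 / 2 - (2 * j - 1)\<^sup>2 / 18) \<le>
        real n * (e \<alpha>)\<^sup>2 * - (1 + 2 * j / 3)"
      by (rule mult_left_mono[OF X]) simp
    also have "\<dots> \<le> - (\<tau> n * (1 + 2 * j / 3))"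
    proof -
      have "\<tau> n * (1 + 2 * j / 3) \<le> real n * (e \<alpha>)\<^sup>2 * (1 + 2 * j / 3)"
        using scale[OF a] j by (intro mult_right_mono) auto
      then show ?thesis by (simp only: mult_minus_right neg_le_iff_le)
    qed
    finally have "\<tau> n + real n * (e \<alpha>)\<^sup>2 * (F + L * (j + 1)\<^sup>2 / 2 - (2 * j - 1)\<^sup>2 / 18) \<le>
        - (\<tau> n * (2 * j / 3))"
      by (simp add: distrib_left)
    \<comment> \<open>Here \<open>\<tau> n \<ge> 2\<close> turns the slope \<open>2 / 3\<close> in
      \<open>k\<close> into one of at least 1.\<close>
    moreover have "3 / 2 * \<tau> n + real k \<le> \<tau> n * (2 * j / 3)"
    proof -
      have "\<tau> n * (2 * (real k + 6) / 3) \<le> \<tau> n * (2 * j / 3)"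
        using j \<tau>2 by (intro mult_left_mono) auto
      moreover have "2 * (2 * real k / 3) \<le> \<tau> n * (2 * real k / 3)"
        using \<tau>2 by (intro mult_right_mono) auto
      moreover have "\<tau> n * (2 * (real k + 6) / 3) = \<tau> n * (2 * real k / 3) + 4 * \<tau> n"
        by (simp add: algebra_simps)
      ultimately show ?thesis using \<tau>2 by simp
    qed
    moreover have "(1 + 1) / 2 * t + x \<le> - y - z" if "t + x \<le> - w" "y + z \<le> w" for t w x y z :: real
      using that by simp
    ultimately show ?thesis unfolding j_def[symmetric] by blast
  qed
  note G0 = suminf_exp_neg_nonneg
  have s0: "0 \<le> ?s" by (intro infsum_nonneg prior_ratio_nonneg)
  have mu': "(\<integral>\<^sup>+\<alpha>. ennreal (sqrt (mu n \<alpha>)) \<partial>count_space S) \<le> ennreal (exp (\<tau> n))"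
    using nn_integral_count_space_mono_set[OF S] mu by (rule order.trans)
  have k01: "1 \<le> k0" using k0 by simp
  have "expected_posterior M p0 A lam Q n S \<le> ennreal (2 / (1\<^sup>2 * \<tau> n)) +
      ennreal (2 * exp ((1 + 1) * \<tau> n) * ?s) +
      (\<integral>\<^sup>+\<alpha>. ennreal (sqrt (mu n \<alpha>)) \<partial>count_space S) * ennreal (sqrt 2 * exp (- (3 / 2 * \<tau> n)) * ?G)"
    by (rule expected_posterior_bound[OF n S _ k01 ent e r eps_le F prior_le rate]) simp
  also have "\<dots> \<le> ennreal (2 / (1\<^sup>2 * \<tau> n)) + ennreal (2 * exp ((1 + 1) * \<tau> n) * ?s) +
      ennreal (exp (\<tau> n)) * ennreal (sqrt 2 * exp (- (3 / 2 * \<tau> n)) * ?G)"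
    by (intro add_left_mono mult_right_mono mu') simp
  also have "ennreal (exp (\<tau> n)) * ennreal (sqrt 2 * exp (- (3 / 2 * \<tau> n)) * ?G) =
      ennreal (sqrt 2 * exp (- \<tau> n / 2) * ?G)"
  proof -
    have "exp (\<tau> n) * exp (- (3 / 2 * \<tau> n)) = exp (- \<tau> n / 2)"
      by (simp only: exp_add[symmetric]) (simp add: field_simps)
    moreover have "x * (sqrt 2 * y * ?G) = sqrt 2 * (x * y) * ?G" for x y :: real by simp
    ultimately have "exp (\<tau> n) * (sqrt 2 * exp (- (3 / 2 * \<tau> n)) * ?G) = sqrt 2 * exp (- \<tau> n / 2) * ?G"
      by simp
    then show ?thesis by (simp only: ennreal_mult'[symmetric] exp_ge_zero)
  qed
  also have "ennreal (2 / (1\<^sup>2 * \<tau> n)) + ennreal (2 * exp ((1 + 1) * \<tau> n) * ?s) +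
      ennreal (sqrt 2 * exp (- \<tau> n / 2) * ?G) =
      ennreal (2 / \<tau> n + 2 * exp (2 * \<tau> n) * ?s + sqrt 2 * exp (- \<tau> n / 2) * ?G)"
    using s0 G0 by (simp add: ennreal_plus[symmetric] del: ennreal_plus)
  finally show ?thesis .
qed

text \<open>With \<open>\<tau> n = 1\<close> there is no decay in \<open>n\<close> to exploit;
  smallness of the shell term comes from a large first shell \<open>k0\<close> instead.\<close>

lemma expected_posterior_bound_constant_rate:
  fixes e r :: "'a \<Rightarrow> real"
  assumes n: "n \<ge> 1" and S: "S \<subseteq> A n" and k0: "8 + 4 * \<bar>F\<bar> \<le> real k0" and c: "0 < c"
    and ent: "entropy_cond p0 d A Q eps E"
    and e: "\<And>\<alpha>. \<alpha> \<in> S \<Longrightarrow> 0 < e \<alpha>"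
    and r: "\<And>\<alpha>. \<alpha> \<in> S \<Longrightarrow> real k0 * e \<alpha> \<le> r \<alpha>"
    and eps_le: "\<And>\<alpha>. \<alpha> \<in> S \<Longrightarrow> eps n \<alpha> \<le> (real k0 + 1) / 2 * e \<alpha>"
    and F: "\<And>\<alpha>. \<alpha> \<in> S \<Longrightarrow> E \<alpha> * real n * (eps n \<alpha>)\<^sup>2 \<le> F * (real n * (e \<alpha>)\<^sup>2)"
    and prior_le: "\<And>\<alpha> k. \<alpha> \<in> S \<Longrightarrow> k0 \<le> k \<Longrightarrow>
      ratio n \<alpha> ((real k + 1) * e \<alpha>) \<le> mu n \<alpha> * exp (L * (real k + 1)\<^sup>2 * real n * (e \<alpha>)\<^sup>2)"
    and scale: "\<And>\<alpha>. \<alpha> \<in> S \<Longrightarrow> \<tau> n \<le> real n * (e \<alpha>)\<^sup>2"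
    and \<tau>1: "\<tau> n = 1" and L: "L \<le> 1 / 18" and C: "0 \<le> C"
    and mu: "(\<integral>\<^sup>+\<alpha>. ennreal (sqrt (mu n \<alpha>)) \<partial>count_space (A n)) \<le> ennreal C"
  shows "expected_posterior M p0 A lam Q n S \<le>
      ennreal (2 / c\<^sup>2 + 2 * exp (1 + c) * (\<Sum>\<^sub>\<infinity>\<alpha>\<in>S. ratio n \<alpha> (r \<alpha>)) +
        C * (sqrt 2 * exp ((1 + c) / 2 - real k0) * (\<Sum>k. exp (- real k))))"
proof -
  let ?G = "\<Sum>k. exp (- real k)" and ?s = "\<Sum>\<^sub>\<infinity>\<alpha>\<in>S. ratio n \<alpha> (r \<alpha>)"
  have rate: "(1 + c) / 2 * \<tau> n + real n * (e \<alpha>)\<^sup>2 *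
        (F + L * (real (k + k0) + 1)\<^sup>2 / 2 - (2 * real (k + k0) - 1)\<^sup>2 / 18) \<le>
        - (real k0 - (1 + c) / 2) - real k"
    if a: "\<alpha> \<in> S" for \<alpha> k
  proof -
    define j where "j = real (k + k0)"
    have j: "8 + 4 * \<bar>F\<bar> \<le> j" "j = real k0 + real k" using k0 by (simp_all add: j_def)
    have "F \<le> j / 4" using j by linarith
    then have "F + L * (j + 1)\<^sup>2 / 2 - (2 * j - 1)\<^sup>2 / 18 \<le> j / 4 + - (7 * j\<^sup>2 - 10 * j + 1) / 36"
      using shell_exponent_le[OF L, of j] j by linarith
    \<comment> \<open>Over the denominator 36 the linear terms add up to \<open>55 * j\<close>,
      while \<open>8 \<le> j\<close> gives \<open>56 * j \<le> 7 * j\<^sup>2\<close>.\<close>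
    also have "\<dots> \<le> - j"
    proof -
      have "8 * j \<le> j * j" using j by (intro mult_right_mono) auto
      then show ?thesis using j by (simp add: power2_eq_square field_simps)
    qed
    finally have X: "F + L * (j + 1)\<^sup>2 / 2 - (2 * j - 1)\<^sup>2 / 18 \<le> - j" .
    have "real n * (e \<alpha>)\<^sup>2 * (F + L * (j + 1)\<^sup>2 / 2 - (2 * j - 1)\<^sup>2 / 18) \<le> real n * (e \<alpha>)\<^sup>2 * - j"
      by (rule mult_left_mono[OF X]) simp
    also have "\<dots> \<le> - (1 * j)"
    proof -
      have "1 * j \<le> real n * (e \<alpha>)\<^sup>2 * j" using scale[OF a] j unfolding \<tau>1 by (intro mult_right_mono) auto
      then show ?thesis by (simp only: mult_minus_right neg_le_iff_le)
    qed
    finally show ?thesis unfolding j_def[symmetric] \<tau>1 using j(2) by simp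
  qed
  note G0 = suminf_exp_neg_nonneg
  have s0: "0 \<le> ?s" by (intro infsum_nonneg prior_ratio_nonneg)
  have mu': "(\<integral>\<^sup>+\<alpha>. ennreal (sqrt (mu n \<alpha>)) \<partial>count_space S) \<le> ennreal C"
    using nn_integral_count_space_mono_set[OF S] mu by (rule order.trans)
  have k01: "1 \<le> k0" using k0 by linarith
  have "expected_posterior M p0 A lam Q n S \<le> ennreal (2 / (c\<^sup>2 * \<tau> n)) +
      ennreal (2 * exp ((1 + c) * \<tau> n) * ?s) +
      (\<integral>\<^sup>+\<alpha>. ennreal (sqrt (mu n \<alpha>)) \<partial>count_space S) *
        ennreal (sqrt 2 * exp (- (real k0 - (1 + c) / 2)) * ?G)"
    by (rule expected_posterior_bound[OF n S c k01 ent e r eps_le F prior_le rate])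
  also have "\<dots> \<le> ennreal (2 / (c\<^sup>2 * \<tau> n)) + ennreal (2 * exp ((1 + c) * \<tau> n) * ?s) +
      ennreal C * ennreal (sqrt 2 * exp (- (real k0 - (1 + c) / 2)) * ?G)"
    by (intro add_left_mono mult_right_mono mu') simp
  also have "\<dots> = ennreal (2 / c\<^sup>2 + 2 * exp (1 + c) * ?s +
      C * (sqrt 2 * exp ((1 + c) / 2 - real k0) * ?G))"
  proof -
    have "ennreal C * ennreal (sqrt 2 * exp (- (real k0 - (1 + c) / 2)) * ?G) =
        ennreal (C * (sqrt 2 * exp ((1 + c) / 2 - real k0) * ?G))"
      by (simp only: ennreal_mult'[OF C] minus_diff_eq)
    moreover have "0 \<le> 2 / c\<^sup>2" "0 \<le> 2 * exp (1 + c) * ?s"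
      "0 \<le> C * (sqrt 2 * exp ((1 + c) / 2 - real k0) * ?G)"
      using s0 G0 C by simp_all
    ultimately show ?thesis unfolding \<tau>1 by (simp only: ennreal_plus add_nonneg_nonneg mult_1_right)
  qed
  finally show ?thesis .
qed

text \<open>The Chebyshev and shell terms vanish because \<open>\<tau> n\<close> grows. The central
  term vanishes in the limit by \<open>prior_cond_sum\<close> for indices below, and identically for
  distant ones.\<close>

lemma increasing_rate_limits:
  assumes \<tau>: "filterlim \<tau> at_top sequentially"
    and B: "0 < B" and E_pos: "\<forall>n\<ge>1. \<forall>\<alpha>\<in>A n. 0 < E \<alpha>" and H: "1 \<le> H" and I: "2 < I"
    and ent: "entropy_cond p0 d A Q eps E"
    and below: "prior_cond_below M p0 d A lam Q eps b H L I mu"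
    and above: "prior_cond_above M p0 d A lam Q eps b H L I mu"
    and sum: "prior_cond_sum M p0 d A lam Q eps b H B I"
    and E12: "entropy_bounds A eps b H E E1 E2"
    and BH: "B > sqrt H" and KB: "1 / 9 * B\<^sup>2 > max (H * E2) E1 + 1"
    and KL: "B\<^sup>2 * I\<^sup>2 * (1 / 9 - 2 * L) > 3"
    and mu: "\<forall>n\<ge>1. (\<integral>\<^sup>+\<alpha>. ennreal (sqrt (mu n \<alpha>)) \<partial>count_space (A n)) \<le> ennreal (exp (\<tau> n))"
  shows "(\<lambda>n. expected_posterior M p0 A lam Q n (lower H n)) \<longlonglongrightarrow> 0"
    and "(\<lambda>n. expected_posterior M p0 A lam Q n (distant H n (I * B * eps n (b n)))) \<longlonglongrightarrow> 0"
proof -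
  let ?G = "\<Sum>k. exp (- real k)"
  \<comment> \<open>The reference index lies in its own upper set, where the quotient in
    \<open>entropy_bounds\<close> is \<open>E (b 1)\<close>. Hence \<open>E1\<close> is positive,
    and the condition on \<open>B\<close> forces \<open>3 < B\<close>.\<close>
  have "b 1 \<in> upper H 1"
    using b_in_A[of 1] H mult_right_mono[OF H, of "(eps 1 (b 1))\<^sup>2"] by (simp add: idx_above_def)
  then have "E (b 1) * (eps 1 (b 1))\<^sup>2 / (eps 1 (b 1))\<^sup>2 \<le> E1" using E12 unfolding entropy_bounds_def by blast
  then have "E (b 1) \<le> E1" using b_in_A[of 1] eps_pos[of 1 "b 1"] by simp
  moreover have "0 < E (b 1)" by (rule E_pos[rule_format, OF order.refl b_in_A[OF order.refl]])
  ultimately have "0 < E1" by linarith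
  then have "1 < 1 / 9 * B\<^sup>2" using KB by linarith
  then have "3\<^sup>2 < B\<^sup>2" by simp
  then have B3: "3 < B" by (rule power2_less_imp_less) (use B in auto)
  have "0 < 1 / 9 - 2 * L"
  proof (rule ccontr)
    assume "\<not> 0 < 1 / 9 - 2 * L"
    then have "B\<^sup>2 * I\<^sup>2 * (1 / 9 - 2 * L) \<le> 0" by (intro mult_nonneg_nonpos) auto
    then show False using KL by linarith
  qed
  then have L18: "L \<le> 1 / 18" by simp
  \<comment> \<open>The largest integer with \<open>k0 \<le> I * B\<close>, so the shells start
    inside the radius of the central term; \<open>k0 + 1\<close> still exceeds \<open>2 * B\<close>,
    which yields \<open>Fk\<close>, and \<open>k0 \<ge> 6\<close> follows from \<open>B > 3\<close>
    and \<open>I > 2\<close>.\<close>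
  define k0 where "k0 = nat \<lfloor>I * B\<rfloor>"
  have IB: "2 * B < I * B" "I * 3 < I * B" using I B B3 by simp_all
  have k0_le: "real k0 \<le> I * B" and k0_gt: "I * B < real k0 + 1"
    using IB B by (auto simp: k0_def)
  have k06: "6 \<le> k0" unfolding k0_def using IB B3 by linarith
  have kI: "I \<le> real k + 1" if "k0 \<le> k" for k
  proof -
    have "I \<le> I * 3" using I by simp
    then show ?thesis using IB k0_gt that by linarith
  qed
  have Fk: "36 * (F + 1) \<le> (real k0 + 1)\<^sup>2" if "F + 1 < 1 / 9 * B\<^sup>2" for F
  proof -
    have "2 * B \<le> real k0 + 1" using IB k0_gt by linarith
    then have "(2 * B)\<^sup>2 \<le> (real k0 + 1)\<^sup>2" using B by (intro power_mono) auto
    moreover have "36 * (F + 1) \<le> (2 * B)\<^sup>2" using that by (simp add: power_mult_distrib)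
    ultimately show ?thesis by (rule order.trans[rotated])
  qed
  define s where "s n = (\<Sum>\<^sub>\<infinity>\<alpha>\<in>lower H n. ratio n \<alpha> (I * B * eps n \<alpha>))" for n
  have s_lim: "(\<lambda>n. exp (2 * \<tau> n) * s n) \<longlonglongrightarrow> 0"
  proof -
    have "(\<lambda>n. s n / exp (- 2 * real n * (eps n (b n))\<^sup>2)) \<longlonglongrightarrow> 0"
      using smalloD_tendsto[OF sum[unfolded prior_cond_sum_def]] unfolding s_def .
    moreover have "s n / exp (- 2 * real n * (eps n (b n))\<^sup>2) = exp (2 * \<tau> n) * s n" for n
      by (simp add: exp_minus mult.assoc field_simps)
    ultimately show ?thesis by simp
  qed
  have lim0: "(\<lambda>n. 2 / \<tau> n + sqrt 2 * exp (- \<tau> n / 2) * ?G) \<longlonglongrightarrow> 0"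
  proof -
    have 1: "(\<lambda>n. 2 / \<tau> n) \<longlonglongrightarrow> 0" by (rule tendsto_divide_0[OF tendsto_const filterlim_at_top_imp_at_infinity[OF \<tau>]])
    have "filterlim (\<lambda>n. 1 / 2 * \<tau> n) at_top sequentially"
      by (rule filterlim_tendsto_pos_mult_at_top[OF tendsto_const _ \<tau>]) simp
    then have "filterlim (\<lambda>n. - (1 / 2 * \<tau> n)) at_bot sequentially"
      by (rule filterlim_compose[OF filterlim_uminus_at_bot_at_top])
    then have "(\<lambda>n. exp (- (1 / 2 * \<tau> n))) \<longlonglongrightarrow> 0" by (rule filterlim_compose[OF exp_at_bot])
    then have "(\<lambda>n. sqrt 2 * exp (- (1 / 2 * \<tau> n)) * ?G) \<longlonglongrightarrow> sqrt 2 * 0 * ?G" by (intro tendsto_intros)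
    then have "(\<lambda>n. sqrt 2 * exp (- \<tau> n / 2) * ?G) \<longlonglongrightarrow> 0" by simp
    from tendsto_add[OF 1 this] show ?thesis by simp
  qed
  have ev2: "\<forall>\<^sub>F n in sequentially. 1 \<le> n \<and> 2 \<le> \<tau> n"
    using \<tau> by (intro eventually_conj eventually_ge_at_top) (simp add: filterlim_at_top)
  show "(\<lambda>n. expected_posterior M p0 A lam Q n (lower H n)) \<longlonglongrightarrow> 0"
  proof (rule tendsto_0_ennrealI)
    fix \<eta> :: real assume \<eta>: "0 < \<eta>"
    have "(\<lambda>n. (2 / \<tau> n + sqrt 2 * exp (- \<tau> n / 2) * ?G) + 2 * (exp (2 * \<tau> n) * s n)) \<longlonglongrightarrow> 0 + 2 * 0"
      by (intro tendsto_intros lim0 s_lim)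
    then have "\<forall>\<^sub>F n in sequentially. (2 / \<tau> n + sqrt 2 * exp (- \<tau> n / 2) * ?G) + 2 * (exp (2 * \<tau> n) * s n) < \<eta>"
      by (rule order_tendstoD(2)) (use \<eta> in simp)
    with ev2 show "\<forall>\<^sub>F n in sequentially. expected_posterior M p0 A lam Q n (lower H n) \<le> ennreal \<eta>"
    proof eventually_elim
      case (elim n)
      then have n: "1 \<le> n" and \<tau>2: "2 \<le> \<tau> n" by auto
      show ?case
      \<comment> \<open>The sign of \<open>E2\<close> is deduced from an index in this set, so the
        empty case is treated apart.\<close>
      proof (cases "lower H n = {}")
        case True
        then show ?thesis by (simp add: expected_posterior_empty)
      next
        case False
        then obtain \<alpha>0 where a0: "\<alpha>0 \<in> lower H n" by auto
        then have "E \<alpha>0 \<le> E2" "0 < E \<alpha>0"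
          using E12 E_pos n by (auto simp: entropy_bounds_def idx_below_def)
        then have "E2 \<le> H * E2" using H by simp
        then have FE: "E2 + 1 < 1 / 9 * B\<^sup>2" using KB by linarith
        have sub: "lower H n \<subseteq> A n" by (auto simp: idx_below_def)
        have "expected_posterior M p0 A lam Q n (lower H n) \<le>
          ennreal (2 / \<tau> n + 2 * exp (2 * \<tau> n) * (\<Sum>\<^sub>\<infinity>\<alpha>\<in>lower H n. ratio n \<alpha> (I * B * eps n \<alpha>)) +
            sqrt 2 * exp (- \<tau> n / 2) * ?G)"
        proof (rule expected_posterior_bound_increasing_rate[where E=E and mu=mu and n=n and S="lower H n" and e="eps n" and r="\<lambda>\<alpha>. I * B * eps n \<alpha>",
            OF n sub k06 ent _ _ _ lower_entropy[OF n _ E12]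
              lower_prior[OF n _ below kI] lower_scale[OF _ H] \<tau>2 L18 Fk[OF FE]])
          fix \<alpha> assume "\<alpha> \<in> lower H n"
          then show pos: "0 < eps n \<alpha>" using eps_pos[OF n] sub by auto
          show "real k0 * eps n \<alpha> \<le> I * B * eps n \<alpha>" using k0_le pos by (intro mult_right_mono) auto
          have "1 * eps n \<alpha> \<le> (real k0 + 1) / 2 * eps n \<alpha>" using pos k06 by (intro mult_right_mono) auto
          then show "eps n \<alpha> \<le> (real k0 + 1) / 2 * eps n \<alpha>" by simp
        qed (use mu n in auto)
        also have "\<dots> \<le> ennreal \<eta>" using elim unfolding s_def by (intro ennreal_leI) (simp add: mult.assoc)
        finally show ?thesis .
      qed
    qed
  qed
  show "(\<lambda>n. expected_posterior M p0 A lam Q n (distant H n (I * B * eps n (b n)))) \<longlonglongrightarrow> 0"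
  proof (rule tendsto_0_ennrealI)
    fix \<eta> :: real assume \<eta>: "0 < \<eta>"
    then have "\<forall>\<^sub>F n in sequentially. 2 / \<tau> n + sqrt 2 * exp (- \<tau> n / 2) * ?G < \<eta>"
      by (rule order_tendstoD(2)[OF lim0])
    with ev2 show "\<forall>\<^sub>F n in sequentially.
        expected_posterior M p0 A lam Q n (distant H n (I * B * eps n (b n))) \<le> ennreal \<eta>"
    proof eventually_elim
      case (elim n)
      then have n: "1 \<le> n" and \<tau>2: "2 \<le> \<tau> n" by auto
      let ?S = "distant H n (I * B * eps n (b n))"
      have pos: "0 < eps n (b n)" by (rule eps_pos[OF n b_in_A[OF n]])
      have FE: "E1 + 1 < 1 / 9 * B\<^sup>2" using KB by linarith
      have sub: "?S \<subseteq> A n" by (auto simp: idx_above_def)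
      have kH: "2 * sqrt H \<le> real k0 + 1" using BH IB k0_gt by linarith
      \<comment> \<open>The near radius stays within the distance threshold, so the central term is
        zero.\<close>
      have le: "real k0 * eps n (b n) \<le> I * B * eps n (b n)" using k0_le pos by (intro mult_right_mono) auto
      have "expected_posterior M p0 A lam Q n ?S \<le>
          ennreal (2 / \<tau> n + 2 * exp (2 * \<tau> n) * (\<Sum>\<^sub>\<infinity>\<alpha>\<in>?S. ratio n \<alpha> (real k0 * eps n (b n))) +
            sqrt 2 * exp (- \<tau> n / 2) * ?G)"
        by (rule expected_posterior_bound_increasing_rate[where E=E and mu=mu and n=n and S="?S" and e="\<lambda>_. eps n (b n)" and r="\<lambda>_. real k0 * eps n (b n)",
              OF n sub k06 ent pos order.refl
              upper_scale[OF n _ H kH] upper_entropy[OF n _ E12] upper_prior[OF n _ above kI]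
              order.refl \<tau>2 L18 Fk[OF FE]]) (use mu n in auto)
      also have "\<dots> \<le> ennreal \<eta>"
        unfolding infsum_ratio_distant[OF n le] using elim by (intro ennreal_leI) simp
      finally show ?case .
    qed
  qed
qed

text \<open>Three errors of size \<open>\<eta> / 3\<close>: \<open>c\<close> settles the Chebyshev
  term, then \<open>k0\<close> the shell term, and only then \<open>n\<close> tends to infinity for
  the central term.\<close>

lemma constant_rate_limits:
  assumes eps_b: "\<forall>n\<ge>1. eps n (b n) = 1 / sqrt (real n)"
    and B: "0 < B" and LK: "L < 1 / 18" and H: "1 \<le> H"
    and ent: "entropy_cond p0 d A Q eps E"
    and conds: "\<forall>\<^sub>F I in at_top.
           prior_cond_below M p0 d A lam Q eps b H L I mu \<and>
           prior_cond_above M p0 d A lam Q eps b H L I mu \<and>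
           prior_cond_sum M p0 d A lam Q eps b H B I"
    and E12: "entropy_bounds A eps b H E E1 E2"
    and mu: "\<exists>C::real. \<forall>\<^sub>F n in sequentially.
           (\<integral>\<^sup>+\<alpha>. ennreal (sqrt (mu n \<alpha>)) \<partial>count_space (A n)) \<le> ennreal C"
    and J: "filterlim J at_top sequentially"
  shows "(\<lambda>n. expected_posterior M p0 A lam Q n (lower H n)) \<longlonglongrightarrow> 0"
    and "(\<lambda>n. expected_posterior M p0 A lam Q n (distant H n (J n * eps n (b n)))) \<longlonglongrightarrow> 0"
proof -
  let ?G = "\<Sum>k. exp (- real k)"
  have L18: "L \<le> 1 / 18" using LK by simp
  obtain C0 :: real where C0: "\<forall>\<^sub>F n in sequentially.
      (\<integral>\<^sup>+\<alpha>. ennreal (sqrt (mu n \<alpha>)) \<partial>count_space (A n)) \<le> ennreal C0" using mu by blast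
  \<comment> \<open>\<open>ennreal\<close> sends a negative \<open>C0\<close> to 0, so passing to
    the positive part changes nothing.\<close>
  define C where "C = max 0 C0"
  have C: "0 \<le> C" and CC: "ennreal C0 = ennreal C" by (auto simp: C_def max_def ennreal_neg)
  obtain I0 where I0: "\<And>I. I \<ge> I0 \<Longrightarrow> prior_cond_below M p0 d A lam Q eps b H L I mu \<and>
           prior_cond_above M p0 d A lam Q eps b H L I mu \<and>
           prior_cond_sum M p0 d A lam Q eps b H B I"
    using conds unfolding eventually_at_top_linorder by blast
  have \<tau>1: "\<tau> n = 1" if "1 \<le> n" for n using eps_b that by (simp add: power_divide)
  have ev1: "\<forall>\<^sub>F n in sequentially. 1 \<le> n \<and>
      (\<integral>\<^sup>+\<alpha>. ennreal (sqrt (mu n \<alpha>)) \<partial>count_space (A n)) \<le> ennreal C"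
    using C0 unfolding CC by (intro eventually_conj eventually_ge_at_top)
  \<comment> \<open>\<open>c\<close> is fixed before \<open>k0\<close>, because the factor
    \<open>exp ((1 + c) / 2)\<close> has to be beaten by \<open>exp (- real k0)\<close>.\<close>
  have choose_k0: "\<exists>k0::nat. 8 + 4 * \<bar>E1\<bar> \<le> real k0 \<and> 8 + 4 * \<bar>E2\<bar> \<le> real k0 \<and> I0 \<le> real k0 \<and>
      2 * sqrt H \<le> real k0 \<and> C * (sqrt 2 * exp ((1 + c) / 2 - real k0) * ?G) < \<eta> / 3"
    if "0 < \<eta>" for c \<eta> :: real
  proof -
    have "filterlim (\<lambda>k. - real k) at_bot sequentially"
      by (rule filterlim_compose[OF filterlim_uminus_at_bot_at_top filterlim_real_sequentially])
    then have "(\<lambda>k. exp (- real k)) \<longlonglongrightarrow> 0" by (rule filterlim_compose[OF exp_at_bot])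
    then have "(\<lambda>k. C * (sqrt 2 * (exp ((1 + c) / 2) * exp (- real k)) * ?G)) \<longlonglongrightarrow>
        C * (sqrt 2 * (exp ((1 + c) / 2) * 0) * ?G)" by (intro tendsto_intros)
    then have "(\<lambda>k. C * (sqrt 2 * exp ((1 + c) / 2 - real k) * ?G)) \<longlonglongrightarrow> 0"
      by (simp only: exp_add[symmetric] diff_conv_add_uminus mult_zero_right mult_zero_left)
    then have "\<forall>\<^sub>F k in sequentially. C * (sqrt 2 * exp ((1 + c) / 2 - real k) * ?G) < \<eta> / 3"
      by (rule order_tendstoD(2)) (use that in simp)
    moreover have "\<forall>\<^sub>F k in sequentially. x \<le> real k" for x
      using filterlim_real_sequentially by (simp add: filterlim_at_top)
    ultimately have "\<forall>\<^sub>F k in sequentially. 8 + 4 * \<bar>E1\<bar> \<le> real k \<and> 8 + 4 * \<bar>E2\<bar> \<le> real k \<and>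
      I0 \<le> real k \<and> 2 * sqrt H \<le> real k \<and> C * (sqrt 2 * exp ((1 + c) / 2 - real k) * ?G) < \<eta> / 3"
      by (intro eventually_conj)
    then show ?thesis unfolding eventually_sequentially by blast
  qed
  show "(\<lambda>n. expected_posterior M p0 A lam Q n (lower H n)) \<longlonglongrightarrow> 0"
  proof (rule tendsto_0_ennrealI)
    fix \<eta> :: real assume \<eta>: "0 < \<eta>"
    define c where "c = sqrt (6 / \<eta>)"
    have c: "0 < c" "2 / c\<^sup>2 = \<eta> / 3" using \<eta> by (simp_all add: c_def)
    obtain k0 :: nat where k0: "8 + 4 * \<bar>E2\<bar> \<le> real k0" "I0 \<le> real k0"
      "C * (sqrt 2 * exp ((1 + c) / 2 - real k0) * ?G) < \<eta> / 3"
      using choose_k0[OF \<eta>] by blast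
    \<comment> \<open>Large enough for the assumed conditions to hold and for \<open>I * B\<close>
      to reach the first shell; this is where having them for every large \<open>I\<close> is
      used.\<close>
    define I where "I = max I0 (real k0 / B)"
    have II: "I0 \<le> I" "real k0 \<le> I * B" using B by (auto simp: I_def max_def field_simps)
    define s where "s n = (\<Sum>\<^sub>\<infinity>\<alpha>\<in>lower H n. ratio n \<alpha> (I * B * eps n \<alpha>))" for n
    have "(\<lambda>n. s n / exp (- 2 * real n * (eps n (b n))\<^sup>2)) \<longlonglongrightarrow> 0"
      using I0[OF II(1)] unfolding prior_cond_sum_def s_def by (intro smalloD_tendsto) simp
    then have "(\<lambda>n. 2 * exp (1 + c) * exp (- 2) * (s n / exp (- 2 * real n * (eps n (b n))\<^sup>2))) \<longlonglongrightarrow>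
        2 * exp (1 + c) * exp (- 2) * 0"
      by (intro tendsto_intros)
    then have "\<forall>\<^sub>F n in sequentially.
        2 * exp (1 + c) * exp (- 2) * (s n / exp (- 2 * real n * (eps n (b n))\<^sup>2)) < \<eta> / 3"
      by (rule order_tendstoD(2)) (use \<eta> in simp)
    with ev1 show "\<forall>\<^sub>F n in sequentially. expected_posterior M p0 A lam Q n (lower H n) \<le> ennreal \<eta>"
    proof eventually_elim
      case (elim n)
      then have n: "1 \<le> n" and mun: "(\<integral>\<^sup>+\<alpha>. ennreal (sqrt (mu n \<alpha>)) \<partial>count_space (A n)) \<le> ennreal C" by auto
      \<comment> \<open>The comparison function is constant here, so the little-o condition says
        that \<open>s n\<close> tends to 0.\<close>
      have eq: "- 2 * real n * (eps n (b n))\<^sup>2 = - 2" using \<tau>1[OF n] by (simp add: mult.assoc)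
      have "2 * exp (1 + c) * exp (- 2) * (s n / exp (- 2)) < \<eta> / 3" using elim unfolding eq by blast
      then have sn: "2 * exp (1 + c) * s n < \<eta> / 3" by simp
      have sub: "lower H n \<subseteq> A n" by (auto simp: idx_below_def)
      have kI: "I0 \<le> real k + 1" if "k0 \<le> k" for k using k0(2) that by linarith
      have "expected_posterior M p0 A lam Q n (lower H n) \<le>
          ennreal (2 / c\<^sup>2 + 2 * exp (1 + c) * (\<Sum>\<^sub>\<infinity>\<alpha>\<in>lower H n. ratio n \<alpha> (I * B * eps n \<alpha>)) +
            C * (sqrt 2 * exp ((1 + c) / 2 - real k0) * ?G))"
      proof (rule expected_posterior_bound_constant_rate[where E=E and mu=mu and n=n and S="lower H n" and e="eps n" and r="\<lambda>\<alpha>. I * B * eps n \<alpha>",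
            OF n sub k0(1) c(1) ent _ _ _ lower_entropy[OF n _ E12]
            lower_prior[OF n _ conjunct1[OF I0[OF order.refl]] kI] lower_scale[OF _ H] \<tau>1[OF n] L18 C mun])
        fix \<alpha> assume "\<alpha> \<in> lower H n"
        then show pos: "0 < eps n \<alpha>" using eps_pos[OF n] sub by auto
        show "real k0 * eps n \<alpha> \<le> I * B * eps n \<alpha>" using II(2) pos by (intro mult_right_mono) auto
        have "1 * eps n \<alpha> \<le> (real k0 + 1) / 2 * eps n \<alpha>" using pos k0(1) by (intro mult_right_mono) auto
        then show "eps n \<alpha> \<le> (real k0 + 1) / 2 * eps n \<alpha>" by simp
      qed auto
      also have "\<dots> \<le> ennreal \<eta>" using sn k0(3) c(2) unfolding s_def by (intro ennreal_leI) linarith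
      finally show ?case .
    qed
  qed
  show "(\<lambda>n. expected_posterior M p0 A lam Q n (distant H n (J n * eps n (b n)))) \<longlonglongrightarrow> 0"
  proof (rule tendsto_0_ennrealI)
    fix \<eta> :: real assume \<eta>: "0 < \<eta>"
    define c where "c = sqrt (6 / \<eta>)"
    have c: "0 < c" "2 / c\<^sup>2 = \<eta> / 3" using \<eta> by (simp_all add: c_def)
    obtain k0 :: nat where k0: "8 + 4 * \<bar>E1\<bar> \<le> real k0" "I0 \<le> real k0" "2 * sqrt H \<le> real k0"
      "C * (sqrt 2 * exp ((1 + c) / 2 - real k0) * ?G) < \<eta> / 3"
      using choose_k0[OF \<eta>] by blast
    \<comment> \<open>Divergence of \<open>J\<close> lets it overtake a \<open>k0\<close> that
      depends on \<eta>, after which the central term vanishes.\<close>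
    have "\<forall>\<^sub>F n in sequentially. real k0 \<le> J n" using J by (simp add: filterlim_at_top)
    with ev1 show "\<forall>\<^sub>F n in sequentially.
        expected_posterior M p0 A lam Q n (distant H n (J n * eps n (b n))) \<le> ennreal \<eta>"
    proof eventually_elim
      case (elim n)
      then have n: "1 \<le> n" and mun: "(\<integral>\<^sup>+\<alpha>. ennreal (sqrt (mu n \<alpha>)) \<partial>count_space (A n)) \<le> ennreal C"
        and Jn: "real k0 \<le> J n" by auto
      let ?S = "distant H n (J n * eps n (b n))"
      have pos: "0 < eps n (b n)" by (rule eps_pos[OF n b_in_A[OF n]])
      have sub: "?S \<subseteq> A n" by (auto simp: idx_above_def)
      have kH: "2 * sqrt H \<le> real k0 + 1" using k0(3) by linarith
      have kI: "I0 \<le> real k + 1" if "k0 \<le> k" for k using k0(2) that by linarith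
      have le: "real k0 * eps n (b n) \<le> J n * eps n (b n)" using Jn pos by (intro mult_right_mono) auto
      have "expected_posterior M p0 A lam Q n ?S \<le>
          ennreal (2 / c\<^sup>2 + 2 * exp (1 + c) * (\<Sum>\<^sub>\<infinity>\<alpha>\<in>?S. ratio n \<alpha> (real k0 * eps n (b n))) +
            C * (sqrt 2 * exp ((1 + c) / 2 - real k0) * ?G))"
        by (rule expected_posterior_bound_constant_rate[where E=E and mu=mu and n=n and S="?S" and e="\<lambda>_. eps n (b n)" and r="\<lambda>_. real k0 * eps n (b n)",
              OF n sub k0(1) c(1) ent pos order.refl
              upper_scale[OF n _ H kH] upper_entropy[OF n _ E12]
              upper_prior[OF n _ conjunct1[OF conjunct2[OF I0[OF order.refl]]] kI]
              order.refl \<tau>1[OF n] L18 C mun]) auto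
      also have "\<dots> \<le> ennreal \<eta>"
        unfolding infsum_ratio_distant[OF n le] using k0(4) c(2) \<eta> by (intro ennreal_leI) linarith
      finally show ?case .
    qed
  qed
qed

end

theorem theorem3p1:
  fixes M :: "'x measure"
    and p0 :: "'x \<Rightarrow> real"
    and d :: "('x \<Rightarrow> real) \<Rightarrow> ('x \<Rightarrow> real) \<Rightarrow> real"
    and A :: "nat \<Rightarrow> 'a set"
    and lam :: "nat \<Rightarrow> 'a pmf"
    and Q :: "nat \<Rightarrow> 'a \<Rightarrow> ('x \<Rightarrow> real) measure"
    and eps :: "nat \<Rightarrow> 'a \<Rightarrow> real"
    and b :: "nat \<Rightarrow> 'a"
    and K :: real
  assumes p0: "p0 \<in> prob_densities M"
    and d_metric: "density_metric M d"
    and d_le_h: "\<And>p q. p \<in> prob_densities M \<Longrightarrow> q \<in> prob_densities M \<Longrightarrow> d p q \<le> hellinger M p q"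
    and d_convex: "convex_balls M d"
    and A_countable: "\<And>n. n \<ge> 1 \<Longrightarrow> countable (A n)"
    and lam_on_A: "\<And>n. n \<ge> 1 \<Longrightarrow> set_pmf (lam n) \<subseteq> A n"
    and prior_prob: "\<And>n \<alpha>. n \<ge> 1 \<Longrightarrow> \<alpha> \<in> A n \<Longrightarrow> prob_space (Q n \<alpha>)"
    and model: "\<And>n \<alpha>. n \<ge> 1 \<Longrightarrow> \<alpha> \<in> A n \<Longrightarrow> space (Q n \<alpha>) \<subseteq> prob_densities M"
    and model_measurable: "\<And>n \<alpha>. n \<ge> 1 \<Longrightarrow> \<alpha> \<in> A n \<Longrightarrow>
          (\<lambda>(x, p). p x) \<in> borel_measurable (M \<Otimes>\<^sub>M Q n \<alpha>)"
    and nbhd_measurable: "\<And>n \<alpha> r. n \<ge> 1 \<Longrightarrow> \<alpha> \<in> A n \<Longrightarrow>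
          dist_nbhd d p0 (space (Q n \<alpha>)) r \<in> sets (Q n \<alpha>)"
    and eps_pos: "\<And>n \<alpha>. n \<ge> 1 \<Longrightarrow> \<alpha> \<in> A n \<Longrightarrow> 0 < eps n \<alpha>"
    and eps_lim: "\<And>\<alpha>. ((\<lambda>n. eps n \<alpha>) \<longlongrightarrow> 0) (inf sequentially (principal {n. \<alpha> \<in> A n}))"
    and b_in_A: "\<And>n. n \<ge> 1 \<Longrightarrow> b n \<in> A n"
    and b_weight_pos: "\<And>n. n \<ge> 1 \<Longrightarrow> 0 < pmf (lam n) (b n)"
    and b_mass_pos: "\<And>n. n \<ge> 1 \<Longrightarrow>
          0 < measure (Q n (b n)) (KL_nbhd M p0 (space (Q n (b n))) (eps n (b n)))"
    and K: "K = 1 / 9"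
  shows
    "(\<forall>B E L H I mu E1 E2.
        filterlim (\<lambda>n. real n * (eps n (b n))\<^sup>2) at_top sequentially \<and>
        0 < B \<and> (\<forall>n\<ge>1. \<forall>\<alpha>\<in>A n. 0 < E \<alpha>) \<and> 0 < L \<and> 1 \<le> H \<and> 2 < I \<and>
        entropy_cond p0 d A Q eps E \<and>
        prior_cond_below M p0 d A lam Q eps b H L I mu \<and>
        prior_cond_above M p0 d A lam Q eps b H L I mu \<and>
        prior_cond_sum M p0 d A lam Q eps b H B I \<and>
        entropy_bounds A eps b H E E1 E2 \<and>
        B > sqrt H \<and> K * B\<^sup>2 > max (H * E2) E1 + 1 \<and> B\<^sup>2 * I\<^sup>2 * (K - 2 * L) > 3 \<and>
        (\<forall>n\<ge>1. (\<integral>\<^sup>+\<alpha>. ennreal (sqrt (mu n \<alpha>)) \<partial>count_space (A n))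
                  \<le> ennreal (exp (real n * (eps n (b n))\<^sup>2)))
        \<longrightarrow>
        (\<lambda>n. expected_posterior M p0 A lam Q n (idx_below H (eps n) (b n) (A n)))
          \<longlonglongrightarrow> 0 \<and>
        (\<lambda>n. expected_posterior M p0 A lam Q n
           {\<alpha> \<in> idx_above H (eps n) (b n) (A n).
              dist_to_model d p0 (space (Q n \<alpha>)) > I * B * eps n (b n)})
          \<longlonglongrightarrow> 0)
     \<and>
     (\<forall>B E L H mu E1 E2.
        (\<forall>n\<ge>1. eps n (b n) = 1 / sqrt (real n)) \<and>
        0 < B \<and> (\<forall>n\<ge>1. \<forall>\<alpha>\<in>A n. 0 < E \<alpha>) \<and> 0 < L \<and> L < K / 2 \<and> 1 \<le> H \<and>
        entropy_cond p0 d A Q eps E \<and>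
        (\<forall>\<^sub>F I in at_top.
           prior_cond_below M p0 d A lam Q eps b H L I mu \<and>
           prior_cond_above M p0 d A lam Q eps b H L I mu \<and>
           prior_cond_sum M p0 d A lam Q eps b H B I) \<and>
        entropy_bounds A eps b H E E1 E2 \<and>
        (\<exists>C::real. \<forall>\<^sub>F n in sequentially.
           (\<integral>\<^sup>+\<alpha>. ennreal (sqrt (mu n \<alpha>)) \<partial>count_space (A n)) \<le> ennreal C)
        \<longrightarrow>
        (\<forall>J :: nat \<Rightarrow> real. filterlim J at_top sequentially \<longrightarrow>
          (\<lambda>n. expected_posterior M p0 A lam Q n (idx_below H (eps n) (b n) (A n)))
            \<longlonglongrightarrow> 0 \<and>
          (\<lambda>n. expected_posterior M p0 A lam Q n
             {\<alpha> \<in> idx_above H (eps n) (b n) (A n).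
                dist_to_model d p0 (space (Q n \<alpha>)) > J n * eps n (b n)})
            \<longlonglongrightarrow> 0))"
proof -
  have "density_model M p0 d"
    by (rule density_model.intro[OF p0 d_metric d_le_h d_convex])
  moreover have priors: "prior M p0 d (Q n \<alpha>)" if "n \<ge> 1" "\<alpha> \<in> A n" for n \<alpha>
    using \<open>density_model M p0 d\<close> prior_prob[OF that] model[OF that] model_measurable[OF that]
      nbhd_measurable[OF that]
    by (intro prior.intro prior_axioms.intro)
  ultimately interpret model_selection M p0 d A lam Q eps b
    by (intro model_selection.intro model_selection_axioms.intro A_countable eps_pos b_in_A b_weight_pos b_mass_pos)
  show ?thesis
    unfolding K
    apply (intro conjI allI impI; elim conjE)
    subgoal by (rule increasing_rate_limits(1); assumption)
    subgoal by (rule increasing_rate_limits(2); assumption)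
    subgoal by (rule constant_rate_limits(1); (assumption | simp))
    subgoal by (rule constant_rate_limits(2); (assumption | simp))
    done
qed

end
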